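(* Let $k$ be a natural number. Let $\mathfrak{K}$ be the class of all finite supersoluble groups $G$ such that all Sylow subgroups of $G$ are $k$-submodular in $G$, and let $\mathfrak{F}$ be the class of all finite groups $G$ such that all Sylow subgroups of $G$ are $k$-submodular in $G$. Then (1) $\mathfrak{K}=\mathfrak{U}\cap\mathrm{w}\mathfrak{U}_k$, where $\mathfrak{U}\cap\mathrm{w}\mathfrak{U}_k$ is the class of all supersoluble groups $G$ in which every Sylow subgroup of $G$ is $\mathfrak{U}_k$-subnormal; (2) $\mathfrak{F}=\mathrm{w}\mathfrak{K}$, where $\mathrm{w}\mathfrak{K}$ is the class of all groups $G$ in which every Sylow subgroup of $G$ is $\mathfrak{K}$-subnormal.
   Context: All groups are finite; natural numbers are positive integers. $\mathrm{Core}_G(H)$ denotes the intersection of all conjugates of $H$ in $G$. For a natural number $n$, a subgroup $H$ of $G$ is $n$-modularly embedded in $G$ if either $H\unlhd G$, or $G/\mathrm{Core}_G(H)$ is a non-nilpotent group of order $pq^n$ with $|G:H|=p$ for some primes $p$ and $q$. For a natural number $k$, a subgroup $H$ of $G$ is $k$-submodular in $G$ if there is a chain of subgroups $H=H_0\le H_1\le\cdots\le H_m=G$ such that for every $i=1,\dots,m$, $H_{i-1}$ is $n_i$-modularly embedded in $H_i$ for some natural number $n_i\le k$. $\mathfrak{U}$ is the class of all supersoluble groups. $\mathfrak{U}_k$ is the class of all supersoluble groups whose exponent is not divisible by the $(k+1)$th power of any prime. Both $\mathfrak{U}_k$ and $\mathfrak{K}$ are formations. For a non-empty formation $\mathfrak{H}$,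 $G^{\mathfrak{H}}$ is the least normal subgroup of $G$ with $G/G^{\mathfrak{H}}\in\mathfrak{H}$. A subgroup $H$ of $G$ is $\mathfrak{H}$-subnormal in $G$ if either $H=G$ or there is a chain of subgroups $H=H_0\le H_1\le\cdots\le H_m=G$ such that $H_i^{\mathfrak{H}}\le H_{i-1}$ for every $i=1,\dots,m$. *)

theory Defs
  imports "HOL-Algebra.Elementary_Groups" "HOL-Computational_Algebra.Primes"
begin

definition finite_group :: "('a, 'b) monoid_scheme \<Rightarrow> bool" where
  "finite_group G \<longleftrightarrow> group G \<and> finite (carrier G)"

fun lower_central :: "('a, 'b) monoid_scheme \<Rightarrow> nat \<Rightarrow> 'a set" where
  "lower_central G 0 = carrier G"
| "lower_central G (Suc i) =
     generate G {x \<otimes>\<^bsub>G\<^esub> y \<otimes>\<^bsub>G\<^esub> inv\<^bsub>G\<^esub> x \<otimes>\<^bsub>G\<^esub> inv\<^bsub>G\<^esub> y | x y. x \<in> lower_central G i \<and> y \<in> carrier G}"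

definition nilpotent_group :: "('a, 'b) monoid_scheme \<Rightarrow> bool" where
  "nilpotent_group G \<longleftrightarrow> group G \<and> (\<exists>c. lower_central G c = {\<one>\<^bsub>G\<^esub>})"

definition subgroup_chain ::
    "('a, 'b) monoid_scheme \<Rightarrow> 'a set \<Rightarrow> nat \<Rightarrow> (nat \<Rightarrow> 'a set) \<Rightarrow> bool" where
  "subgroup_chain G H m C \<longleftrightarrow>
     C 0 = H \<and> C m = carrier G \<and> (\<forall>i\<le>m. subgroup (C i) G) \<and> (\<forall>i<m. C i \<subseteq> C (Suc i))"

definition supersoluble :: "('a, 'b) monoid_scheme \<Rightarrow> bool" where
  "supersoluble G \<longleftrightarrow> group G \<and>
     (\<exists>m C. subgroup_chain G {\<one>\<^bsub>G\<^esub>} m C \<and>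
            (\<forall>i\<le>m. C i \<lhd> G) \<and>
            (\<forall>i<m. cyclic_group ((G\<lparr>carrier := C (Suc i)\<rparr>) Mod C i)))"

definition group_exponent :: "('a, 'b) monoid_scheme \<Rightarrow> nat" where
  "group_exponent G = (LEAST n. 0 < n \<and> (\<forall>x\<in>carrier G. x [^]\<^bsub>G\<^esub> n = \<one>\<^bsub>G\<^esub>))"

text \<open>For a prime not dividing the order, the trivial subgroup counts as a Sylow subgroup.\<close>

definition sylow_subgroup :: "'a set \<Rightarrow> ('a, 'b) monoid_scheme \<Rightarrow> bool" where
  "sylow_subgroup P G \<longleftrightarrow>
     subgroup P G \<and> (\<exists>p::nat. prime p \<and> card P = p ^ multiplicity p (order G))"

definition Core :: "('a, 'b) monoid_scheme \<Rightarrow> 'a set \<Rightarrow> 'a set" where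
  "Core G H = (\<Inter>g\<in>carrier G. g <#\<^bsub>G\<^esub> H #>\<^bsub>G\<^esub> inv\<^bsub>G\<^esub> g)"

definition modularly_embedded :: "nat \<Rightarrow> 'a set \<Rightarrow> ('a, 'b) monoid_scheme \<Rightarrow> bool" where
  "modularly_embedded n H G \<longleftrightarrow> subgroup H G \<and>
     (H \<lhd> G \<or>
      (\<exists>p q::nat. prime p \<and> prime q \<and>
         \<not> nilpotent_group (G Mod Core G H) \<and>
         order (G Mod Core G H) = p * q ^ n \<and>
         card (rcosets\<^bsub>G\<^esub> H) = p))"

definition submodular :: "nat \<Rightarrow> 'a set \<Rightarrow> ('a, 'b) monoid_scheme \<Rightarrow> bool" where
  "submodular k H G \<longleftrightarrow>
     (\<exists>m C. subgroup_chain G H m C \<and>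
        (\<forall>i<m. \<exists>n. 1 \<le> n \<and> n \<le> k \<and> modularly_embedded n (C i) (G\<lparr>carrier := C (Suc i)\<rparr>)))"

text \<open>
  A class of groups is given by a polymorphic constant, read at each element type as a set of
  groups. The quotients of a group over \<open>'a\<close> are groups over \<open>'a set\<close>, so the residual
  of a group over \<open>'a\<close> refers to the class at type \<open>'a set\<close>. The residual is only
  meaningful if a least such normal subgroup exists, which holds for finite groups and formations.
\<close>

definition residual :: "'a set monoid set \<Rightarrow> ('a, 'b) monoid_scheme \<Rightarrow> 'a set" where
  "residual X G = (LEAST N. N \<lhd> G \<and> G Mod N \<in> X)"

definition class_subnormal ::
    "'a set monoid set \<Rightarrow> 'a set \<Rightarrow> ('a, 'b) monoid_scheme \<Rightarrow> bool" where
  "class_subnormal X H G \<longleftrightarrow>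
     H = carrier G \<or>
     (\<exists>m C. subgroup_chain G H m C \<and>
        (\<forall>i<m. residual X (G\<lparr>carrier := C (Suc i)\<rparr>) \<subseteq> C i))"

definition class_w :: "'a set monoid set \<Rightarrow> 'a monoid set" where
  "class_w X = {G. finite_group G \<and> (\<forall>P. sylow_subgroup P G \<longrightarrow> class_subnormal X P G)}"

definition class_U :: "'a monoid set" where
  "class_U = {G. finite_group G \<and> supersoluble G}"

definition class_Uk :: "nat \<Rightarrow> 'a monoid set" where
  "class_Uk k = {G. finite_group G \<and> supersoluble G \<and>
     (\<forall>p::nat. prime p \<longrightarrow> \<not> p ^ (k + 1) dvd group_exponent G)}"

definition class_F :: "nat \<Rightarrow> 'a monoid set" where
  "class_F k = {G. finite_group G \<and> (\<forall>P. sylow_subgroup P G \<longrightarrow> submodular k P G)}"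

definition class_K :: "nat \<Rightarrow> 'a monoid set" where
  "class_K k = {G. finite_group G \<and> supersoluble G \<and>
     (\<forall>P. sylow_subgroup P G \<longrightarrow> submodular k P G)}"

end

theory Submission
  imports Defs "HOL-Algebra.Group_Action" "HOL-Algebra.Sylow" "HOL-Number_Theory.Residues"
begin

text \<open>
  A subgroup \<open>H\<close> of prime index \<open>p\<close> which is modularly embedded but not normal has, modulo its core, a very
  restricted shape: \<open>G / Core G H\<close> is a group of order \<open>p q\<^sup>n\<close> with a normal subgroup of order \<open>p\<close> and abelian
  quotient (\<open>modular_step_structure\<close>). For a core-free Sylow \<open>q\<close>-subgroup this is proved by showing that
  its \<open>p\<close> conjugates intersect trivially and counting the elements outside them. The shape has three uses.

  It makes submodularity pass to intersections with subgroups (\<open>modular_steps_Int\<close>); images and inverse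
  images are straightforward. It shows that a group whose Sylow subgroups are submodular is soluble, since
  a simple quotient cannot have a non-normal modular link at the top (\<open>prime_steps_if_sylow_modular\<close>). And it
  shows that \<open>G / Core G H\<close> lies in \<open>class_Uk k\<close>. In a soluble group the normal links of a chain refine
  to links with quotient of prime order, so every submodular chain yields a \<open>class_Uk k\<close>-subnormal one
  (\<open>class_steps_Uk_if_modular_steps\<close>).

  In the other direction, \<open>class_Uk k\<close> is contained in \<open>class_K k\<close>
  (\<open>sylow_modular_steps_if_supersoluble\<close>): in a chief series a \<open>q\<close>-subgroup acts on a factor of order \<open>p\<close>
  through a cyclic group, so its exponent controls the order of the group induced. A
  \<open>class_K k\<close>-subnormal Sylow subgroup is submodular (\<open>modular_steps_if_class_steps_K\<close>), by intersecting with
  the products of the Sylow subgroup with normal subgroups.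

  Both classes are closed under subdirect products, so the residuals in the definition of
  subnormality exist. With \<open>class_Uk k\<close>, respectively \<open>class_K k\<close>, as the class for the chains, these implications
  give both equations.
\<close>

section \<open>Normality, quotient maps and cardinalities\<close>

abbreviation restrict_carrier :: "('a, 'b) monoid_scheme \<Rightarrow> 'a set \<Rightarrow> ('a, 'b) monoid_scheme"
    (infixl "\<restriction>" 90) where
  "G\<restriction>B \<equiv> G\<lparr>carrier := B\<rparr>"

text \<open>
  Normality of \<open>N\<close> in \<open>B\<close> is expressed inside one ambient group \<open>G\<close>. Chains of subgroups
  can then be handled as chains of a relation on sets, without changing the group at each link.
\<close>

definition normal_in :: "('a, 'b) monoid_scheme \<Rightarrow> 'a set \<Rightarrow> 'a set \<Rightarrow> bool" where
  "normal_in G N B \<longleftrightarrow> subgroup N G \<and> subgroup B G \<and> N \<subseteq> B \<and>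
     (\<forall>b\<in>B. \<forall>n\<in>N. b \<otimes>\<^bsub>G\<^esub> n \<otimes>\<^bsub>G\<^esub> inv\<^bsub>G\<^esub> b \<in> N)"

lemma normal_inD:
  assumes "normal_in G N B"
  shows "subgroup N G" "subgroup B G" "N \<subseteq> B"
    "\<And>b n. b \<in> B \<Longrightarrow> n \<in> N \<Longrightarrow> b \<otimes>\<^bsub>G\<^esub> n \<otimes>\<^bsub>G\<^esub> inv\<^bsub>G\<^esub> b \<in> N"
  using assms by (auto simp: normal_in_def)

context group begin

lemma subgroup_restrict_iff:
  assumes "subgroup B G"
  shows "subgroup A (G\<restriction>B) \<longleftrightarrow> subgroup A G \<and> A \<subseteq> B"
proof
  assume "subgroup A (G\<restriction>B)"
  then show "subgroup A G \<and> A \<subseteq> B"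
    using incl_subgroup[OF assms] subgroup.subset[of A "G\<restriction>B"] by simp
next
  assume "subgroup A G \<and> A \<subseteq> B"
  then show "subgroup A (G\<restriction>B)"
    using subgroup_incl[OF _ assms] by blast
qed

lemma normal_in_carrier_iff: "normal_in G N (carrier G) \<longleftrightarrow> N \<lhd> G"
  by (auto simp: normal_in_def normal_inv_iff subgroup_self dest: subgroup.subset)

lemma normal_in_restrict_iff:
  assumes "subgroup B G" "C \<subseteq> B"
  shows "normal_in (G\<restriction>B) N C \<longleftrightarrow> normal_in G N C"
proof -
  have "inv\<^bsub>G\<restriction>B\<^esub> b = inv b" if "b \<in> C" for b
    using m_inv_consistent[OF assms(1)] that assms(2) by blast
  then have "(\<forall>b\<in>C. \<forall>n\<in>N. b \<otimes> n \<otimes> inv\<^bsub>G\<restriction>B\<^esub> b \<in> N) \<longleftrightarrow>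
      (\<forall>b\<in>C. \<forall>n\<in>N. b \<otimes> n \<otimes> inv b \<in> N)"
    by (intro ball_cong refl) (simp only:)
  moreover have "b \<otimes>\<^bsub>G\<restriction>B\<^esub> n = b \<otimes> n" for b n
    by simp
  moreover have "N \<subseteq> C \<Longrightarrow> N \<subseteq> B"
    using assms(2) by (rule subset_trans[rotated])
  ultimately show ?thesis
    using assms(2) unfolding normal_in_def subgroup_restrict_iff[OF assms(1)] by metis
qed

lemma normal_in_iff:
  assumes "subgroup B G"
  shows "normal_in G N B \<longleftrightarrow> N \<lhd> G\<restriction>B"
proof -
  interpret B: group "G\<restriction>B"
    using assms by (rule subgroup.subgroup_is_group) (rule group_axioms)
  show ?thesis
    using B.normal_in_carrier_iff[of N] normal_in_restrict_iff[OF assms, of B N] by simp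
qed

lemma normal_in_Int_subgroup:
  assumes "normal_in G N B" "subgroup U G"
  shows "normal_in G (N \<inter> U) (B \<inter> U)"
  unfolding normal_in_def
proof (intro conjI ballI)
  fix b n assume "b \<in> B \<inter> U" "n \<in> N \<inter> U"
  then show "b \<otimes> n \<otimes> inv b \<in> N \<inter> U"
    using normal_inD(4)[OF assms(1)] assms(2) by (simp add: subgroup.m_closed subgroup.m_inv_closed)
qed (use assms in \<open>auto simp: normal_in_def subgroups_Inter_pair\<close>)

lemma normal_in_subset:
  assumes "normal_in G N B" "subgroup C G" "N \<subseteq> C" "C \<subseteq> B"
  shows "normal_in G N C"
  using assms by (auto simp: normal_in_def)

lemma normal_in_refl: "subgroup B G \<Longrightarrow> normal_in G B B"
  by (auto simp: normal_in_def subgroup.m_closed subgroup.m_inv_closed)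

lemma subgroup_card_pos: "finite (carrier G) \<Longrightarrow> subgroup A G \<Longrightarrow> card A > 0"
  by (rule subgroup.finite_imp_card_positive)

lemma subgroup_finite: "finite (carrier G) \<Longrightarrow> subgroup A G \<Longrightarrow> finite A"
  by (meson finite_subset subgroup.subset)

lemma subgroup_card_dvd:
  assumes "subgroup A G" "subgroup B G" "A \<subseteq> B"
  shows "card A dvd card B"
proof -
  interpret B: group "G\<restriction>B"
    using assms(2) by (rule subgroup.subgroup_is_group) (rule group_axioms)
  have "card (rcosets\<^bsub>G\<restriction>B\<^esub> A) * card A = card B"
    using B.lagrange[OF subgroup_incl[OF assms]] by (simp add: order_def)
  then show ?thesis
    using dvd_triv_right[of "card A"] by metis
qed

end

definition preimage :: "('a, 'b) monoid_scheme \<Rightarrow> ('a \<Rightarrow> 'c) \<Rightarrow> 'c set \<Rightarrow> 'a set" where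
  "preimage G h S = {x \<in> carrier G. h x \<in> S}"

text \<open>
  Quotients of a group over \<open>'a\<close> live over \<open>'a set\<close>, so an induction on the group order cannot pass
  to a quotient. Statements are instead moved back and forth along this kind of map.
\<close>

locale finite_epi = group_hom +
  assumes surj: "h ` carrier G = carrier H" and fin: "finite (carrier G)"

context group_hom begin

lemma subgroup_preimage: "subgroup S H \<Longrightarrow> subgroup (preimage G h S) G"
  by (rule G.subgroupI) (auto simp: preimage_def subgroup.m_closed subgroup.m_inv_closed subgroup.one_closed intro: exI[of _ \<one>])

lemma normal_in_preimage: "normal_in H N B \<Longrightarrow> normal_in G (preimage G h N) (preimage G h B)"
  using subgroup_preimage by (auto simp: normal_in_def preimage_def)

lemma normal_in_image: "normal_in G N B \<Longrightarrow> normal_in H (h ` N) (h ` B)"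
  unfolding normal_in_def
  by (auto simp: subgroup_img_is_subgroup subgroup.mem_carrier simp flip: hom_mult hom_inv)

text \<open>
  The first isomorphism theorem for a restricted homomorphism, in numbers: every fibre of \<open>h\<close> on
  \<open>A\<close> is a coset of \<open>A \<inter> kernel G H h\<close>.
\<close>

lemma card_image:
  assumes A: "subgroup A G" and fin: "finite (carrier G)"
  shows "card (h ` A) * card (A \<inter> kernel G H h) = card A"
proof -
  have "finite A" using A fin by (rule G.subgroup_finite[rotated])
  then have "card A = (\<Sum>y\<in>h ` A. card {x\<in>A. h x = y})"
    using sum.image_gen[of A "\<lambda>_. 1::nat" h] by simp
  also have "\<dots> = (\<Sum>y\<in>h ` A. card (A \<inter> kernel G H h))"
  proof (rule sum.cong)
    fix y assume "y \<in> h ` A"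
    then obtain a where a: "a \<in> A" "y = h a" by auto
    have "bij_betw (\<lambda>x. x \<otimes> a) (A \<inter> kernel G H h) {x\<in>A. h x = y}"
      by (rule bij_betw_byWitness[where f' = "\<lambda>x. x \<otimes> inv a"])
        (use a A in \<open>auto simp: kernel_def subgroup.m_closed subgroup.m_inv_closed subgroup.mem_carrier G.m_assoc\<close>)
    then show "card {x\<in>A. h x = y} = card (A \<inter> kernel G H h)"
      by (simp add: bij_betw_same_card)
  qed simp
  finally show ?thesis by simp
qed

lemma preimage_image:
  assumes "subgroup A G" "kernel G H h \<subseteq> A"
  shows "preimage G h (h ` A) = A"
proof
  show "preimage G h (h ` A) \<subseteq> A"
  proof
    fix x assume "x \<in> preimage G h (h ` A)"
    then obtain a where a: "x \<in> carrier G" "a \<in> A" "h x = h a" by (auto simp: preimage_def)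
    then have "x \<otimes> inv a \<in> kernel G H h"
      using assms by (simp add: kernel_def subgroup.mem_carrier)
    then have "x \<otimes> inv a \<otimes> a \<in> A"
      using assms a by (auto intro: subgroup.m_closed)
    then show "x \<in> A" using a assms(1) by (simp add: G.m_assoc subgroup.mem_carrier)
  qed
  show "A \<subseteq> preimage G h (h ` A)"
    using assms(1) by (auto simp: preimage_def subgroup.mem_carrier)
qed

end

context finite_epi begin

lemma fin_H: "finite (carrier H)"
  using fin surj by (metis finite_imageI)

lemma image_preimage: "S \<subseteq> carrier H \<Longrightarrow> h ` preimage G h S = S"
  using surj by (fastforce simp: preimage_def)

lemma card_preimage:
  assumes "subgroup S H"
  shows "card (preimage G h S) = card S * card (kernel G H h)"
proof -
  have "preimage G h S \<inter> kernel G H h = kernel G H h"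
    using assms by (auto simp: preimage_def kernel_def subgroup.one_closed)
  then show ?thesis
    using card_image[OF subgroup_preimage[OF assms] fin] image_preimage[of S] assms
    by (simp add: subgroup.subset)
qed

lemma kernel_preimage: "subgroup S H \<Longrightarrow> kernel G H h \<subseteq> preimage G h S"
  by (auto simp: preimage_def kernel_def subgroup.one_closed)

lemma preimage_carrier: "preimage G h (carrier H) = carrier G"
  by (auto simp: preimage_def)

lemma preimage_one: "preimage G h {\<one>\<^bsub>H\<^esub>} = kernel G H h"
  by (auto simp: preimage_def kernel_def)

lemma order_eq: "order G = order H * card (kernel G H h)"
  using card_preimage[of "carrier H"] H.subgroup_self preimage_carrier by (simp add: order_def)

end

lemma (in group) quotient_finite_epi:
  assumes "N \<lhd> G" "finite (carrier G)"
  shows "finite_epi G (G Mod N) ((#>) N)"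
proof -
  interpret N: normal N G by fact
  interpret Q: group "G Mod N" by (rule N.factorgroup_is_group)
  show ?thesis
    by unfold_locales (use assms N.r_coset_hom_Mod in \<open>auto simp: carrier_FactGroup\<close>)
qed

lemma (in group) kernel_quotient:
  assumes "N \<lhd> G"
  shows "kernel G (G Mod N) ((#>) N) = N"
proof -
  interpret N: normal N G by fact
  have "N #> x = N \<longleftrightarrow> x \<in> N" if "x \<in> carrier G" for x
    using coset_join1[OF _ that N.subgroup_axioms] coset_join2[OF that N.subgroup_axioms] by blast
  then show ?thesis
    using N.subset unfolding kernel_def one_FactGroup by blast
qed

section \<open>Fixed points of q-groups and normalisers\<close>

text \<open>
  Orbits of a \<open>q\<close>-group have \<open>q\<close>-power length, and an orbit of length 1 would be a fixed point.
\<close>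

lemma (in group) q_dvd_card_if_no_fixed_point:
  fixes act :: "'a \<Rightarrow> 'c \<Rightarrow> 'c"
  assumes q: "prime q" and ord: "order G = q ^ m" and fin: "finite E"
    and closed: "\<And>a x. a \<in> carrier G \<Longrightarrow> x \<in> E \<Longrightarrow> act a x \<in> E"
    and one: "\<And>x. x \<in> E \<Longrightarrow> act \<one> x = x"
    and mult: "\<And>a b x. a \<in> carrier G \<Longrightarrow> b \<in> carrier G \<Longrightarrow> x \<in> E \<Longrightarrow> act (a \<otimes> b) x = act a (act b x)"
    and nofix: "\<And>x. x \<in> E \<Longrightarrow> \<exists>a\<in>carrier G. act a x \<noteq> x"
  shows "q dvd card E"
proof -
  define \<phi> where "\<phi> = (\<lambda>a. restrict (act a) E)"
  have bij: "\<phi> a \<in> Bij E" if "a \<in> carrier G" for a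
  proof -
    have "bij_betw (act a) E E"
      by (rule bij_betw_byWitness[where f' = "act (inv a)"])
        (use that one closed in \<open>auto simp flip: mult\<close>)
    then show ?thesis by (auto simp: Bij_def \<phi>_def)
  qed
  have "\<phi> \<in> hom G (BijGroup E)"
    by (rule homI) (use bij closed mult in \<open>auto simp: BijGroup_def compose_def \<phi>_def fun_eq_iff\<close>)
  then have "group_action G E \<phi>"
    by (simp add: group_action_def group_hom_def group_hom_axioms_def group_BijGroup)
  then interpret group_action G E \<phi> .
  have "card E = (\<Sum>X\<in>orbits G E \<phi>. \<Sum>x\<in>X. 1)"
    using disjoint_sum[OF fin, of "\<lambda>_. 1::nat"] by simp
  moreover have "q dvd (\<Sum>x\<in>X. 1::nat)" if "X \<in> orbits G E \<phi>" for X
  proof -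
    obtain x where x: "x \<in> E" "X = orbit G \<phi> x" using \<open>X \<in> orbits G E \<phi>\<close> by (auto simp: orbits_def)
    have "card X dvd q ^ m"
      using orbit_stabilizer_theorem[OF x(1)] ord x(2) by (metis dvd_triv_left)
    then obtain j where j: "card X = q ^ j"
      using q by (auto simp: divides_primepow_nat)
    obtain a where a: "a \<in> carrier G" "act a x \<noteq> x" using nofix[OF x(1)] by blast
    have "act a x \<in> X" "act \<one> x \<in> X"
      using a x by (auto simp: orbit_def \<phi>_def)
    then have "card X \<noteq> 1"
      using a one[OF x(1)] by (auto simp: card_1_singleton_iff)
    then have "j \<noteq> 0" using j by auto
    then have "q dvd q ^ j" by simp
    then show ?thesis using j by simp
  qed
  ultimately show ?thesis
    by (simp add: dvd_sum del: sum_constant)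
qed

lemma (in group) fixed_points_cong:
  fixes act :: "'a \<Rightarrow> 'c \<Rightarrow> 'c"
  assumes q: "prime q" and ord: "order G = q ^ m" and fin: "finite E"
    and closed: "\<And>a x. a \<in> carrier G \<Longrightarrow> x \<in> E \<Longrightarrow> act a x \<in> E"
    and one: "\<And>x. x \<in> E \<Longrightarrow> act \<one> x = x"
    and mult: "\<And>a b x. a \<in> carrier G \<Longrightarrow> b \<in> carrier G \<Longrightarrow> x \<in> E \<Longrightarrow> act (a \<otimes> b) x = act a (act b x)"
  shows "[card E = card {x\<in>E. \<forall>a\<in>carrier G. act a x = x}] (mod q)"
proof -
  define F where "F = {x\<in>E. \<forall>a\<in>carrier G. act a x = x}"
  have "q dvd card (E - F)"
  proof (rule q_dvd_card_if_no_fixed_point[OF q ord, where act = act])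
    show "finite (E - F)" using fin by simp
  next
    fix a x assume ax: "a \<in> carrier G" "x \<in> E - F"
    have "act a x \<notin> F"
    proof
      assume "act a x \<in> F"
      then have "act (inv a) (act a x) = act a x" using ax by (auto simp: F_def)
      moreover have "act (inv a) (act a x) = x" using ax one by (simp flip: mult)
      ultimately show False using ax \<open>act a x \<in> F\<close> by simp
    qed
    then show "act a x \<in> E - F" using ax closed by blast
  qed (use one mult in \<open>auto simp: F_def\<close>)
  moreover have "card E = card F + card (E - F)"
    using fin card_Un_disjoint[of F "E - F"] by (simp add: F_def Un_absorb1 finite_subset Collect_conj_eq Int_absorb1)
  ultimately show ?thesis
    unfolding F_def[symmetric] by (auto simp: cong_def)
qed

text \<open>
  The count for right translation on the cosets of a subgroup. A coset \<open>D #> g\<close>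
  fixed by \<open>A\<close> is one with \<open>g A g\<^sup>-\<^sup>1 \<subseteq> D\<close>, so counting fixed cosets yields both the growth of normalisers in
  \<open>q\<close>-groups and the conjugacy part of Sylow's theorem.
\<close>

lemma (in group) coset_fixed_points_cong:
  assumes q: "prime q" and A: "subgroup A G" "card A = q ^ m" and D: "subgroup D G"
    and fin: "finite (carrier G)"
  shows "[card (rcosets D) = card {X\<in>rcosets D. \<forall>a\<in>A. X #> a = X}] (mod q)"
proof -
  interpret A: group "G\<restriction>A"
    using A(1) by (rule subgroup.subgroup_is_group) (rule group_axioms)
  have sub: "X \<subseteq> carrier G" if "X \<in> rcosets D" for X
    using that rcosets_subset_PowG[OF D] by blast
  have Ac: "a \<in> carrier G" if "a \<in> A" for a
    using that A(1) by (rule subgroup.mem_carrier[rotated])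
  have iA: "inv a \<in> A" if "a \<in> A" for a
    using that A(1) by (rule subgroup.m_inv_closed[rotated])
  have "[card (rcosets D) = card {X\<in>rcosets D. \<forall>a\<in>carrier (G\<restriction>A). X #> inv a = X}] (mod q)"
  proof (rule A.fixed_points_cong[OF q, where m = m and act = "\<lambda>a X. X #> inv a"])
    show "order (G\<restriction>A) = q ^ m" using A by (simp add: order_def)
    show "finite (rcosets D)"
      using fin rcosets_subset_PowG[OF D] by (meson finite_Pow_iff finite_subset)
  next
    fix a X assume "a \<in> carrier (G\<restriction>A)" and X: "X \<in> rcosets D"
    then have a: "a \<in> A" by simp
    from X obtain g where g: "g \<in> carrier G" "X = D #> g" by (auto simp: RCOSETS_def)
    then have "X #> inv a = D #> (g \<otimes> inv a)"
      using D a Ac by (simp add: coset_mult_assoc subgroup.subset)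
    then show "X #> inv a \<in> rcosets D"
      using g a Ac D by (simp add: rcosetsI subgroup.subset)
  next
    fix X assume "X \<in> rcosets D"
    then show "X #> inv \<one>\<^bsub>G\<restriction>A\<^esub> = X" using sub by simp
  next
    fix a b X assume "a \<in> carrier (G\<restriction>A)" "b \<in> carrier (G\<restriction>A)" "X \<in> rcosets D"
    then show "X #> inv (a \<otimes>\<^bsub>G\<restriction>A\<^esub> b) = X #> inv b #> inv a"
      using sub Ac by (simp add: coset_mult_assoc inv_mult_group)
  qed
  moreover have "(\<forall>a\<in>A. X #> inv a = X) \<longleftrightarrow> (\<forall>a\<in>A. X #> a = X)" for X
    using iA Ac by (metis inv_inv)
  ultimately show ?thesis by simp
qed

lemma (in group) coset_fixed_iff:
  assumes D: "subgroup D G" and g: "g \<in> carrier G" and a: "a \<in> carrier G"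
  shows "D #> g #> a = D #> g \<longleftrightarrow> g \<otimes> a \<otimes> inv g \<in> D"
proof -
  have "D #> g #> a = D #> (g \<otimes> a)" using assms by (simp add: coset_mult_assoc subgroup.subset)
  moreover have "D #> (g \<otimes> a) = D #> g \<longleftrightarrow> g \<otimes> a \<otimes> inv g \<in> D"
  proof
    assume "D #> (g \<otimes> a) = D #> g"
    then have "g \<otimes> a \<in> D #> g" using rcos_self[OF _ D, of "g \<otimes> a"] g a by simp
    then obtain d where "d \<in> D" "g \<otimes> a = d \<otimes> g" by (auto simp: r_coset_def)
    then show "g \<otimes> a \<otimes> inv g \<in> D" using g D by (simp add: m_assoc subgroup.mem_carrier)
  next
    assume d: "g \<otimes> a \<otimes> inv g \<in> D"
    have "g \<otimes> a \<otimes> inv g \<otimes> g = g \<otimes> a" using g a by (simp add: m_assoc)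
    then have "g \<otimes> a \<in> D #> g" using d by (force simp: r_coset_def)
    then show "D #> (g \<otimes> a) = D #> g"
      using repr_independence[OF _ g D, of "g \<otimes> a"] by simp
  qed
  ultimately show ?thesis by simp
qed

lemma (in group) card_rcosets_dvd_prime:
  assumes q: "prime q" and o: "order G = q ^ m" and D: "subgroup D G" "D \<noteq> carrier G"
  shows "q dvd card (rcosets D)"
proof -
  have fin: "finite (carrier G)"
    using o q order_gt_0_iff_finite by (metis prime_gt_0_nat zero_less_power)
  have *: "card (rcosets D) * card D = q ^ m" using lagrange[OF D(1)] o by simp
  then obtain j where j: "card (rcosets D) = q ^ j"
    using q by (metis divides_primepow_nat dvd_triv_left)
  have "j \<noteq> 0"
  proof
    assume "j = 0"
    then have "card D = card (carrier G)" using * j o by (simp add: order_def)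
    then show False using D fin by (metis card_subset_eq subgroup.subset)
  qed
  then show ?thesis using j by simp
qed

text \<open>
  The cosets of \<open>D\<close> fixed by \<open>D\<close> itself are those in its normaliser. Their number is divisible by \<open>q\<close>,
  and \<open>D\<close> is one of them, so there is another.
\<close>

lemma (in group) normalizer_grows:
  assumes q: "prime q" and o: "order G = q ^ m" and D: "subgroup D G" "D \<noteq> carrier G"
  shows "\<exists>x\<in>carrier G - D. \<forall>d\<in>D. x \<otimes> d \<otimes> inv x \<in> D"
proof -
  have fin: "finite (carrier G)"
    using o q order_gt_0_iff_finite by (metis prime_gt_0_nat zero_less_power)
  have "card D dvd q ^ m" using lagrange[OF D(1)] o by (metis dvd_triv_right)
  then obtain n where n: "card D = q ^ n" using q by (auto simp: divides_primepow_nat)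
  define F where "F = {X\<in>rcosets D. \<forall>a\<in>D. X #> a = X}"
  have "q dvd card F"
    using coset_fixed_points_cong[OF q D(1) n D(1) fin] card_rcosets_dvd_prime[OF q o D] cong_dvd_iff
    unfolding F_def by blast
  moreover have "D \<in> F"
    using subgroup.subgroup_in_rcosets[OF D(1) group_axioms] D(1)
    by (auto simp: F_def coset_join2 subgroup.mem_carrier)
  ultimately have "F \<noteq> {D}" using q by (auto simp: prime_nat_iff)
  then obtain X where X: "X \<in> F" "X \<noteq> D" using \<open>D \<in> F\<close> by blast
  then obtain g where g: "g \<in> carrier G" "X = D #> g" by (auto simp: F_def RCOSETS_def)
  have "g \<notin> D" using X g D(1) by (auto simp: coset_join2)
  moreover have "g \<otimes> d \<otimes> inv g \<in> D" if "d \<in> D" for d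
    using X g that coset_fixed_iff[OF D(1) g(1), of d] D(1) by (auto simp: F_def subgroup.mem_carrier)
  ultimately show ?thesis using g by blast
qed

lemma (in group) normalizer_grows_subgroup:
  assumes q: "prime q" and K: "subgroup K G" "card K = q ^ m" and D: "subgroup D G" "D \<subset> K"
  shows "\<exists>x\<in>K - D. \<forall>d\<in>D. x \<otimes> d \<otimes> inv x \<in> D"
proof -
  interpret K: group "G\<restriction>K"
    using K(1) by (rule subgroup.subgroup_is_group) (rule group_axioms)
  have "subgroup D (G\<restriction>K)"
    using subgroup_incl[OF D(1) K(1)] D(2) by blast
  then have "\<exists>x\<in>carrier (G\<restriction>K) - D. \<forall>d\<in>D. x \<otimes>\<^bsub>G\<restriction>K\<^esub> d \<otimes>\<^bsub>G\<restriction>K\<^esub> inv\<^bsub>G\<restriction>K\<^esub> x \<in> D"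
    by (intro K.normalizer_grows[OF q, of m]) (use K D in \<open>auto simp: order_def\<close>)
  then show ?thesis
    using m_inv_consistent[OF K(1)] by auto
qed

text \<open>
  If the number of cosets of \<open>P\<close> is prime to \<open>q\<close>, then \<open>S\<close> fixes one of them.
\<close>

lemma (in group) q_subgroup_conjugate_into:
  assumes q: "prime q" and S: "subgroup S G" "card S = q ^ m"
    and P: "subgroup P G" "\<not> q dvd card (rcosets P)" and fin: "finite (carrier G)"
  shows "\<exists>g\<in>carrier G. \<forall>s\<in>S. g \<otimes> s \<otimes> inv g \<in> P"
proof -
  define F where "F = {X\<in>rcosets P. \<forall>a\<in>S. X #> a = X}"
  have "\<not> q dvd card F"
    using coset_fixed_points_cong[OF q S P(1) fin] P(2) cong_dvd_iff unfolding F_def by blast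
  then have "F \<noteq> {}" by auto
  then obtain g where g: "g \<in> carrier G" "P #> g \<in> F" by (auto simp: F_def RCOSETS_def)
  then show ?thesis
    using coset_fixed_iff[OF P(1) g(1)] S(1) by (auto simp: F_def subgroup.mem_carrier)
qed

text \<open>
  The equivalence, instead of mere invariance, makes this a subgroup for every set \<open>D\<close>. For a finite
  subset of a group it is the usual normaliser, by \<open>normaliser_ofI\<close>.
\<close>

definition normaliser_of :: "('a, 'b) monoid_scheme \<Rightarrow> 'a set \<Rightarrow> 'a set" where
  "normaliser_of G D = {g \<in> carrier G. \<forall>x\<in>carrier G. g \<otimes>\<^bsub>G\<^esub> x \<otimes>\<^bsub>G\<^esub> inv\<^bsub>G\<^esub> g \<in> D \<longleftrightarrow> x \<in> D}"

context group begin

lemma conj_conj: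
  assumes "g \<in> carrier G" "h \<in> carrier G" "x \<in> carrier G"
  shows "g \<otimes> (h \<otimes> x \<otimes> inv h) \<otimes> inv g = (g \<otimes> h) \<otimes> x \<otimes> inv (g \<otimes> h)"
  using assms by (simp add: inv_mult_group m_assoc)

lemma inv_cancel_left:
  assumes "g \<in> carrier G" "x \<in> carrier G"
  shows "inv g \<otimes> (g \<otimes> x) = x" "g \<otimes> (inv g \<otimes> x) = x"
  using assms by (simp_all flip: m_assoc)

lemma conj_inv_conj:
  assumes "g \<in> carrier G" "x \<in> carrier G"
  shows "inv g \<otimes> (g \<otimes> x \<otimes> inv g) \<otimes> g = x" "g \<otimes> (inv g \<otimes> x \<otimes> g) \<otimes> inv g = x"
  using assms by (simp_all add: m_assoc inv_cancel_left)

lemma conj_group_hom: "g \<in> carrier G \<Longrightarrow> group_hom G G (\<lambda>x. g \<otimes> x \<otimes> inv g)"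
  by unfold_locales (auto simp: hom_def m_assoc inv_cancel_left)

lemma normaliser_ofI:
  assumes D: "D \<subseteq> carrier G" "finite D" and g: "g \<in> carrier G" and c: "\<And>d. d \<in> D \<Longrightarrow> g \<otimes> d \<otimes> inv g \<in> D"
  shows "g \<in> normaliser_of G D"
proof -
  have inj: "inj_on (\<lambda>x. g \<otimes> x \<otimes> inv g) (carrier G)"
    by (rule inj_onI) (use g in simp)
  then have "inj_on (\<lambda>x. g \<otimes> x \<otimes> inv g) D" using D(1) by (rule inj_on_subset)
  then have eq: "(\<lambda>x. g \<otimes> x \<otimes> inv g) ` D = D"
    by (rule endo_inj_surj[OF D(2), rotated]) (use c in blast)
  have "x \<in> D" if x: "x \<in> carrier G" and xD: "g \<otimes> x \<otimes> inv g \<in> D" for x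
  proof -
    have "g \<otimes> x \<otimes> inv g \<in> (\<lambda>x. g \<otimes> x \<otimes> inv g) ` D" using eq xD by simp
    then obtain d where d: "d \<in> D" "g \<otimes> x \<otimes> inv g = g \<otimes> d \<otimes> inv g" by blast
    then have "x = d" using inj_onD[OF inj d(2) x] D(1) by blast
    then show ?thesis using d(1) by simp
  qed
  then show ?thesis using c g unfolding normaliser_of_def by blast
qed

lemma normaliser_of_subgroup: "subgroup (normaliser_of G D) G"
proof (rule subgroupI)
  show "normaliser_of G D \<noteq> {}" by (auto simp: normaliser_of_def intro!: exI[of _ \<one>])
next
  fix g assume g: "g \<in> normaliser_of G D"
  then have gc: "g \<in> carrier G" by (simp add: normaliser_of_def)
  have "inv g \<otimes> x \<otimes> inv (inv g) \<in> D \<longleftrightarrow> x \<in> D" if "x \<in> carrier G" for x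
  proof -
    have "inv g \<otimes> x \<otimes> g \<in> carrier G" using that gc by simp
    then have "g \<otimes> (inv g \<otimes> x \<otimes> g) \<otimes> inv g \<in> D \<longleftrightarrow> inv g \<otimes> x \<otimes> g \<in> D"
      using g unfolding normaliser_of_def by blast
    then show ?thesis using that gc by (simp add: conj_inv_conj)
  qed
  then show "inv g \<in> normaliser_of G D" using gc unfolding normaliser_of_def by blast
next
  fix g h assume gh: "g \<in> normaliser_of G D" "h \<in> normaliser_of G D"
  then have c: "g \<in> carrier G" "h \<in> carrier G" by (auto simp: normaliser_of_def)
  have "g \<otimes> h \<otimes> x \<otimes> inv (g \<otimes> h) \<in> D \<longleftrightarrow> x \<in> D" if "x \<in> carrier G" for x
  proof -
    have "h \<otimes> x \<otimes> inv h \<in> carrier G" using c that by simp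
    then have "g \<otimes> (h \<otimes> x \<otimes> inv h) \<otimes> inv g \<in> D \<longleftrightarrow> x \<in> D"
      using gh that unfolding normaliser_of_def by blast
    then show ?thesis using conj_conj[OF c that] by simp
  qed
  moreover have "g \<otimes> h \<in> carrier G" using c by simp
  ultimately show "g \<otimes> h \<in> normaliser_of G D" unfolding normaliser_of_def by blast
qed (simp add: normaliser_of_def subset_iff)

lemma subgroup_le_normaliser_of:
  assumes "subgroup H G" shows "H \<subseteq> normaliser_of G H"
proof
  fix h assume h: "h \<in> H"
  have "x \<in> H" if "x \<in> carrier G" "h \<otimes> x \<otimes> inv h \<in> H" for x
  proof -
    have "inv h \<otimes> (h \<otimes> x \<otimes> inv h) \<otimes> h \<in> H"
      by (rule subgroup.m_closed[OF assms subgroup.m_closed[OF assms subgroup.m_inv_closed[OF assms h] that(2)] h])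
    then show ?thesis
      by (simp only: conj_inv_conj(1)[OF subgroup.mem_carrier[OF assms h] that(1)])
  qed
  moreover have "h \<otimes> x \<otimes> inv h \<in> H" if "x \<in> H" for x
    using h that by (simp add: subgroup.m_closed[OF assms] subgroup.m_inv_closed[OF assms])
  ultimately have "\<forall>x\<in>carrier G. h \<otimes> x \<otimes> inv h \<in> H \<longleftrightarrow> x \<in> H" by blast
  then show "h \<in> normaliser_of G H"
    using subgroup.mem_carrier[OF assms h] unfolding normaliser_of_def by simp
qed

lemma normal_iff_normaliser_of:
  "subgroup H G \<Longrightarrow> carrier G \<subseteq> normaliser_of G H \<Longrightarrow> H \<lhd> G"
  by (auto simp: normal_inv_iff normaliser_of_def subgroup.mem_carrier)

lemma prime_index_maximal:
  assumes fin: "finite (carrier G)" and p: "prime p" and H: "subgroup H G" "order G = p * card H"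
    and K: "subgroup K G" "H \<subseteq> K"
  shows "K = H \<or> K = carrier G"
proof -
  have "card H > 0" using fin H(1) by (rule subgroup_card_pos)
  obtain s where s: "card K = card H * s" using subgroup_card_dvd[OF H(1) K] by auto
  obtain t where "order G = card K * t"
    using subgroup_card_dvd[OF K(1) subgroup_self] subgroup.subset[OF K(1)] by (auto simp: order_def)
  then have "p = s * t" using s H(2) \<open>card H > 0\<close> by (simp add: mult.commute[of p])
  then have "s = 1 \<or> s = p" using p by (metis dvd_triv_left prime_nat_iff)
  then show ?thesis
  proof
    assume "s = 1" then show ?thesis using s K fin subgroup_finite by (metis card_subset_eq mult.right_neutral)
  next
    assume "s = p"
    then have "card K = card (carrier G)" using s H(2) by (simp add: order_def)
    then show ?thesis using K(1) fin card_subset_eq subgroup.subset by blast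
  qed
qed

lemma prime_index_normal_or_selfnormalizing:
  assumes fin: "finite (carrier G)" and p: "prime p" and H: "subgroup H G" "order G = p * card H"
  shows "H \<lhd> G \<or> normaliser_of G H = H"
  using prime_index_maximal[OF fin p H normaliser_of_subgroup subgroup_le_normaliser_of] normal_iff_normaliser_of H(1)
  by blast

text \<open>
  The normaliser of \<open>H\<close> properly contains \<open>H\<close>, and \<open>H\<close> is maximal.
\<close>

lemma prime_index_normal_if_p_group:
  assumes p: "prime p" and H: "subgroup H G" "order G = p * card H" and o: "order G = p ^ m"
  shows "H \<lhd> G"
proof -
  have fin: "finite (carrier G)"
    using o p order_gt_0_iff_finite by (metis prime_gt_0_nat zero_less_power)
  have "H \<noteq> carrier G"
    using H(2) p subgroup_card_pos[OF fin H(1)] prime_gt_1_nat[OF p] by (auto simp: order_def)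
  then obtain x where x: "x \<in> carrier G - H" "\<forall>d\<in>H. x \<otimes> d \<otimes> inv x \<in> H"
    using normalizer_grows[OF p o H(1)] by blast
  then have "x \<in> normaliser_of G H"
    using normaliser_ofI[of H x] H(1) subgroup_finite[OF fin H(1)] subgroup.subset by blast
  then show ?thesis
    using prime_index_normal_or_selfnormalizing[OF fin p H] x by blast
qed

end

section \<open>Conjugates of a self-normalising subgroup of prime index\<close>

text \<open>
  The conjugate \<open>g\<^sup>-\<^sup>1 H g\<close>, written as an inverse image so that it depends only on the right coset of \<open>g\<close>
  when \<open>H\<close> is a subgroup.
\<close>

definition conj_sub :: "('a, 'b) monoid_scheme \<Rightarrow> 'a set \<Rightarrow> 'a \<Rightarrow> 'a set" where
  "conj_sub G H g = {x \<in> carrier G. g \<otimes>\<^bsub>G\<^esub> x \<otimes>\<^bsub>G\<^esub> inv\<^bsub>G\<^esub> g \<in> H}"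

context group begin

lemma conj_sub_subgroup:
  assumes "subgroup H G" "g \<in> carrier G"
  shows "subgroup (conj_sub G H g) G"
proof -
  interpret group_hom G G "\<lambda>x. g \<otimes> x \<otimes> inv g" using assms(2) by (rule conj_group_hom)
  show ?thesis using subgroup_preimage[OF assms(1)] by (simp add: preimage_def conj_sub_def)
qed

lemma conj_sub_card:
  assumes "H \<subseteq> carrier G" "g \<in> carrier G"
  shows "card (conj_sub G H g) = card H"
proof -
  have "bij_betw (\<lambda>x. g \<otimes> x \<otimes> inv g) (conj_sub G H g) H"
    by (rule bij_betw_byWitness[where f' = "\<lambda>x. inv g \<otimes> x \<otimes> g"])
      (use assms in \<open>auto simp: conj_sub_def conj_inv_conj subset_iff\<close>)
  then show ?thesis by (rule bij_betw_same_card)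
qed

lemma conj_sub_conj_sub:
  assumes "g \<in> carrier G" "h \<in> carrier G"
  shows "conj_sub G (conj_sub G H g) h = conj_sub G H (g \<otimes> h)"
  using assms by (auto simp: conj_sub_def conj_conj)

lemma conj_sub_one: "H \<subseteq> carrier G \<Longrightarrow> conj_sub G H \<one> = H"
  by (auto simp: conj_sub_def)

lemma conj_sub_eq_self_iff:
  assumes "H \<subseteq> carrier G" "g \<in> carrier G"
  shows "conj_sub G H g = H \<longleftrightarrow> g \<in> normaliser_of G H"
  using assms unfolding conj_sub_def normaliser_of_def by blast

lemma conj_sub_eq_iff:
  assumes H: "subgroup H G" "normaliser_of G H = H" and g: "g \<in> carrier G" and h: "h \<in> carrier G"
  shows "conj_sub G H g = conj_sub G H h \<longleftrightarrow> g \<otimes> inv h \<in> H"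
proof -
  have Hc: "H \<subseteq> carrier G" using H by (simp add: subgroup.subset)
  have *: "conj_sub G (conj_sub G H (g \<otimes> inv h)) h = conj_sub G H g"
    using g h by (simp add: conj_sub_conj_sub m_assoc)
  have "conj_sub G (conj_sub G H h) (inv h) = H"
    using h Hc by (simp add: conj_sub_conj_sub conj_sub_one)
  moreover have "conj_sub G (conj_sub G H g) (inv h) = conj_sub G H (g \<otimes> inv h)"
    using g h by (simp add: conj_sub_conj_sub)
  ultimately have "conj_sub G H g = conj_sub G H h \<longleftrightarrow> conj_sub G H (g \<otimes> inv h) = H"
    using * by metis
  then show ?thesis using conj_sub_eq_self_iff[OF Hc, of "g \<otimes> inv h"] H(2) g h by simp
qed

text \<open>
  Membership in the core, stated elementwise; it agrees with \<^const>\<open>Core\<close> on subgroups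
  (\<open>Core_eq_core_in\<close>).
\<close>

definition core_in :: "'a set \<Rightarrow> 'a set" where
  "core_in H = {x \<in> carrier G. \<forall>y\<in>carrier G. y \<otimes> x \<otimes> inv y \<in> H}"

lemma core_in_normal:
  assumes "subgroup H G"
  shows "core_in H \<lhd> G"
proof -
  have R: "core_in H = (\<Inter>y\<in>carrier G. conj_sub G H y)" by (auto simp: core_in_def conj_sub_def)
  have "subgroup (core_in H) G" unfolding R using conj_sub_subgroup[OF assms] by (intro subgroups_Inter) auto
  moreover have "y \<otimes> x \<otimes> inv y \<in> core_in H" if "y \<in> carrier G" "x \<in> core_in H" for x y
    using that by (auto simp: core_in_def conj_conj)
  ultimately show ?thesis by (simp add: normal_inv_iff)
qed

lemma core_in_subset: "core_in H \<subseteq> H"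
  by (auto simp: core_in_def dest: bspec[of _ _ \<one>])

lemma core_in_greatest: "N \<lhd> G \<Longrightarrow> N \<subseteq> H \<Longrightarrow> N \<subseteq> core_in H"
  by (auto simp: core_in_def normal_inv_iff subgroup.mem_carrier)

text \<open>
  The product formula \<open>|K N| |N \<inter> K| = |K| |N|\<close>, divided by \<open>|K|\<close>.
\<close>

lemma card_cosets_meeting:
  assumes K: "subgroup K G" and N: "subgroup N G" and fin: "finite (carrier G)"
  shows "card ((\<lambda>g. K #> g) ` N) * card (N \<inter> K) = card N"
proof -
  have Nf: "finite N" using fin N by (rule subgroup_finite)
  have Nc: "x \<in> carrier G" if "x \<in> N" for x using that N by (rule subgroup.mem_carrier[rotated])
  have "card N = (\<Sum>y\<in>(\<lambda>g. K #> g) ` N. card {x\<in>N. K #> x = y})"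
    using sum.image_gen[OF Nf, of "\<lambda>_. 1::nat" "\<lambda>g. K #> g"] by simp
  also have "\<dots> = (\<Sum>y\<in>(\<lambda>g. K #> g) ` N. card (N \<inter> K))"
  proof (rule sum.cong)
    fix y assume "y \<in> (\<lambda>g. K #> g) ` N"
    then obtain a where a: "a \<in> N" "y = K #> a" by auto
    have eq: "K #> x = K #> a \<longleftrightarrow> x \<otimes> inv a \<in> K" if x: "x \<in> N" for x
    proof
      assume "K #> x = K #> a"
      then have "x \<in> K #> a" using rcos_self[OF Nc[OF x] K] by simp
      then show "x \<otimes> inv a \<in> K"
        using subgroup.rcos_module[OF K group_axioms Nc[OF a(1)] Nc[OF x]] by simp
    next
      assume "x \<otimes> inv a \<in> K"
      then have "x \<in> K #> a"
        using subgroup.rcos_module[OF K group_axioms Nc[OF a(1)] Nc[OF x]] by simp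
      then show "K #> x = K #> a"
        using repr_independence[OF _ Nc[OF a(1)] K] by simp
    qed
    have "bij_betw (\<lambda>x. x \<otimes> a) (N \<inter> K) {x\<in>N. K #> x = y}"
    proof (rule bij_betw_byWitness[where f' = "\<lambda>x. x \<otimes> inv a"])
      show "\<forall>x\<in>N \<inter> K. x \<otimes> a \<otimes> inv a = x" "\<forall>x\<in>{x\<in>N. K #> x = y}. x \<otimes> inv a \<otimes> a = x"
        using a Nc by (auto simp: m_assoc)
      show "(\<lambda>x. x \<otimes> a) ` (N \<inter> K) \<subseteq> {x\<in>N. K #> x = y}"
      proof clarify
        fix x assume x: "x \<in> N" "x \<in> K"
        have xa: "x \<otimes> a \<in> N" using x(1) a(1) N by (simp add: subgroup.m_closed)
        have "x \<otimes> a \<otimes> inv a \<in> K" using x a Nc by (simp add: m_assoc)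
        then have "K #> (x \<otimes> a) = y" using eq[OF xa] a(2) by simp
        then show "x \<otimes> a \<in> N \<and> K #> (x \<otimes> a) = y" using xa by blast
      qed
      show "(\<lambda>x. x \<otimes> inv a) ` {x\<in>N. K #> x = y} \<subseteq> N \<inter> K"
      proof clarify
        fix x assume x: "x \<in> N" "y = K #> x"
        have "x \<otimes> inv a \<in> N" using x(1) a(1) N by (simp add: subgroup.m_closed subgroup.m_inv_closed)
        moreover have "x \<otimes> inv a \<in> K" using eq[OF x(1)] x(2) a(2) by simp
        ultimately show "x \<otimes> inv a \<in> N \<inter> K" by blast
      qed
    qed
    then show "card {x\<in>N. K #> x = y} = card (N \<inter> K)"
      by (simp add: bij_betw_same_card)
  qed simp
  finally show ?thesis by simp
qed

lemma coset_meets_if_index: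
  assumes K: "subgroup K G" and N: "subgroup N G" and fin: "finite (carrier G)"
    and idx: "card N = card (rcosets K) * card (N \<inter> K)" and y: "y \<in> carrier G"
  shows "\<exists>k\<in>K. \<exists>g\<in>N. y = k \<otimes> g"
proof -
  have "card (N \<inter> K) > 0" using N K fin by (intro subgroup_card_pos subgroups_Inter_pair)
  then have "card ((\<lambda>g. K #> g) ` N) = card (rcosets K)"
    using card_cosets_meeting[OF K N fin] idx by simp
  moreover have "(\<lambda>g. K #> g) ` N \<subseteq> rcosets K"
    using N by (auto simp: RCOSETS_def dest: subgroup.mem_carrier)
  moreover have "finite (rcosets K)"
    using fin rcosets_subset_PowG[OF K] by (meson finite_Pow_iff finite_subset)
  ultimately have eq: "(\<lambda>g. K #> g) ` N = rcosets K" by (simp add: card_subset_eq)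
  have "K #> y \<in> rcosets K" using y by (auto simp: RCOSETS_def)
  then obtain g where g: "g \<in> N" "K #> y = K #> g" using eq by (metis imageE)
  then have "y \<in> K #> g" using rcos_self[OF y K] by simp
  then show ?thesis using g(1) by (auto simp: r_coset_def)
qed

text \<open>
  This is the heart of the solubility of groups of order \<open>p q\<^sup>n\<close>. Let \<open>D\<close> be a largest intersection of two
  distinct conjugates and \<open>N\<close> its normaliser. Each conjugate \<open>K \<supseteq> D\<close> has
  \<open>N \<inter> K\<close> strictly larger than \<open>D\<close>, because normalisers grow in \<open>q\<close>-groups. By maximality of \<open>D\<close> a conjugate
  containing \<open>N \<inter> K\<close> is \<open>K\<close> itself. Letting \<open>N \<inter> K\<close> act on the cosets of \<open>N \<inter> C\<close> in \<open>N\<close>, where \<open>C\<close> is one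
  conjugate above \<open>D\<close>, gives index congruent to 1 modulo \<open>q\<close> for \<open>K = C\<close>, and congruent to 0 if \<open>K\<close> were not an
  \<open>N\<close>-conjugate of \<open>C\<close>. So \<open>N\<close> permutes the conjugates above \<open>D\<close> transitively, and their number is prime to \<open>q\<close>,
  divides \<open>p\<close> and exceeds 1. Hence it is \<open>p\<close>: all conjugates contain \<open>D\<close>, and \<open>D\<close> lies in the core, which is trivial.
\<close>

lemma distinct_conjugates_meet_trivially:
  assumes fin: "finite (carrier G)" and p: "prime p" and q: "prime q" and pq: "p \<noteq> q"
    and H: "subgroup H G" and cH: "card H = q ^ n" and o: "order G = p * card H"
    and sn: "normaliser_of G H = H"
    and core: "\<And>N. N \<lhd> G \<Longrightarrow> N \<subseteq> H \<Longrightarrow> N = {\<one>}"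
    and ab: "a0 \<in> carrier G" "b0 \<in> carrier G" "conj_sub G H a0 \<noteq> conj_sub G H b0"
  shows "conj_sub G H a0 \<inter> conj_sub G H b0 = {\<one>}"
proof -
  let ?C = "conj_sub G H"
  note sub = conj_sub_subgroup[OF H]
  have Hc: "H \<subseteq> carrier G" using H by (simp add: subgroup.subset)
  have cC: "card (?C g) = q ^ n" if "g \<in> carrier G" for g
    using conj_sub_card[OF Hc that] cH by simp
  have finC: "finite (?C g)" if "g \<in> carrier G" for g
    using sub[OF that] fin by (simp add: subgroup_finite)
  \<comment> \<open>Choose a pair of distinct conjugates with largest intersection \<open>D\<close>.\<close>
  define P where "P = (\<lambda>(a, b). a \<in> carrier G \<and> b \<in> carrier G \<and> ?C a \<noteq> ?C b)"
  define f where "f = (\<lambda>(a, b). card (?C a \<inter> ?C b))"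
  have "\<exists>x. P x \<and> (\<forall>y. P y \<longrightarrow> f y \<le> f x)"
  proof (rule ex_has_greatest_nat[of P "(a0, b0)" f "Suc (q ^ n)"])
    show "P (a0, b0)" using ab by (simp add: P_def)
    show "\<forall>y. P y \<longrightarrow> f y < Suc (q ^ n)"
    proof (clarsimp simp: P_def f_def)
      fix a b assume "a \<in> carrier G"
      then show "card (?C a \<inter> ?C b) < Suc (q ^ n)"
        using cC[of a] finC[of a] card_mono[of "?C a" "?C a \<inter> ?C b"] by simp
    qed
  qed
  then obtain a b where abP: "P (a, b)" and maxf: "\<And>y. P y \<Longrightarrow> f y \<le> f (a, b)" by (metis surj_pair)
  then have a: "a \<in> carrier G" and b: "b \<in> carrier G" and neq: "?C a \<noteq> ?C b" by (auto simp: P_def)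
  define D where "D = ?C a \<inter> ?C b"
  have Dsub: "subgroup D G" using sub[OF a] sub[OF b] by (simp add: D_def subgroups_Inter_pair)
  have Dfin: "finite D" using Dsub fin by (simp add: subgroup_finite)
  have Dc: "D \<subseteq> carrier G" using Dsub by (simp add: subgroup.subset)
  have max: "?C c \<inter> ?C d = D" if "c \<in> carrier G" "d \<in> carrier G" "?C c \<noteq> ?C d" "D \<subseteq> ?C c" "D \<subseteq> ?C d" for c d
  proof -
    have "card (?C c \<inter> ?C d) \<le> card D"
      using maxf[of "(c, d)"] that by (simp add: P_def f_def D_def)
    then show ?thesis using that finC[of c] card_seteq[of "?C c \<inter> ?C d" D] by blast
  qed
  have proper: "D \<subset> ?C c" if c: "c \<in> carrier G" "D \<subseteq> ?C c" for c
  proof -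
    have "D \<noteq> ?C c"
    proof
      assume eq: "D = ?C c"
      then have "card D = q ^ n" using cC c by simp
      then have "D = ?C a" "D = ?C b"
        using card_subset_eq[of "?C a" D] card_subset_eq[of "?C b" D] finC cC a b by (auto simp: D_def)
      then show False using neq by simp
    qed
    then show ?thesis using c by blast
  qed
  define N where "N = normaliser_of G D"
  have Nsub: "subgroup N G" by (simp add: N_def normaliser_of_subgroup)
  have Nc: "N \<subseteq> carrier G" using Nsub by (simp add: subgroup.subset)
  have ND: "g \<otimes> d \<otimes> inv g \<in> D" if "g \<in> N" "d \<in> D" for g d
    using that Dc by (auto simp: N_def normaliser_of_def)
  have DN: "D \<subseteq> N" using subgroup_le_normaliser_of[OF Dsub] by (simp add: N_def)
  interpret N: group "G\<restriction>N"
    using Nsub by (rule subgroup.subgroup_is_group) (rule group_axioms)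
  have Nfin: "finite N" using Nsub fin by (simp add: subgroup_finite)
  have grow: "\<exists>x\<in>N \<inter> ?C c. x \<notin> D" if c: "c \<in> carrier G" "D \<subseteq> ?C c" for c
  proof -
    obtain x where x: "x \<in> ?C c - D" "\<forall>d\<in>D. x \<otimes> d \<otimes> inv x \<in> D"
      using normalizer_grows_subgroup[OF q sub[OF c(1)] cC[OF c(1)] Dsub proper[OF c]] by blast
    then have "x \<in> N"
      unfolding N_def using sub[OF c(1)] by (intro normaliser_ofI Dc Dfin) (auto intro: subgroup.mem_carrier)
    then show ?thesis using x by blast
  qed
  define M where "M = N \<inter> ?C a"
  have Msub: "subgroup M G" using Nsub sub[OF a] by (simp add: M_def subgroups_Inter_pair)
  have MsubN: "subgroup M (G\<restriction>N)"
    using subgroup_incl[OF Msub Nsub] by (simp add: M_def)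
  define idx where "idx = card (rcosets\<^bsub>G\<restriction>N\<^esub> M)"
  have idxM: "idx * card M = card N"
    using N.lagrange[OF MsubN] by (simp add: idx_def order_def)
  have aD: "D \<subseteq> ?C a" by (simp add: D_def)
  \<comment> \<open>If \<open>N \<inter> C c\<close> fixes the coset \<open>M g\<close>, then \<open>C c\<close> is the conjugate of \<open>C a\<close> by \<open>g\<close>.\<close>
  have fixed: "?C c = ?C (a \<otimes> g)"
    if c: "c \<in> carrier G" "D \<subseteq> ?C c" and g: "g \<in> N"
      and fx: "\<forall>x\<in>N \<inter> ?C c. M #> g #> x = M #> g" for c g
  proof (rule ccontr)
    assume ne: "?C c \<noteq> ?C (a \<otimes> g)"
    have gc: "g \<in> carrier G" using g Nc by blast
    have le: "N \<inter> ?C c \<subseteq> ?C (a \<otimes> g)"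
    proof
      fix x assume x: "x \<in> N \<inter> ?C c"
      then have xc: "x \<in> carrier G" using Nc by blast
      have "g \<otimes> x \<otimes> inv g \<in> M" using coset_fixed_iff[OF Msub gc xc] fx x by simp
      then have "g \<otimes> x \<otimes> inv g \<in> ?C a" by (simp add: M_def)
      then have "x \<in> conj_sub G (?C a) g" using xc by (simp add: conj_sub_def[of _ "?C a"])
      then show "x \<in> ?C (a \<otimes> g)" using a gc by (simp add: conj_sub_conj_sub)
    qed
    have "D \<subseteq> ?C (a \<otimes> g)" using le c(2) DN by blast
    then have "?C c \<inter> ?C (a \<otimes> g) = D"
      using c ne a gc by (intro max) auto
    then have "N \<inter> ?C c \<subseteq> D" using le by blast
    then show False using grow[OF c] by blast
  qed
  have rc: "(\<exists>g\<in>N. X = M #> g)" if "X \<in> rcosets\<^bsub>G\<restriction>N\<^esub> M" for X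
    using that by (auto simp: RCOSETS_def)
  have count: "[idx = card {X\<in>rcosets\<^bsub>G\<restriction>N\<^esub> M. \<forall>x\<in>N \<inter> ?C c. X #> x = X}] (mod q)"
    if c: "c \<in> carrier G" "D \<subseteq> ?C c" for c
  proof -
    have s: "subgroup (N \<inter> ?C c) G" using Nsub sub[OF c(1)] by (simp add: subgroups_Inter_pair)
    then have "card (N \<inter> ?C c) dvd q ^ n"
      using subgroup_card_dvd[OF s sub[OF c(1)]] cC[OF c(1)] by simp
    then obtain j where "card (N \<inter> ?C c) = q ^ j" using q by (auto simp: divides_primepow_nat)
    then show ?thesis
      using N.coset_fixed_points_cong[OF q subgroup_incl[OF s Nsub] _ MsubN] Nfin
      by (simp add: idx_def)
  qed
  \<comment> \<open>For \<open>K = C a\<close> the only fixed coset is \<open>M\<close> itself, as \<open>C a\<close> is its own normaliser.\<close>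
  have idxq: "[idx = 1] (mod q)"
  proof -
    have "{X\<in>rcosets\<^bsub>G\<restriction>N\<^esub> M. \<forall>x\<in>N \<inter> ?C a. X #> x = X} = {M}"
    proof
      show "{X\<in>rcosets\<^bsub>G\<restriction>N\<^esub> M. \<forall>x\<in>N \<inter> ?C a. X #> x = X} \<subseteq> {M}"
      proof clarify
        fix X assume X: "X \<in> rcosets\<^bsub>G\<restriction>N\<^esub> M" "\<forall>x\<in>N \<inter> ?C a. X #> x = X"
        obtain g where g: "g \<in> N" "X = M #> g" using rc[OF X(1)] by blast
        have gc: "g \<in> carrier G" using g Nc by blast
        have "?C a = ?C (a \<otimes> g)" using fixed[OF a aD g(1)] X(2) g(2) by blast
        then have "a \<otimes> g \<otimes> inv a \<in> H" using conj_sub_eq_iff[OF H sn, of "a \<otimes> g" a] a gc by simp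
        then have "g \<in> M" using gc g(1) by (simp add: M_def conj_sub_def)
        then show "X = M" using g(2) Msub gc by (simp add: coset_join2)
      qed
      have "M \<in> rcosets\<^bsub>G\<restriction>N\<^esub> M"
        using subgroup.subgroup_in_rcosets[OF MsubN N.group_axioms] .
      moreover have "M #> x = M" if "x \<in> N \<inter> ?C a" for x
        using that Msub Nc by (intro coset_join2) (auto simp: M_def)
      ultimately show "{M} \<subseteq> {X\<in>rcosets\<^bsub>G\<restriction>N\<^esub> M. \<forall>x\<in>N \<inter> ?C a. X #> x = X}"
        by blast
    qed
    then show ?thesis using count[OF a aD] by simp
  qed
  \<comment> \<open>A conjugate \<open>C c\<close> that is not an \<open>N\<close>-conjugate of \<open>C a\<close> would have no fixed coset at all.\<close>
  have conjg: "\<exists>g\<in>N. ?C c = ?C (a \<otimes> g)" if c: "c \<in> carrier G" "D \<subseteq> ?C c" for c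
  proof (rule ccontr)
    assume no: "\<not> (\<exists>g\<in>N. ?C c = ?C (a \<otimes> g))"
    have "{X\<in>rcosets\<^bsub>G\<restriction>N\<^esub> M. \<forall>x\<in>N \<inter> ?C c. X #> x = X} = {}"
    proof (rule ccontr)
      assume "\<not> ?thesis"
      then obtain X where X: "X \<in> rcosets\<^bsub>G\<restriction>N\<^esub> M" "\<forall>x\<in>N \<inter> ?C c. X #> x = X" by blast
      obtain g where "g \<in> N" "X = M #> g" using rc[OF X(1)] by blast
      then show False using fixed[OF c] X(2) no by blast
    qed
    then have "[idx = 0] (mod q)" using count[OF c] by (metis card.empty)
    then have "q dvd idx" by (simp add: cong_0_iff)
    then show False using idxq q by (metis cong_dvd_iff not_prime_unit)
  qed
  have "idx dvd p * q ^ n"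
    using idxM subgroup_card_dvd[OF Nsub subgroup_self Nc] o cH by (metis dvd_trans dvd_triv_left order_def)
  moreover have "coprime idx (q ^ n)"
    using idxq q by (metis cong_dvd_iff coprime_commute coprime_power_left_iff not_prime_unit prime_imp_coprime)
  ultimately have "idx dvd p" by (simp add: coprime_dvd_mult_left_iff)
  then have "idx = 1 \<or> idx = p" using p by (auto simp: prime_nat_iff)
  moreover have "idx \<noteq> 1"
  proof
    assume "idx = 1"
    then have "M = N" using idxM Nfin by (simp add: M_def card_subset_eq)
    then have NC: "N \<subseteq> ?C a" by (auto simp: M_def)
    have "D \<subseteq> ?C b" by (simp add: D_def)
    then obtain g where g: "g \<in> N" "?C b = ?C (a \<otimes> g)" using conjg[OF b] by blast
    then have gc: "g \<in> carrier G" using Nc by blast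
    have "a \<otimes> g \<otimes> inv a \<in> H" using g NC by (auto simp: conj_sub_def)
    then have "?C (a \<otimes> g) = ?C a" using conj_sub_eq_iff[OF H sn, of "a \<otimes> g" a] a gc by simp
    then show False using neq g by simp
  qed
  ultimately have "idx = p" by blast
  have "card H > 0" using fin H by (rule subgroup_card_pos)
  have "card (rcosets (?C a)) * card (?C a) = p * card H"
    using lagrange[OF sub[OF a]] o by simp
  then have "card (rcosets (?C a)) = p"
    using conj_sub_card[OF Hc a] \<open>card H > 0\<close> by simp
  then have index: "card N = card (rcosets (?C a)) * card (N \<inter> ?C a)"
    using idxM \<open>idx = p\<close> by (simp add: M_def)
  have all: "D \<subseteq> ?C y" if y: "y \<in> carrier G" for y
  proof
    fix d assume d: "d \<in> D"
    have "inv a \<otimes> y \<in> carrier G" using a y by simp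
    then obtain k g where kg: "k \<in> ?C a" "g \<in> N" "inv a \<otimes> y = k \<otimes> g"
      using coset_meets_if_index[OF sub[OF a] Nsub fin index] by blast
    have c: "k \<in> carrier G" "g \<in> carrier G" "d \<in> carrier G"
      using kg d Dc Nc by (auto simp: conj_sub_def)
    have "g \<otimes> d \<otimes> inv g \<in> ?C a" using ND[OF kg(2) d] aD by blast
    then have "k \<otimes> (g \<otimes> d \<otimes> inv g) \<otimes> inv k \<in> ?C a"
      using kg(1) subgroup.m_closed[OF sub[OF a]] subgroup.m_inv_closed[OF sub[OF a]] by blast
    then have "(inv a \<otimes> y) \<otimes> d \<otimes> inv (inv a \<otimes> y) \<in> ?C a" using c by (simp add: kg(3) conj_conj)
    then have "d \<in> conj_sub G (?C a) (inv a \<otimes> y)" using c by (simp add: conj_sub_def[of _ "?C a"])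
    then show "d \<in> ?C y" using a y by (simp add: conj_sub_conj_sub inv_cancel_left)
  qed
  have "D \<subseteq> core_in H" using all Dc by (auto simp: core_in_def conj_sub_def)
  moreover have "core_in H = {\<one>}" using core_in_normal[OF H] core_in_subset by (rule core)
  ultimately have "D \<subseteq> {\<one>}" by simp
  then have "card D \<le> 1" using card_mono[of "{\<one>}" D] by simp
  then have "card (?C a0 \<inter> ?C b0) \<le> 1"
    using maxf[of "(a0, b0)"] ab by (simp add: P_def f_def D_def)
  moreover have "\<one> \<in> ?C a0 \<inter> ?C b0" using sub ab by (simp add: subgroup.one_closed)
  moreover have "finite (?C a0 \<inter> ?C b0)" using finC ab by simp
  ultimately show ?thesis using card_le_Suc0_iff_eq[of "?C a0 \<inter> ?C b0"] by auto
qed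

end

section \<open>Core-free subgroups of prime index\<close>

lemma card_image_eq_if_same_fibres:
  assumes "\<And>x y. x \<in> A \<Longrightarrow> y \<in> A \<Longrightarrow> f x = f y \<longleftrightarrow> g x = g y"
  shows "card (f ` A) = card (g ` A)"
proof -
  have "bij_betw (\<lambda>z. g (inv_into A f z)) (f ` A) (g ` A)"
  proof (rule bij_betw_imageI)
    show "inj_on (\<lambda>z. g (inv_into A f z)) (f ` A)"
      using assms by (intro inj_onI) (metis f_inv_into_f inv_into_into)
    show "(\<lambda>z. g (inv_into A f z)) ` f ` A = g ` A"
      using assms by (auto simp: image_iff) (metis f_inv_into_f inv_into_into imageI)+
  qed
  then show ?thesis by (rule bij_betw_same_card)
qed

context group begin

lemma prime_order_subgroup_powers:
  assumes fin: "finite (carrier G)" and P: "subgroup P G" "prime (card P)" and x: "x \<in> P" "x \<noteq> \<one>" and y: "y \<in> P"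
  shows "\<exists>i::nat. y = x [^] i"
proof -
  have xc: "x \<in> carrier G" using x P by (simp add: subgroup.mem_carrier)
  have s: "subgroup (generate G {x}) G" using xc by (intro generate_is_subgroup) simp
  have le: "generate G {x} \<subseteq> P" using x P by (intro generate_subgroup_incl) auto
  have "card (generate G {x}) dvd card P" using subgroup_card_dvd[OF s P(1) le] .
  then have "card (generate G {x}) = 1 \<or> card (generate G {x}) = card P"
    using P(2) by (simp add: prime_nat_iff)
  moreover have "x \<in> generate G {x}" "\<one> \<in> generate G {x}"
    by (auto intro: generate.incl generate.one)
  then have "card (generate G {x}) \<noteq> 1" using x(2) by (auto simp: card_1_singleton_iff)
  ultimately have "generate G {x} = P"
    using le P fin subgroup_finite by (metis card_subset_eq)
  then have "y \<in> {x [^] k | k. k \<in> (UNIV :: nat set)}"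
    using generate_pow_on_finite_carrier[OF fin xc] y by simp
  then show ?thesis by auto
qed

lemma conj_pow:
  assumes "u \<in> carrier G" "x \<in> carrier G"
  shows "u \<otimes> x [^] (i::nat) \<otimes> inv u = (u \<otimes> x \<otimes> inv u) [^] i"
proof -
  interpret group_hom G G "\<lambda>x. u \<otimes> x \<otimes> inv u" using assms(1) by (rule conj_group_hom)
  show ?thesis using hom_nat_pow[OF assms(2)] by simp
qed

lemma conj_on_prime_order_subgroup:
  assumes fin: "finite (carrier G)" and P: "P \<lhd> G" "prime (card P)" and u: "u \<in> carrier G"
  shows "\<exists>a::nat. \<forall>l\<in>P. u \<otimes> l \<otimes> inv u = l [^] a"
proof -
  have Ps: "subgroup P G" using P(1) by (rule normal_imp_subgroup)
  have "P \<noteq> {\<one>}" using P(2) by auto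
  then obtain x where x: "x \<in> P" "x \<noteq> \<one>" using subgroup.one_closed[OF Ps] by blast
  have xc: "x \<in> carrier G" using x Ps by (simp add: subgroup.mem_carrier)
  have "u \<otimes> x \<otimes> inv u \<in> P" using P(1) u x by (simp add: normal_inv_iff)
  then obtain a :: nat where a: "u \<otimes> x \<otimes> inv u = x [^] a"
    using prime_order_subgroup_powers[OF fin Ps P(2) x] by blast
  have "u \<otimes> l \<otimes> inv u = l [^] a" if l: "l \<in> P" for l
  proof -
    obtain i :: nat where i: "l = x [^] i" using prime_order_subgroup_powers[OF fin Ps P(2) x(1) x(2) l] by blast
    show ?thesis using conj_pow[OF u xc, of i] xc by (simp add: i a nat_pow_pow mult.commute)
  qed
  then show ?thesis by blast
qed

definition centraliser :: "'a set \<Rightarrow> 'a set" where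
  "centraliser P = {c \<in> carrier G. \<forall>l\<in>P. c \<otimes> l \<otimes> inv c = l}"

lemma centraliser_subgroup:
  assumes "P \<subseteq> carrier G"
  shows "subgroup (centraliser P) G"
proof (rule subgroupI)
  fix c assume c: "c \<in> centraliser P"
  then have cc: "c \<in> carrier G" by (simp add: centraliser_def)
  have "inv c \<otimes> l \<otimes> inv (inv c) = l" if "l \<in> P" for l
  proof -
    have l: "l \<in> carrier G" "c \<otimes> l \<otimes> inv c = l" using c that assms by (auto simp: centraliser_def)
    show ?thesis using conj_inv_conj(1)[OF cc l(1)] l cc by simp
  qed
  then show "inv c \<in> centraliser P" using cc by (simp add: centraliser_def)
next
  fix c d assume c: "c \<in> centraliser P" "d \<in> centraliser P"
  then have cc: "c \<in> carrier G" "d \<in> carrier G" by (simp_all add: centraliser_def)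
  have "c \<otimes> d \<otimes> l \<otimes> inv (c \<otimes> d) = l" if "l \<in> P" for l
  proof -
    have l: "l \<in> carrier G" "c \<otimes> l \<otimes> inv c = l" "d \<otimes> l \<otimes> inv d = l"
      using c that assms by (auto simp: centraliser_def)
    show ?thesis using conj_conj[OF cc l(1)] l by simp
  qed
  then show "c \<otimes> d \<in> centraliser P" using cc by (simp add: centraliser_def)
next
  show "centraliser P \<noteq> {}" using assms by (auto simp: centraliser_def intro!: exI[of _ \<one>])
qed (simp add: centraliser_def subset_iff)

lemma centraliser_normal:
  assumes "P \<lhd> G"
  shows "centraliser P \<lhd> G"
proof -
  have Ps: "subgroup P G" using assms by (rule normal_imp_subgroup)
  have Pc: "P \<subseteq> carrier G" using Ps by (rule subgroup.subset)
  have "g \<otimes> c \<otimes> inv g \<in> centraliser P" if g: "g \<in> carrier G" and c: "c \<in> centraliser P" for g c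
  proof -
    have cc: "c \<in> carrier G" using c by (simp add: centraliser_def)
    have "(g \<otimes> c \<otimes> inv g) \<otimes> l \<otimes> inv (g \<otimes> c \<otimes> inv g) = l" if "l \<in> P" for l
    proof -
      have lc: "l \<in> carrier G" using that Pc by blast
      have l': "inv g \<otimes> l \<otimes> g \<in> P" using assms g that by (rule normal.inv_op_closed1)
      have "(g \<otimes> c \<otimes> inv g) \<otimes> l \<otimes> inv (g \<otimes> c \<otimes> inv g) = g \<otimes> (c \<otimes> (inv g \<otimes> l \<otimes> g) \<otimes> inv c) \<otimes> inv g"
        using g cc lc by (simp add: inv_mult_group m_assoc)
      also have "\<dots> = g \<otimes> (inv g \<otimes> l \<otimes> g) \<otimes> inv g" using c l' by (simp add: centraliser_def)
      also have "\<dots> = l" using g lc by (simp add: conj_inv_conj)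
      finally show ?thesis .
    qed
    then show ?thesis using g cc by (simp add: centraliser_def)
  qed
  then show ?thesis using centraliser_subgroup[OF Pc] by (simp add: normal_inv_iff)
qed

text \<open>
  Conjugation acts on a cyclic group by raising to powers, and such maps commute.
\<close>

lemma commutator_centralises_prime_order:
  assumes fin: "finite (carrier G)" and P: "P \<lhd> G" "prime (card P)"
    and u: "u \<in> carrier G" and v: "v \<in> carrier G"
  shows "u \<otimes> v \<otimes> inv u \<otimes> inv v \<in> centraliser P"
proof -
  have Ps: "subgroup P G" using P(1) by (rule normal_imp_subgroup)
  obtain a :: nat where a: "\<And>l. l \<in> P \<Longrightarrow> u \<otimes> l \<otimes> inv u = l [^] a"
    using conj_on_prime_order_subgroup[OF fin P u] by blast
  obtain b :: nat where b: "\<And>l. l \<in> P \<Longrightarrow> v \<otimes> l \<otimes> inv v = l [^] b"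
    using conj_on_prime_order_subgroup[OF fin P v] by blast
  have Pc: "l \<in> carrier G" if "l \<in> P" for l using that Ps by (rule subgroup.mem_carrier[rotated])
  have pw: "l [^] (i::nat) \<in> P" if "l \<in> P" for l i
    using that Ps by (induction i) (auto simp: subgroup.m_closed subgroup.one_closed)
  have eq: "(u \<otimes> v) \<otimes> l \<otimes> inv (u \<otimes> v) = (v \<otimes> u) \<otimes> l \<otimes> inv (v \<otimes> u)" if "l \<in> P" for l
    using that u v Pc a b pw
    by (simp flip: conj_conj add: nat_pow_pow mult.commute)
  have "(u \<otimes> v \<otimes> inv u \<otimes> inv v) \<otimes> l \<otimes> inv (u \<otimes> v \<otimes> inv u \<otimes> inv v) = l" if l: "l \<in> P" for l
  proof -
    define w where "w = v \<otimes> u"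
    have w: "w \<in> carrier G" using u v by (simp add: w_def)
    have l': "inv w \<otimes> l \<otimes> inv (inv w) \<in> P" using normal.inv_op_closed1[OF P(1) w l] w by simp
    have "u \<otimes> v \<otimes> inv u \<otimes> inv v = (u \<otimes> v) \<otimes> inv w"
      using u v by (simp add: w_def inv_mult_group m_assoc)
    then have "(u \<otimes> v \<otimes> inv u \<otimes> inv v) \<otimes> l \<otimes> inv (u \<otimes> v \<otimes> inv u \<otimes> inv v)
        = (u \<otimes> v) \<otimes> (inv w \<otimes> l \<otimes> inv (inv w)) \<otimes> inv (u \<otimes> v)"
      using u v w Pc[OF l] conj_conj[of "u \<otimes> v" "inv w" l] by simp
    also have "\<dots> = w \<otimes> (inv w \<otimes> l \<otimes> inv (inv w)) \<otimes> inv w"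
      using eq[OF l'] by (simp add: w_def)
    also have "\<dots> = l" using conj_inv_conj(2)[OF w Pc[OF l]] w by simp
    finally show ?thesis .
  qed
  then show ?thesis using u v by (simp add: centraliser_def)
qed

text \<open>
  The \<open>p\<close> conjugates of \<open>H\<close> meet pairwise trivially, so they cover \<open>p (q\<^sup>n - 1)\<close> nontrivial elements and
  leave only \<open>p - 1\<close> of them. A subgroup of order \<open>p\<close> has to fill this remainder, which is invariant under
  conjugation.
\<close>

lemma core_free_prime_index_normal_subgroup:
  assumes fin: "finite (carrier G)" and p: "prime p" and q: "prime q" and pq: "p \<noteq> q"
    and H: "subgroup H G" and cH: "card H = q ^ n" and o: "order G = p * card H"
    and nn: "\<not> H \<lhd> G"
    and core: "\<And>N. N \<lhd> G \<Longrightarrow> N \<subseteq> H \<Longrightarrow> N = {\<one>}"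
  shows "\<exists>P. P \<lhd> G \<and> card P = p"
proof -
  let ?C = "conj_sub G H"
  note sub = conj_sub_subgroup[OF H]
  have sn: "normaliser_of G H = H" using prime_index_normal_or_selfnormalizing[OF fin p H o] nn by blast
  have Hc: "H \<subseteq> carrier G" using H by (simp add: subgroup.subset)
  have cC: "card (?C g) = q ^ n" if "g \<in> carrier G" for g
    using conj_sub_card[OF Hc that] cH by simp
  have finC: "finite (?C g)" if "g \<in> carrier G" for g
    using sub[OF that] fin by (simp add: subgroup_finite)
  have "card H > 0" using fin H by (rule subgroup_card_pos)
  then have idx: "card (rcosets H) = p" using lagrange[OF H] o by simp
  have "card (?C ` carrier G) = card ((\<lambda>g. H #> g) ` carrier G)"
  proof (rule card_image_eq_if_same_fibres)
    fix x y assume xy: "x \<in> carrier G" "y \<in> carrier G"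
    have "?C x = ?C y \<longleftrightarrow> x \<otimes> inv y \<in> H" using conj_sub_eq_iff[OF H sn xy] .
    also have "\<dots> \<longleftrightarrow> x \<in> H #> y"
      using subgroup.rcos_module[OF H group_axioms xy(2,1)] by simp
    also have "\<dots> \<longleftrightarrow> H #> x = H #> y"
      using repr_independence[OF _ xy(2) H] rcos_self[OF xy(1) H] by metis
    finally show "?C x = ?C y \<longleftrightarrow> H #> x = H #> y" .
  qed
  also have "(\<lambda>g. H #> g) ` carrier G = rcosets H" by (auto simp: RCOSETS_def)
  finally have cF: "card (?C ` carrier G) = p" using idx by simp
  define U where "U = (\<Union>K\<in>?C ` carrier G. K - {\<one>})"
  have "card U = (\<Sum>K\<in>?C ` carrier G. card (K - {\<one>}))"
    unfolding U_def
  proof (rule card_UN_disjoint)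
    show "\<forall>K\<in>?C ` carrier G. \<forall>K'\<in>?C ` carrier G. K \<noteq> K' \<longrightarrow> (K - {\<one>}) \<inter> (K' - {\<one>}) = {}"
    proof clarify
      fix a b assume ab: "a \<in> carrier G" "b \<in> carrier G" "?C a \<noteq> ?C b"
      show "(?C a - {\<one>}) \<inter> (?C b - {\<one>}) = {}"
        using distinct_conjugates_meet_trivially[OF fin p q pq H cH o sn core ab] by blast
    qed
  qed (use fin finC in auto)
  also have "\<dots> = (\<Sum>K\<in>?C ` carrier G. q ^ n - 1)"
  proof (rule sum.cong)
    fix K assume "K \<in> ?C ` carrier G"
    then obtain g where g: "g \<in> carrier G" "K = ?C g" by blast
    then show "card (K - {\<one>}) = q ^ n - 1"
      using cC[of g] sub[of g] finC[of g] by (simp add: subgroup.one_closed)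
  qed simp
  also have "\<dots> = p * (q ^ n - 1)" using cF by simp
  finally have cU: "card U = p * (q ^ n - 1)" .
  have Uc: "U \<subseteq> carrier G - {\<one>}" by (auto simp: U_def conj_sub_def)
  \<comment> \<open>\<open>U\<close> is what the conjugates cover, \<open>E\<close> the nontrivial elements that they leave.\<close>
  define E where "E = carrier G - {\<one>} - U"
  have "card E = card (carrier G - {\<one>}) - card U"
    unfolding E_def using Uc fin by (intro card_Diff_subset) (auto intro: finite_subset)
  also have "card (carrier G - {\<one>}) = p * q ^ n - 1"
    using o cH fin by (simp add: order_def)
  also have "p * q ^ n - 1 - card U = p - 1"
  proof -
    have "p * q ^ n = p * (q ^ n - 1) + p"
      using q prime_gt_0_nat[OF q] by (simp add: algebra_simps)
    then show ?thesis unfolding cU by simp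
  qed
  finally have cE: "card E = p - 1" .
  obtain P where P: "subgroup P G" "card P = p ^ 1"
    using sylow_thm[OF p group_axioms, of 1 "card H"] o fin by auto
  have Pfin: "finite P" using P(1) fin by (simp add: subgroup_finite)
  have "P - {\<one>} \<subseteq> E"
  proof
    fix x assume x: "x \<in> P - {\<one>}"
    have "x \<notin> ?C g" if g: "g \<in> carrier G" for g
    proof -
      have s: "subgroup (P \<inter> ?C g) G" using P sub[OF g] by (simp add: subgroups_Inter_pair)
      have "card (P \<inter> ?C g) dvd p" "card (P \<inter> ?C g) dvd q ^ n"
        using subgroup_card_dvd[OF s P(1)] subgroup_card_dvd[OF s sub[OF g]] P cC[OF g] by auto
      moreover have "coprime p (q ^ n)" using primes_coprime[OF p q pq] by simp
      ultimately have "card (P \<inter> ?C g) = 1" using coprime_common_divisor_nat by blast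
      moreover have "\<one> \<in> P \<inter> ?C g" using s by (rule subgroup.one_closed)
      ultimately have "P \<inter> ?C g = {\<one>}" by (metis card_1_singletonE singletonD)
      then show ?thesis using x by blast
    qed
    then show "x \<in> E" using x P by (auto simp: E_def U_def subgroup.mem_carrier)
  qed
  moreover have "card (P - {\<one>}) = p - 1"
    using P Pfin by (simp add: subgroup.one_closed)
  moreover have "finite E" using fin by (simp add: E_def)
  ultimately have PE: "P - {\<one>} = E" using cE by (simp add: card_subset_eq)
  have "y \<otimes> x \<otimes> inv y \<in> P" if y: "y \<in> carrier G" and x: "x \<in> P" for x y
  proof (cases "x = \<one>")
    case True
    then show ?thesis using y P(1) by (simp add: subgroup.one_closed)
  next
    case False
    then have xE: "x \<in> E" using x PE by blast
    then have xc: "x \<in> carrier G" by (simp add: E_def)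
    have "y \<otimes> x \<otimes> inv y \<noteq> \<one>"
    proof
      assume "y \<otimes> x \<otimes> inv y = \<one>"
      then have "x = \<one>" using conj_inv_conj(1)[OF y xc] y by simp
      then show False using False by simp
    qed
    moreover have "y \<otimes> x \<otimes> inv y \<notin> U"
    proof
      assume "y \<otimes> x \<otimes> inv y \<in> U"
      then obtain g where g: "g \<in> carrier G" "y \<otimes> x \<otimes> inv y \<in> ?C g" by (auto simp: U_def)
      then have "x \<in> conj_sub G (?C g) y" using xc by (simp add: conj_sub_def[of _ "?C g"])
      then have "x \<in> ?C (g \<otimes> y)" using g y by (simp add: conj_sub_conj_sub)
      then have "x \<in> U" using False g y by (auto simp: U_def)
      then show False using xE by (simp add: E_def)
    qed
    ultimately have "y \<otimes> x \<otimes> inv y \<in> E" using y xc by (simp add: E_def)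
    then show ?thesis using PE by blast
  qed
  then have "P \<lhd> G" using P(1) by (simp add: normal_inv_iff)
  then show ?thesis using P(2) by auto
qed

text \<open>
  The centraliser of \<open>P\<close> meets \<open>H\<close> in a normal subgroup of \<open>G = H P\<close>, hence trivially, so it equals \<open>P\<close>;
  and it contains all commutators.
\<close>

lemma core_free_prime_index_structure:
  assumes fin: "finite (carrier G)" and p: "prime p" and q: "prime q" and pq: "p \<noteq> q"
    and H: "subgroup H G" and cH: "card H = q ^ n" and o: "order G = p * card H"
    and nn: "\<not> H \<lhd> G"
    and core: "\<And>N. N \<lhd> G \<Longrightarrow> N \<subseteq> H \<Longrightarrow> N = {\<one>}"
  shows "\<exists>P. P \<lhd> G \<and> card P = p \<and> (\<forall>u\<in>carrier G. \<forall>v\<in>carrier G. u \<otimes> v \<otimes> inv u \<otimes> inv v \<in> P)"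
proof -
  obtain P where P: "P \<lhd> G" "card P = p"
    using core_free_prime_index_normal_subgroup[OF assms] by blast
  have pP: "prime (card P)" using P p by simp
  have Ps: "subgroup P G" using P(1) by (rule normal_imp_subgroup)
  have Pc: "P \<subseteq> carrier G" using Ps by (rule subgroup.subset)
  have s: "subgroup (P \<inter> H) G" using Ps H by (rule subgroups_Inter_pair)
  have "card (P \<inter> H) dvd p" "card (P \<inter> H) dvd q ^ n"
    using subgroup_card_dvd[OF s Ps] subgroup_card_dvd[OF s H] P cH by auto
  moreover have "coprime p (q ^ n)" using primes_coprime[OF p q pq] by simp
  ultimately have PH: "card (P \<inter> H) = 1" using coprime_common_divisor_nat by blast
  have "card H > 0" using fin H by (rule subgroup_card_pos)
  then have idx: "card (rcosets H) = p" using lagrange[OF H] o by simp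
  have fact: "\<exists>h\<in>H. \<exists>l\<in>P. y = h \<otimes> l" if "y \<in> carrier G" for y
    using coset_meets_if_index[OF H Ps fin _ that] idx PH P by simp
  let ?Z = "centraliser P"
  have Zn: "?Z \<lhd> G" using P(1) by (rule centraliser_normal)
  have Zs: "subgroup ?Z G" using Zn by (rule normal_imp_subgroup)
  have PZ: "P \<subseteq> ?Z"
  proof
    fix l assume l: "l \<in> P"
    have lc: "l \<in> carrier G" using l Pc by blast
    have "l \<otimes> m \<otimes> inv l = m" if m: "m \<in> P" for m
    proof (cases "l = \<one>")
      case False
      obtain i :: nat where "m = l [^] i" using prime_order_subgroup_powers[OF fin Ps pP l False m] by blast
      then show ?thesis using conj_pow[OF lc lc, of i] lc by (simp add: m_assoc)
    qed (use m Pc in auto)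
    then show "l \<in> ?Z" using lc by (simp add: centraliser_def)
  qed
  have "H \<inter> ?Z \<lhd> G"
    unfolding normal_inv_iff
  proof (intro conjI ballI)
    show HZ: "subgroup (H \<inter> ?Z) G" using H Zs by (rule subgroups_Inter_pair)
    fix y z assume y: "y \<in> carrier G" and z: "z \<in> H \<inter> ?Z"
    obtain h l where hl: "h \<in> H" "l \<in> P" "y = h \<otimes> l" using fact[OF y] by blast
    have c: "h \<in> carrier G" "l \<in> carrier G" "z \<in> carrier G"
      using hl z H Pc by (auto simp: subgroup.mem_carrier)
    have "z \<otimes> l \<otimes> inv z = l" using z hl by (auto simp: centraliser_def)
    then have "z \<otimes> l = l \<otimes> z" using c by (metis inv_solve_right m_closed)
    then have "l \<otimes> z \<otimes> inv l = z" using c by (metis m_assoc r_inv r_one inv_closed)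
    then have "y \<otimes> z \<otimes> inv y = h \<otimes> z \<otimes> inv h" using conj_conj[OF c] hl(3) by simp
    moreover have "h \<otimes> z \<otimes> inv h \<in> H" using hl z H by (simp add: subgroup.m_closed subgroup.m_inv_closed)
    moreover have "h \<otimes> z \<otimes> inv h \<in> ?Z" using Zn c z by (simp add: normal_inv_iff)
    ultimately show "y \<otimes> z \<otimes> inv y \<in> H \<inter> ?Z" by simp
  qed
  then have HZ1: "H \<inter> ?Z = {\<one>}" by (rule core) simp
  have "u \<otimes> v \<otimes> inv u \<otimes> inv v \<in> P" if uv: "u \<in> carrier G" "v \<in> carrier G" for u v
  proof -
    define w where "w = u \<otimes> v \<otimes> inv u \<otimes> inv v"
    have wZ: "w \<in> ?Z" using commutator_centralises_prime_order[OF fin P(1) pP uv] by (simp add: w_def)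
    have wc: "w \<in> carrier G" using uv by (simp add: w_def)
    obtain h l where hl: "h \<in> H" "l \<in> P" "w = h \<otimes> l" using fact[OF wc] by blast
    have c: "h \<in> carrier G" "l \<in> carrier G" using hl H Pc by (auto simp: subgroup.mem_carrier)
    have "w \<otimes> inv l \<in> ?Z" using wZ hl PZ Zs by (meson subgroup.m_closed subgroup.m_inv_closed subsetD)
    moreover have "w \<otimes> inv l = h" using hl c by (simp add: m_assoc)
    ultimately have "h = \<one>" using hl HZ1 by blast
    then show ?thesis using hl c by (simp flip: w_def)
  qed
  then show ?thesis using P by blast
qed

end

section \<open>Modular, prime and chief steps\<close>

text \<open>
  A chain of \<open>prime_step\<close>s from the trivial group
  to \<open>G\<close> means that \<open>G\<close> is soluble; a chain of \<open>chief_step\<close>s, that \<open>G\<close> is supersoluble.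
\<close>

definition prime_step :: "('a, 'b) monoid_scheme \<Rightarrow> 'a set \<Rightarrow> 'a set \<Rightarrow> bool" where
  "prime_step G A B \<longleftrightarrow> normal_in G A B \<and> (\<exists>r::nat. prime r \<and> card B = r * card A)"

definition chief_step :: "('a, 'b) monoid_scheme \<Rightarrow> 'a set \<Rightarrow> 'a set \<Rightarrow> bool" where
  "chief_step G A B \<longleftrightarrow> A \<lhd> G \<and> B \<lhd> G \<and> A \<subseteq> B \<and> (\<exists>r::nat. prime r \<and> card B = r * card A)"

text \<open>
  Modular embedding in terms of subgroup orders, with the exponent bounded by \<open>k\<close> at once. Letting the primes
  coincide and letting \<open>N\<close> be smaller than the core makes the relation stable under images and inverse images;
  by \<open>modularly_embedded_iff_modular_step\<close> it is equivalent to the original notion.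
\<close>

definition modular_step :: "nat \<Rightarrow> ('a, 'b) monoid_scheme \<Rightarrow> 'a set \<Rightarrow> 'a set \<Rightarrow> bool" where
  "modular_step k G A B \<longleftrightarrow> normal_in G A B \<or>
     (subgroup A G \<and> subgroup B G \<and> A \<subseteq> B \<and>
      (\<exists>(p::nat) (q::nat) N. prime p \<and> prime q \<and> normal_in G N B \<and> N \<subseteq> A \<and>
         card B = p * card A \<and> card B dvd p * q ^ k * card N))"

lemma modular_step_subgroup:
  assumes "modular_step k G A B"
  shows "subgroup A G" "subgroup B G" "A \<subseteq> B"
  using assms by (auto simp: modular_step_def normal_in_def)

lemma rtranclp_map_step:
  assumes "R^** x y" and step: "\<And>x y. R x y \<Longrightarrow> f x = f y \<or> S (f x) (f y)"
  shows "S^** (f x) (f y)"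
  using assms(1)
proof induction
  case (step y z)
  then show ?case using assms(2)[of y z] by auto
qed simp

context group_hom begin

text \<open>
  The index of the image divides the index \<open>p\<close>.
\<close>

lemma index_image:
  assumes fin: "finite (carrier G)" and A: "subgroup A G" and B: "subgroup B G" and AB: "A \<subseteq> B"
    and p: "prime p" "card B = p * card A"
  shows "h ` A = h ` B \<or> card (h ` B) = p * card (h ` A)"
proof -
  let ?K = "kernel G H h"
  have Ks: "subgroup ?K G" by (rule subgroup_kernel)
  have AK: "subgroup (A \<inter> ?K) G" and BK: "subgroup (B \<inter> ?K) G"
    using A B Ks by (simp_all add: G.subgroups_Inter_pair)
  obtain t where t: "card (B \<inter> ?K) = card (A \<inter> ?K) * t"
    using G.subgroup_card_dvd[OF AK BK] AB by (auto elim: dvdE)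
  have hs: "subgroup (h ` A) H" "subgroup (h ` B) H"
    using A B by (simp_all add: subgroup_img_is_subgroup)
  obtain s where s: "card (h ` B) = card (h ` A) * s"
    using H.subgroup_card_dvd[OF hs] AB by (auto elim: dvdE)
  have "card (h ` A) * s * (card (A \<inter> ?K) * t) = p * (card (h ` A) * card (A \<inter> ?K))"
    using card_image[OF A fin] card_image[OF B fin] s t p(2) by simp
  moreover have "card (h ` A) * card (A \<inter> ?K) > 0"
    using card_image[OF A fin] G.subgroup_card_pos[OF fin A] by simp
  ultimately have "s * t = p" by (auto simp: algebra_simps)
  then have "s = 1 \<or> s = p" using p(1) by (metis dvd_triv_left prime_nat_iff)
  then show ?thesis
  proof
    assume "s = 1"
    moreover have "finite (h ` B)" using G.subgroup_finite[OF fin B] by simp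
    ultimately have "h ` A = h ` B" using s AB by (intro card_subset_eq) auto
    then show ?thesis ..
  next
    assume "s = p" then show ?thesis using s by (simp add: mult.commute)
  qed
qed

lemma prime_step_image:
  assumes fin: "finite (carrier G)" and "prime_step G A B"
  shows "h ` A = h ` B \<or> prime_step H (h ` A) (h ` B)"
proof -
  obtain r :: nat where n: "normal_in G A B" and r: "prime r" "card B = r * card A"
    using assms(2) by (auto simp: prime_step_def)
  show ?thesis
    using index_image[OF fin normal_inD(1-3)[OF n] r] normal_in_image[OF n] r(1)
    by (auto simp: prime_step_def)
qed

lemma modular_step_image:
  assumes fin: "finite (carrier G)" and st: "modular_step k G A B"
  shows "modular_step k H (h ` A) (h ` B)"
proof (cases "normal_in G A B")
  case True then show ?thesis by (simp add: modular_step_def normal_in_image)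
next
  case False
  then obtain p q :: nat and N where A: "subgroup A G" and B: "subgroup B G" and AB: "A \<subseteq> B"
    and p: "prime p" and q: "prime q" and N: "normal_in G N B" "N \<subseteq> A"
    and cB: "card B = p * card A" and dv: "card B dvd p * q ^ k * card N"
    using st by (auto simp: modular_step_def)
  let ?K = "kernel G H h"
  have Ks: "subgroup ?K G" by (rule subgroup_kernel)
  have Ns: "subgroup N G" using N by (simp add: normal_inD)
  have hs: "subgroup (h ` A) H" "subgroup (h ` B) H" "h ` A \<subseteq> h ` B"
    using A B AB by (auto simp: subgroup_img_is_subgroup)
  have NK: "subgroup (N \<inter> ?K) G" and BK: "subgroup (B \<inter> ?K) G"
    using Ns B Ks by (simp_all add: G.subgroups_Inter_pair)
  obtain t where t: "card (B \<inter> ?K) = card (N \<inter> ?K) * t"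
    using G.subgroup_card_dvd[OF NK BK] AB N by (auto elim: dvdE)
  have "card (h ` B) * (card (N \<inter> ?K) * t) dvd p * q ^ k * (card (h ` N) * card (N \<inter> ?K))"
    using dv card_image[OF B fin] card_image[OF Ns fin] t by simp
  then have "card (N \<inter> ?K) * (card (h ` B) * t) dvd card (N \<inter> ?K) * (p * q ^ k * card (h ` N))"
    by (simp add: algebra_simps)
  moreover have "card (N \<inter> ?K) > 0" using G.subgroup_card_pos[OF fin NK] .
  ultimately have dv': "card (h ` B) dvd p * q ^ k * card (h ` N)"
    by (metis dvd_mult_left nat_mult_dvd_cancel_disj not_gr_zero)
  from index_image[OF fin A B AB p cB] show ?thesis
  proof
    assume "h ` A = h ` B"
    then show ?thesis using hs H.normal_in_refl by (simp add: modular_step_def)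
  next
    assume "card (h ` B) = p * card (h ` A)"
    then show ?thesis
      unfolding modular_step_def using hs p q normal_in_image[OF N(1)] N(2) dv' by blast
  qed
qed

end

context finite_epi begin

lemma preimage_mono: "A \<subseteq> B \<Longrightarrow> preimage G h A \<subseteq> preimage G h B"
  by (auto simp: preimage_def)

lemma preimage_normal: "A \<lhd> H \<Longrightarrow> preimage G h A \<lhd> G"
  using normal_in_preimage[of A "carrier H"] preimage_carrier
  by (simp add: G.normal_in_carrier_iff H.normal_in_carrier_iff)

lemma image_normal: "A \<lhd> G \<Longrightarrow> h ` A \<lhd> H"
  using normal_in_image[of A "carrier G"] surj
  by (simp add: G.normal_in_carrier_iff H.normal_in_carrier_iff)

lemma prime_step_preimage:
  assumes "prime_step H A B"
  shows "prime_step G (preimage G h A) (preimage G h B)"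
  using assms by (auto simp: prime_step_def normal_in_preimage normal_inD card_preimage mult.assoc)

lemma chief_step_preimage:
  assumes "chief_step H A B"
  shows "chief_step G (preimage G h A) (preimage G h B)"
  using assms
  by (auto simp: chief_step_def preimage_normal preimage_mono normal_imp_subgroup card_preimage mult.assoc
      simp del: mult_cancel2)

lemma chief_step_image:
  assumes "chief_step G A B"
  shows "h ` A = h ` B \<or> chief_step H (h ` A) (h ` B)"
proof -
  obtain r :: nat where n: "A \<lhd> G" "B \<lhd> G" "A \<subseteq> B" and r: "prime r" "card B = r * card A"
    using assms by (auto simp: chief_step_def)
  show ?thesis
    using index_image[OF fin normal_imp_subgroup[OF n(1)] normal_imp_subgroup[OF n(2)] n(3) r] n r(1)
    by (auto simp: chief_step_def image_normal)
qed

lemma modular_step_preimage: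
  assumes "modular_step k H A B"
  shows "modular_step k G (preimage G h A) (preimage G h B)"
proof (cases "normal_in H A B")
  case True then show ?thesis by (simp add: modular_step_def normal_in_preimage)
next
  case False
  then obtain p q :: nat and N where A: "subgroup A H" and B: "subgroup B H" and AB: "A \<subseteq> B"
    and p: "prime p" and q: "prime q" and N: "normal_in H N B" "N \<subseteq> A"
    and cB: "card B = p * card A" and dv: "card B dvd p * q ^ k * card N"
    using assms by (auto simp: modular_step_def)
  have "card (preimage G h B) = p * card (preimage G h A)"
    using A B cB by (simp add: card_preimage)
  moreover have "card (preimage G h B) dvd p * q ^ k * card (preimage G h N)"
    using B N dv normal_inD(1)[OF N(1)] by (simp add: card_preimage flip: mult.assoc)
  ultimately show ?thesis
    unfolding modular_step_def
    using p q A B subgroup_preimage preimage_mono[OF AB] preimage_mono[OF N(2)] normal_in_preimage[OF N(1)]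
    by blast
qed

lemma modular_steps_image: "(modular_step k G)^** A B \<Longrightarrow> (modular_step k H)^** (h ` A) (h ` B)"
  by (erule rtranclp_map_step) (simp add: modular_step_image fin)

lemma modular_steps_preimage:
  "(modular_step k H)^** A B \<Longrightarrow> (modular_step k G)^** (preimage G h A) (preimage G h B)"
  by (erule rtranclp_map_step) (simp add: modular_step_preimage)

end

context group begin

lemma subgroup_group: "subgroup B G \<Longrightarrow> group (G\<restriction>B)"
  by (rule subgroup.subgroup_is_group[OF _ group_axioms])

lemma chief_step_imp_prime_step:
  assumes "chief_step G A B"
  shows "prime_step G A B"
proof -
  have n: "A \<lhd> G" "B \<lhd> G" "A \<subseteq> B" using assms by (auto simp: chief_step_def)
  then have "normal_in G A B"
    using normal_in_subset[of A "carrier G" B] subgroup.subset[OF normal_imp_subgroup[OF n(2)]]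
    by (simp add: normal_in_carrier_iff normal_imp_subgroup)
  then show ?thesis using assms by (auto simp: prime_step_def chief_step_def)
qed

lemma modular_step_restrict_iff:
  assumes "subgroup B G" "C \<subseteq> B"
  shows "modular_step k (G\<restriction>B) A C \<longleftrightarrow> modular_step k G A C"
proof -
  have "A \<subseteq> C \<Longrightarrow> A \<subseteq> B" using assms(2) by blast
  then show ?thesis
    using assms(2) unfolding modular_step_def subgroup_restrict_iff[OF assms(1)] normal_in_restrict_iff[OF assms]
    by metis
qed

lemma prime_step_restrict_iff:
  assumes "subgroup B G" "C \<subseteq> B"
  shows "prime_step (G\<restriction>B) A C \<longleftrightarrow> prime_step G A C"
  unfolding prime_step_def normal_in_restrict_iff[OF assms] ..

lemma modular_steps_subset: "(modular_step k G)^** A B \<Longrightarrow> A \<subseteq> B"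
  by (induction rule: rtranclp_induct) (auto dest: modular_step_subgroup)

lemma modular_steps_restrict_iff:
  assumes "subgroup B G"
  shows "(modular_step k (G\<restriction>B))^** A B \<longleftrightarrow> (modular_step k G)^** A B"
proof
  interpret B: group "G\<restriction>B" using assms by (rule subgroup_group)
  assume "(modular_step k (G\<restriction>B))^** A B"
  then show "(modular_step k G)^** A B"
  proof (rule rtranclp_mono[THEN predicate2D, rotated], intro predicate2I)
    fix C D assume st: "modular_step k (G\<restriction>B) C D"
    then have "D \<subseteq> B" using modular_step_subgroup(2)[OF st] subgroup.subset by force
    then show "modular_step k G C D" using st modular_step_restrict_iff[OF assms] by blast
  qed
next
  assume "(modular_step k G)^** A B"
  then show "(modular_step k (G\<restriction>B))^** A B"
  proof (induction rule: converse_rtranclp_induct)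
    case (step C D)
    then have "D \<subseteq> B" using modular_steps_subset by blast
    then have "modular_step k (G\<restriction>B) C D" using step modular_step_restrict_iff[OF assms] by blast
    then show ?case using step.IH by (rule converse_rtranclp_into_rtranclp)
  qed simp
qed

text \<open>
  Passing from \<open>N\<close> to the core can only shrink the quotient, so modulo the core the order is still \<open>p q\<^sup>n\<close> with
  \<open>n \<le> k\<close>.
\<close>

lemma prime_index_core_quotient:
  fixes p q :: nat
  assumes fin: "finite (carrier G)" and H: "subgroup H G" and nn: "\<not> H \<lhd> G"
    and p: "prime p" and q: "prime q" and N: "N \<lhd> G" "N \<subseteq> H"
    and o: "order G = p * card H" and dv: "order G dvd p * q ^ k * card N"
  obtains n where "n \<le> k" "card (((#>) (core_in H)) ` H) = q ^ n" "order (G Mod core_in H) = p * q ^ n"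
    "\<not> ((#>) (core_in H)) ` H \<lhd> G Mod core_in H"
proof -
  define R where "R = core_in H"
  have Rn: "R \<lhd> G" unfolding R_def using H by (rule core_in_normal)
  have Rs: "subgroup R G" using Rn by (rule normal_imp_subgroup)
  have RH: "R \<subseteq> H" by (simp add: R_def core_in_subset)
  have NR: "N \<subseteq> R" using N by (simp add: R_def core_in_greatest)
  have R0: "card R > 0" using fin Rs by (rule subgroup_card_pos)
  interpret \<phi>: finite_epi G "G Mod R" "(#>) R" using Rn fin by (rule quotient_finite_epi)
  have ker: "kernel G (G Mod R) ((#>) R) = R" using Rn by (rule kernel_quotient)
  let ?H = "((#>) R) ` H"
  have cH: "card ?H * card R = card H"
    using \<phi>.card_image[OF H fin] RH by (simp add: ker Int_absorb1)
  have oR: "order G = order (G Mod R) * card R" using \<phi>.order_eq by (simp add: ker)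
  have o': "order (G Mod R) = p * card ?H" using oR o cH[symmetric] R0 by simp
  have "card N dvd card R" using subgroup_card_dvd[OF normal_imp_subgroup[OF N(1)] Rs NR] .
  then have "order G dvd p * q ^ k * card R" using dv by (meson dvd_trans mult_dvd_mono dvd_refl)
  then have "(card R * p) * card ?H dvd (card R * p) * q ^ k" using oR o' by (simp add: algebra_simps)
  then have "card ?H dvd q ^ k" using R0 prime_gt_0_nat[OF p] by (subst (asm) nat_mult_dvd_cancel1) auto
  then obtain n where n: "n \<le> k" "card ?H = q ^ n" using q by (auto simp: divides_primepow_nat)
  have "\<not> ?H \<lhd> G Mod R"
  proof
    assume "?H \<lhd> G Mod R"
    then have "preimage G ((#>) R) ?H \<lhd> G" by (rule \<phi>.preimage_normal)
    then show False using nn \<phi>.preimage_image[OF H] RH by (simp add: ker)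
  qed
  then show thesis using that n o' by (simp add: R_def)
qed

text \<open>
  The structure of core-free subgroups, lifted from the quotient by the core. The primes differ because in a
  \<open>p\<close>-group a subgroup of index \<open>p\<close> is normal.
\<close>

lemma modular_step_structure_whole:
  fixes p q :: nat
  assumes fin: "finite (carrier G)" and H: "subgroup H G" and nn: "\<not> H \<lhd> G"
    and p: "prime p" and q: "prime q" and N: "N \<lhd> G" "N \<subseteq> H"
    and o: "order G = p * card H" and dv: "order G dvd p * q ^ k * card N"
  shows "\<exists>n M L. p \<noteq> q \<and> n \<le> k \<and> M \<lhd> G \<and> L \<lhd> G \<and> M \<subseteq> H \<and> M \<subseteq> L \<and> card L = p * card M \<and>
    order G = p * q ^ n * card M \<and> (\<forall>u\<in>carrier G. \<forall>v\<in>carrier G. u \<otimes> v \<otimes> inv u \<otimes> inv v \<in> L)"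
proof -
  define R where "R = core_in H"
  have Rn: "R \<lhd> G" unfolding R_def using H by (rule core_in_normal)
  have Rs: "subgroup R G" using Rn by (rule normal_imp_subgroup)
  have RH: "R \<subseteq> H" by (simp add: R_def core_in_subset)
  interpret \<phi>: finite_epi G "G Mod R" "(#>) R" using Rn fin by (rule quotient_finite_epi)
  have ker: "kernel G (G Mod R) ((#>) R) = R" using Rn by (rule kernel_quotient)
  let ?H = "((#>) R) ` H"
  have Hs: "subgroup ?H (G Mod R)" using H by (rule \<phi>.subgroup_img_is_subgroup)
  have oR: "order G = order (G Mod R) * card R" using \<phi>.order_eq by (simp add: ker)
  obtain n where n: "n \<le> k" "card ?H = q ^ n" and oQ: "order (G Mod R) = p * q ^ n" and nn': "\<not> ?H \<lhd> G Mod R"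
    using prime_index_core_quotient[OF assms] unfolding R_def by metis
  have o': "order (G Mod R) = p * card ?H" using oQ n by simp
  have pq: "p \<noteq> q"
  proof
    assume "p = q"
    then have "order (G Mod R) = p ^ Suc n" using o' n by simp
    then show False using \<phi>.H.prime_index_normal_if_p_group[OF p Hs o'] nn' by blast
  qed
  have core: "M = {\<one>\<^bsub>G Mod R\<^esub>}" if M: "M \<lhd> G Mod R" "M \<subseteq> ?H" for M
  proof -
    have "preimage G ((#>) R) M \<subseteq> preimage G ((#>) R) ?H" using M(2) by (rule \<phi>.preimage_mono)
    then have "preimage G ((#>) R) M \<subseteq> H" using \<phi>.preimage_image[OF H] RH by (simp add: ker)
    then have "preimage G ((#>) R) M \<subseteq> R"
      unfolding R_def by (intro core_in_greatest \<phi>.preimage_normal[unfolded R_def] M(1)[unfolded R_def])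
    then have "((#>) R) ` preimage G ((#>) R) M \<subseteq> ((#>) R) ` R" by (rule image_mono)
    moreover have "((#>) R) ` R \<subseteq> {\<one>\<^bsub>G Mod R\<^esub>}"
      using Rs by (auto simp: coset_join2 subgroup.mem_carrier)
    ultimately have "((#>) R) ` preimage G ((#>) R) M \<subseteq> {\<one>\<^bsub>G Mod R\<^esub>}"
      by (rule subset_trans)
    then have "M \<subseteq> {\<one>\<^bsub>G Mod R\<^esub>}"
      by (simp only: \<phi>.image_preimage[OF subgroup.subset[OF normal_imp_subgroup[OF M(1)]]])
    moreover have "\<one>\<^bsub>G Mod R\<^esub> \<in> M"
      using subgroup.one_closed[OF normal_imp_subgroup[OF M(1)]] .
    ultimately show ?thesis by auto
  qed
  obtain P where P: "P \<lhd> G Mod R" "card P = p"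
    and comm: "\<And>u v. u \<in> carrier (G Mod R) \<Longrightarrow> v \<in> carrier (G Mod R) \<Longrightarrow>
        u \<otimes>\<^bsub>G Mod R\<^esub> v \<otimes>\<^bsub>G Mod R\<^esub> inv\<^bsub>G Mod R\<^esub> u \<otimes>\<^bsub>G Mod R\<^esub> inv\<^bsub>G Mod R\<^esub> v \<in> P"
    using \<phi>.H.core_free_prime_index_structure[OF \<phi>.fin_H p q pq Hs n(2) o' nn' core] by blast
  define L where "L = preimage G ((#>) R) P"
  have Ln: "L \<lhd> G" unfolding L_def using P(1) by (rule \<phi>.preimage_normal)
  have RL: "R \<subseteq> L"
    using \<phi>.kernel_preimage[OF normal_imp_subgroup[OF P(1)]] by (simp add: ker L_def)
  have cL: "card L = p * card R"
    using \<phi>.card_preimage[OF normal_imp_subgroup[OF P(1)]] P(2) by (simp add: ker L_def)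
  have "u \<otimes> v \<otimes> inv u \<otimes> inv v \<in> L" if uv: "u \<in> carrier G" "v \<in> carrier G" for u v
  proof -
    have "R #> (u \<otimes> v \<otimes> inv u \<otimes> inv v) = (R #> u) \<otimes>\<^bsub>G Mod R\<^esub> (R #> v) \<otimes>\<^bsub>G Mod R\<^esub> inv\<^bsub>G Mod R\<^esub> (R #> u) \<otimes>\<^bsub>G Mod R\<^esub> inv\<^bsub>G Mod R\<^esub> (R #> v)"
      using uv by (simp only: \<phi>.hom_mult \<phi>.hom_inv m_closed inv_closed)
    then show ?thesis using comm[of "R #> u" "R #> v"] uv \<phi>.hom_closed by (simp add: L_def preimage_def)
  qed
  moreover have "order G = p * q ^ n * card R" using oR o' n by simp
  ultimately show ?thesis using pq n Rn Ln RH RL cL by blast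
qed

lemma modular_step_structure:
  assumes fin: "finite (carrier G)" and st: "modular_step k G A B" and nn: "\<not> normal_in G A B"
  obtains p q n :: nat and N L where "prime p" "prime q" "p \<noteq> q" "n \<le> k" "normal_in G N B" "normal_in G L B"
    "N \<subseteq> A" "N \<subseteq> L" "card L = p * card N" "card B = p * card A" "card B = p * q ^ n * card N"
    "\<And>u v. u \<in> B \<Longrightarrow> v \<in> B \<Longrightarrow> u \<otimes> v \<otimes> inv u \<otimes> inv v \<in> L"
proof -
  obtain p q :: nat and N where A: "subgroup A G" and B: "subgroup B G" and AB: "A \<subseteq> B"
    and p: "prime p" and q: "prime q" and N: "normal_in G N B" "N \<subseteq> A"
    and cB: "card B = p * card A" and dv: "card B dvd p * q ^ k * card N"
    using st nn by (auto simp: modular_step_def)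
  interpret B: group "G\<restriction>B" using B by (rule subgroup_group)
  have "\<exists>n M L. p \<noteq> q \<and> n \<le> k \<and> M \<lhd> G\<restriction>B \<and> L \<lhd> G\<restriction>B \<and> M \<subseteq> A \<and> M \<subseteq> L \<and>
      card L = p * card M \<and> order (G\<restriction>B) = p * q ^ n * card M \<and>
      (\<forall>u\<in>carrier (G\<restriction>B). \<forall>v\<in>carrier (G\<restriction>B). u \<otimes>\<^bsub>G\<restriction>B\<^esub> v \<otimes>\<^bsub>G\<restriction>B\<^esub>
        inv\<^bsub>G\<restriction>B\<^esub> u \<otimes>\<^bsub>G\<restriction>B\<^esub> inv\<^bsub>G\<restriction>B\<^esub> v \<in> L)"
  proof (rule B.modular_step_structure_whole[OF _ _ _ p q])
    show "finite (carrier (G\<restriction>B))" using subgroup_finite[OF fin B] by simp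
    show "subgroup A (G\<restriction>B)" using A B AB by (simp add: subgroup_incl)
    show "\<not> A \<lhd> G\<restriction>B" using nn normal_in_iff[OF B] by blast
    show "N \<lhd> G\<restriction>B" using N(1) normal_in_iff[OF B] by blast
  qed (use N cB dv in \<open>simp_all add: order_def\<close>)
  then obtain n M L where "p \<noteq> q" "n \<le> k" "M \<lhd> G\<restriction>B" "L \<lhd> G\<restriction>B" "M \<subseteq> A" "M \<subseteq> L"
      "card L = p * card M" "card B = p * q ^ n * card M"
      "\<And>u v. u \<in> B \<Longrightarrow> v \<in> B \<Longrightarrow> u \<otimes> v \<otimes> inv\<^bsub>G\<restriction>B\<^esub> u \<otimes> inv\<^bsub>G\<restriction>B\<^esub> v \<in> L"
    by (auto simp: order_def)
  then show thesis
    using that[of p q n M L] p q cB by (simp add: normal_in_iff[OF B] m_inv_consistent[OF B])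
qed

text \<open>
  \<open>V / (V \<inter> N)\<close> embeds in \<open>B / N\<close>.
\<close>

lemma card_dvd_index_times_Int:
  assumes fin: "finite (carrier G)" and N: "normal_in G N B" and V: "subgroup V G" "V \<subseteq> B"
    and c: "card B = c * card N"
  shows "card V dvd c * card (V \<inter> N)"
proof -
  have B: "subgroup B G" using N by (rule normal_inD)
  interpret B: group "G\<restriction>B" using B by (rule subgroup_group)
  have Nn: "N \<lhd> G\<restriction>B" using N normal_in_iff[OF B] by blast
  let ?f = "\<lambda>x. N #>\<^bsub>G\<restriction>B\<^esub> x"
  let ?Q = "G\<restriction>B Mod N"
  have finB: "finite (carrier (G\<restriction>B))" using subgroup_finite[OF fin B] by simp
  interpret \<phi>: finite_epi "G\<restriction>B" ?Q ?f
    using Nn finB by (rule B.quotient_finite_epi)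
  have ker: "kernel (G\<restriction>B) ?Q ?f = N" using Nn by (rule B.kernel_quotient)
  have Vs: "subgroup V (G\<restriction>B)" using V B by (simp add: subgroup_incl)
  have "card N > 0" using subgroup_card_pos[OF fin normal_inD(1)[OF N]] .
  moreover have o: "order (G\<restriction>B) = card B" by (simp add: order_def)
  have "order ?Q * card N = c * card N"
    using \<phi>.order_eq unfolding ker o c by (rule sym)
  ultimately have "order ?Q = c" by simp
  moreover have "card (?f ` V) dvd order ?Q"
    using \<phi>.H.subgroup_card_dvd[OF \<phi>.subgroup_img_is_subgroup[OF Vs] \<phi>.H.subgroup_self]
      subgroup.subset[OF \<phi>.subgroup_img_is_subgroup[OF Vs]] by (simp add: order_def)
  ultimately show ?thesis
    using \<phi>.card_image[OF Vs finB] unfolding ker by (metis mult_dvd_mono dvd_refl)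
qed

lemma prime_step_Int:
  assumes fin: "finite (carrier G)" and st: "prime_step G A B" and U: "subgroup U G"
  shows "A \<inter> U = B \<inter> U \<or> prime_step G (A \<inter> U) (B \<inter> U)"
proof -
  obtain r :: nat where n: "normal_in G A B" and r: "prime r" "card B = r * card A"
    using st by (auto simp: prime_step_def)
  have s: "subgroup (B \<inter> U) G" "subgroup (A \<inter> U) G"
    using normal_inD[OF n] U by (simp_all add: subgroups_Inter_pair)
  have AB: "A \<subseteq> B" using n by (rule normal_inD)
  have "card (B \<inter> U) dvd r * card (B \<inter> U \<inter> A)"
    using card_dvd_index_times_Int[OF fin n s(1) _ r(2)] by simp
  moreover have "B \<inter> U \<inter> A = A \<inter> U" using AB by blast
  moreover obtain t where t: "card (B \<inter> U) = card (A \<inter> U) * t"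
    using subgroup_card_dvd[OF s(2,1)] AB by (auto elim: dvdE)
  ultimately have "card (A \<inter> U) * t dvd card (A \<inter> U) * r" by (simp add: mult.commute)
  then have "t dvd r" using subgroup_card_pos[OF fin s(2)] by simp
  then have "t = 1 \<or> t = r" using r by (simp add: prime_nat_iff)
  then show ?thesis
  proof
    assume "t = 1"
    then have "A \<inter> U = B \<inter> U"
      using t AB subgroup_finite[OF fin s(1)] by (intro card_subset_eq) auto
    then show ?thesis ..
  next
    assume "t = r"
    then show ?thesis using t r normal_in_Int_subgroup[OF n U] by (auto simp: prime_step_def mult.commute)
  qed
qed

lemma normal_in_if_commutators:
  assumes "subgroup A G" "subgroup B G" "A \<subseteq> B"
    and c: "\<And>u v. u \<in> B \<Longrightarrow> v \<in> A \<Longrightarrow> u \<otimes> v \<otimes> inv u \<otimes> inv v \<in> A"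
  shows "normal_in G A B"
  unfolding normal_in_def
proof (intro conjI ballI)
  fix u v assume uv: "u \<in> B" "v \<in> A"
  then have cc: "u \<in> carrier G" "v \<in> carrier G" using assms by (auto simp: subgroup.mem_carrier)
  have "u \<otimes> v \<otimes> inv u \<otimes> inv v \<otimes> v \<in> A" using c[OF uv] uv(2) assms(1) by (simp add: subgroup.m_closed)
  then show "u \<otimes> v \<otimes> inv u \<in> A" using cc by (simp add: m_assoc)
qed (use assms in auto)

text \<open>
  A non-normal modular step meets \<open>U\<close> in a step of the same index \<open>p\<close> if \<open>V = B \<inter> U\<close> covers the \<open>p\<close>-part
  of \<open>B / N\<close>, and in a normal step otherwise: then \<open>L \<inter> V = N \<inter> V\<close>, and since \<open>L\<close> contains all commutators of \<open>B\<close>, every subgroup of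
  \<open>V\<close> above \<open>N \<inter> V\<close> is normal in \<open>V\<close>.
\<close>

lemma modular_step_Int:
  assumes fin: "finite (carrier G)" and st: "modular_step k G A B" and U: "subgroup U G"
  shows "modular_step k G (A \<inter> U) (B \<inter> U)"
proof (cases "normal_in G A B")
  case True
  then show ?thesis using normal_in_Int_subgroup[OF True U] by (simp add: modular_step_def)
next
  case False
  obtain p q n :: nat and N L where p: "prime p" and q: "prime q" and pq: "p \<noteq> q" and n: "n \<le> k"
    and N: "normal_in G N B" and L: "normal_in G L B" and NA: "N \<subseteq> A" and NL: "N \<subseteq> L"
    and cL: "card L = p * card N" and cA: "card B = p * card A" and cN: "card B = p * q ^ n * card N"
    and comm: "\<And>u v. u \<in> B \<Longrightarrow> v \<in> B \<Longrightarrow> u \<otimes> v \<otimes> inv u \<otimes> inv v \<in> L"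
    using modular_step_structure[OF fin st False] by metis
  have A: "subgroup A G" and B: "subgroup B G" and AB: "A \<subseteq> B" using modular_step_subgroup[OF st] by auto
  have Ns: "subgroup N G" and Ls: "subgroup L G" and LB: "L \<subseteq> B" using N L by (auto simp: normal_inD)
  define V where "V = B \<inter> U"
  have V: "subgroup V G" "V \<subseteq> B" using B U by (auto simp: V_def subgroups_Inter_pair)
  have AV: "A \<inter> U = A \<inter> V" using AB by (auto simp: V_def)
  have NV: "N \<inter> U = N \<inter> V" using AB NA by (auto simp: V_def)
  have s: "subgroup (A \<inter> V) G" "subgroup (N \<inter> V) G" "subgroup (L \<inter> V) G"
    using A Ns Ls V by (simp_all add: subgroups_Inter_pair)
  have Vf: "finite V" using subgroup_finite[OF fin V(1)] .
  have N0: "card (N \<inter> V) > 0" and A0: "card (A \<inter> V) > 0" and cN0: "card N > 0"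
    using subgroup_card_pos[OF fin] s Ns by auto
  obtain c where c: "card V = card (N \<inter> V) * c"
    using subgroup_card_dvd[OF s(2) V(1)] by (auto elim: dvdE)
  have "card V dvd p * q ^ n * card (N \<inter> V)"
    using card_dvd_index_times_Int[OF fin N V cN] by (simp add: Int_commute)
  moreover have "p * q ^ n * card (N \<inter> V) dvd p * q ^ k * card (N \<inter> V)"
    using n by (intro mult_dvd_mono le_imp_power_dvd) auto
  ultimately have dv: "card V dvd p * q ^ k * card (N \<inter> V)" by (rule dvd_trans)
  show ?thesis
  proof (cases "p dvd c")
    case True
    \<comment> \<open>\<open>A \<inter> V\<close> has index at most \<open>p\<close> in \<open>V\<close>, and index prime to \<open>p\<close> over \<open>N \<inter> V\<close>; so the former is \<open>p\<close>.\<close>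
    interpret B: group "G\<restriction>B" using B by (rule subgroup_group)
    have Bs: "subgroup A (G\<restriction>B)" "subgroup V (G\<restriction>B)"
      using A V B AB by (simp_all add: subgroup_incl)
    have finB: "finite (carrier (G\<restriction>B))" using subgroup_finite[OF fin B] by simp
    define m where "m = card ((\<lambda>g. A #>\<^bsub>G\<restriction>B\<^esub> g) ` V)"
    have m: "m * card (A \<inter> V) = card V"
      using B.card_cosets_meeting[OF Bs finB] by (simp add: m_def Int_commute)
    have rA: "card (rcosets\<^bsub>G\<restriction>B\<^esub> A) = p"
      using B.lagrange[OF Bs(1)] cA subgroup_card_pos[OF fin A] by (simp add: order_def)
    have "(\<lambda>g. A #>\<^bsub>G\<restriction>B\<^esub> g) ` V \<subseteq> rcosets\<^bsub>G\<restriction>B\<^esub> A"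
      using V(2) by (auto simp: RCOSETS_def)
    moreover have "finite (rcosets\<^bsub>G\<restriction>B\<^esub> A)"
      using rA prime_gt_0_nat[OF p] by (metis card.infinite less_numeral_extra(3))
    ultimately have "m \<le> p" unfolding m_def using rA card_mono by metis
    have "card A = q ^ n * card N" using cA cN prime_gt_0_nat[OF p] by simp
    then have "card (A \<inter> V) dvd q ^ n * card (A \<inter> V \<inter> N)"
      using card_dvd_index_times_Int[OF fin normal_in_subset[OF N A NA AB] s(1), of "q ^ n"] by simp
    moreover have "A \<inter> V \<inter> N = N \<inter> V" using NA by blast
    moreover obtain d where d: "card (A \<inter> V) = card (N \<inter> V) * d"
      using subgroup_card_dvd[OF s(2,1)] NA by (auto elim: dvdE)
    ultimately have "card (N \<inter> V) * d dvd card (N \<inter> V) * q ^ n" by (simp add: mult.commute)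
    then have "d dvd q ^ n" using N0 by simp
    then have "\<not> p dvd d"
      using p q pq by (metis dvd_trans prime_dvd_power primes_dvd_imp_eq)
    have "c = m * d" using c m d N0 by (simp add: algebra_simps)
    then have "p dvd m" using True \<open>\<not> p dvd d\<close> p by (simp add: prime_dvd_mult_iff)
    moreover have "m > 0" using m subgroup_card_pos[OF fin V(1)] by (cases m) auto
    ultimately have "m = p" using \<open>m \<le> p\<close> by (simp add: dvd_imp_le order_antisym)
    then have "card V = p * card (A \<inter> V)" using m by simp
    moreover have "normal_in G (N \<inter> V) V"
      using normal_in_Int_subgroup[OF N V(1)] V(2) by (simp add: Int_absorb1)
    moreover have "N \<inter> V \<subseteq> A \<inter> V" using NA by blast
    ultimately show ?thesis
      unfolding modular_step_def AV V_def[symmetric] using p q s V dv by blast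
  next
    case False
    have "card (L \<inter> V) dvd p * card (L \<inter> V \<inter> N)"
      using card_dvd_index_times_Int[OF fin normal_in_subset[OF N Ls NL LB] s(3) _ cL] by simp
    moreover have "L \<inter> V \<inter> N = N \<inter> V" using NL by blast
    moreover obtain d where d: "card (L \<inter> V) = card (N \<inter> V) * d"
      using subgroup_card_dvd[OF s(2,3)] NL by (auto elim: dvdE)
    ultimately have "d dvd p" using N0 by (simp add: mult.commute[of p])
    moreover have "d dvd c"
      using subgroup_card_dvd[OF s(3) V(1)] d c N0 by simp
    ultimately have "d = 1" using False p by (metis prime_nat_iff)
    then have "N \<inter> V = L \<inter> V" using d NL Vf by (intro card_subset_eq) auto
    then have LA: "L \<inter> V \<subseteq> A \<inter> V" using NA by blast
    have "normal_in G (A \<inter> V) V"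
    proof (rule normal_in_if_commutators[OF s(1) V(1)])
      fix u v assume uv: "u \<in> V" "v \<in> A \<inter> V"
      then have "u \<otimes> v \<otimes> inv u \<otimes> inv v \<in> V" using V(1) by (simp add: subgroup.m_closed subgroup.m_inv_closed)
      moreover have "u \<otimes> v \<otimes> inv u \<otimes> inv v \<in> L" using comm uv V(2) by blast
      ultimately show "u \<otimes> v \<otimes> inv u \<otimes> inv v \<in> A \<inter> V" using LA by blast
    qed simp
    then show ?thesis unfolding modular_step_def AV V_def[symmetric] by blast
  qed
qed

lemma modular_steps_Int:
  assumes fin: "finite (carrier G)" and st: "(modular_step k G)^** A B" and U: "subgroup U G"
  shows "(modular_step k G)^** (A \<inter> U) (B \<inter> U)"
  using st by (rule rtranclp_map_step[where f = "\<lambda>X. X \<inter> U"]) (simp add: modular_step_Int fin U)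

section \<open>Submodularity and supersolubility as chains of steps\<close>

lemma Core_eq_core_in:
  assumes "subgroup H G"
  shows "Core G H = core_in H"
proof -
  have Hc: "H \<subseteq> carrier G" using assms by (rule subgroup.subset)
  have *: "x \<in> g <# H #> inv g \<longleftrightarrow> x \<in> carrier G \<and> inv g \<otimes> x \<otimes> g \<in> H" if g: "g \<in> carrier G" for g x
  proof
    assume "x \<in> g <# H #> inv g"
    then obtain h where h: "h \<in> H" "x = g \<otimes> h \<otimes> inv g" by (auto simp: l_coset_def r_coset_def)
    then show "x \<in> carrier G \<and> inv g \<otimes> x \<otimes> g \<in> H"
      using g Hc conj_inv_conj(1)[of g h] by (auto simp: subset_iff)
  next
    assume x: "x \<in> carrier G \<and> inv g \<otimes> x \<otimes> g \<in> H"
    then have "x = g \<otimes> (inv g \<otimes> x \<otimes> g) \<otimes> inv g" using g conj_inv_conj(2)[of g x] by simp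
    then show "x \<in> g <# H #> inv g" using x unfolding l_coset_def r_coset_def by blast
  qed
  have "Core G H = {x \<in> carrier G. \<forall>g\<in>carrier G. inv g \<otimes> x \<otimes> g \<in> H}"
    unfolding Core_def using * by blast
  also have "\<dots> = core_in H"
  proof -
    have "(\<forall>g\<in>carrier G. inv g \<otimes> x \<otimes> g \<in> H) \<longleftrightarrow> (\<forall>g\<in>carrier G. g \<otimes> x \<otimes> inv g \<in> H)" for x
      by (metis inv_closed inv_inv)
    then show ?thesis by (simp add: core_in_def)
  qed
  finally show ?thesis .
qed

lemma lower_central_subset: "lower_central G i \<subseteq> carrier G"
proof (induction i)
  case (Suc i)
  then show ?case by (auto intro!: generate_incl)
qed simp

text \<open>
  An element of the last term of the lower central series not contained in \<open>H\<close> normalises \<open>H\<close>, because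
  its commutators with \<open>H\<close> lie in the next term.
\<close>

lemma nilpotent_prime_index_normal:
  assumes nil: "nilpotent_group G" and fin: "finite (carrier G)" and p: "prime p"
    and H: "subgroup H G" "order G = p * card H"
  shows "H \<lhd> G"
proof -
  obtain c where "lower_central G c = {\<one>}" using nil by (auto simp: nilpotent_group_def)
  then have "lower_central G c \<subseteq> H" using H by (simp add: subgroup.one_closed)
  moreover define i where "i = (LEAST i. lower_central G i \<subseteq> H)"
  ultimately have i: "lower_central G i \<subseteq> H" by (metis LeastI)
  have "carrier G \<noteq> H"
    using H(2) subgroup_card_pos[OF fin H(1)] prime_gt_1_nat[OF p] by (auto simp: order_def)
  then have "\<not> lower_central G 0 \<subseteq> H" using subgroup.subset[OF H(1)] by auto
  then obtain j where j: "i = Suc j" using i by (cases i) auto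
  then have "\<not> lower_central G j \<subseteq> H" using not_less_Least[of j "\<lambda>i. lower_central G i \<subseteq> H"] by (simp add: i_def)
  then obtain x where x: "x \<in> lower_central G j" "x \<notin> H" by blast
  have xc: "x \<in> carrier G" using x lower_central_subset by blast
  have "x \<otimes> h \<otimes> inv x \<in> H" if h: "h \<in> H" for h
  proof -
    have hc: "h \<in> carrier G" using h H(1) by (simp add: subgroup.mem_carrier)
    have "x \<otimes> h \<otimes> inv x \<otimes> inv h \<in> lower_central G (Suc j)"
      using x(1) hc by (auto intro!: generate.incl)
    then have "x \<otimes> h \<otimes> inv x \<otimes> inv h \<in> H" using i j by blast
    then have "x \<otimes> h \<otimes> inv x \<otimes> inv h \<otimes> h \<in> H" using h H(1) by (simp add: subgroup.m_closed)
    then show ?thesis using xc hc by (simp add: m_assoc)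
  qed
  then have "x \<in> normaliser_of G H"
    using xc H(1) subgroup_finite[OF fin H(1)] by (intro normaliser_ofI) (auto simp: subgroup.subset)
  then show ?thesis using prime_index_normal_or_selfnormalizing[OF fin p H] x(2) by blast
qed

text \<open>
  From left to right take the core for \<open>N\<close>. Conversely, in a nilpotent quotient the image of \<open>H\<close> would be
  normal, as a subgroup of prime index.
\<close>

lemma modularly_embedded_iff_modular_step:
  assumes fin: "finite (carrier G)" and k: "1 \<le> k"
  shows "(\<exists>n. 1 \<le> n \<and> n \<le> k \<and> modularly_embedded n H G) \<longleftrightarrow> modular_step k G H (carrier G)"
proof
  assume "\<exists>n. 1 \<le> n \<and> n \<le> k \<and> modularly_embedded n H G"
  then obtain n where n: "n \<le> k" and H: "subgroup H G" and
    "H \<lhd> G \<or> (\<exists>p q::nat. prime p \<and> prime q \<and> order (G Mod Core G H) = p * q ^ n \<and> card (rcosets H) = p)"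
    by (auto simp: modularly_embedded_def)
  then consider "H \<lhd> G" | p q :: nat where "prime p" "prime q" "order (G Mod Core G H) = p * q ^ n" "card (rcosets H) = p"
    by blast
  then show "modular_step k G H (carrier G)"
  proof cases
    case 1 then show ?thesis by (simp add: modular_step_def normal_in_carrier_iff)
  next
    case 2
    let ?R = "core_in H"
    have Rn: "?R \<lhd> G" using H by (rule core_in_normal)
    interpret \<phi>: finite_epi G "G Mod ?R" "(#>) ?R" using Rn fin by (rule quotient_finite_epi)
    have "card (carrier G) = p * q ^ n * card ?R"
      using \<phi>.order_eq 2(3) Core_eq_core_in[OF H] kernel_quotient[OF Rn] by (simp add: order_def)
    moreover have "p * q ^ n * card ?R dvd p * q ^ k * card ?R"
      using n by (intro mult_dvd_mono le_imp_power_dvd) auto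
    moreover have "card (carrier G) = p * card H" using lagrange[OF H] 2(4) by (simp add: order_def)
    moreover have "normal_in G ?R (carrier G)" using Rn normal_in_carrier_iff by blast
    ultimately show ?thesis
      unfolding modular_step_def using H 2(1,2) core_in_subset[of H] subgroup_self subgroup.subset[OF H] by metis
  qed
next
  assume st: "modular_step k G H (carrier G)"
  show "\<exists>n. 1 \<le> n \<and> n \<le> k \<and> modularly_embedded n H G"
  proof (cases "normal_in G H (carrier G)")
    case True
    then show ?thesis using k normal_in_carrier_iff[of H] normal_imp_subgroup unfolding modularly_embedded_def by blast
  next
    case False
    then have nn: "\<not> H \<lhd> G" using normal_in_carrier_iff by blast
    obtain p q :: nat and N where H: "subgroup H G" and p: "prime p" and q: "prime q"
      and N: "normal_in G N (carrier G)" "N \<subseteq> H" and o: "card (carrier G) = p * card H"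
      and dv: "card (carrier G) dvd p * q ^ k * card N"
      using st False by (auto simp: modular_step_def)
    let ?R = "core_in H"
    have Rn: "?R \<lhd> G" using H by (rule core_in_normal)
    interpret \<phi>: finite_epi G "G Mod ?R" "(#>) ?R" using Rn fin by (rule quotient_finite_epi)
    let ?H = "((#>) ?R) ` H"
    have Hs: "subgroup ?H (G Mod ?R)" using H by (rule \<phi>.subgroup_img_is_subgroup)
    have "N \<lhd> G" using N(1) normal_in_carrier_iff by blast
    then obtain n where n: "n \<le> k" "card ?H = q ^ n" and oQ: "order (G Mod ?R) = p * q ^ n"
      and nn': "\<not> ?H \<lhd> G Mod ?R"
      using prime_index_core_quotient[OF fin H nn p q _ N(2)] o dv unfolding order_def by metis
    have o': "order (G Mod ?R) = p * card ?H" using oQ n by simp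
    have "n \<noteq> 0"
    proof
      assume "n = 0"
      then obtain X where "?H = {X}" using n(2) by (auto simp: card_1_singleton_iff)
      then have "?H = {\<one>\<^bsub>G Mod ?R\<^esub>}" using subgroup.one_closed[OF Hs] by simp
      then show False using \<phi>.H.one_is_normal nn' by simp
    qed
    moreover have "\<not> nilpotent_group (G Mod ?R)"
      using \<phi>.H.nilpotent_prime_index_normal[OF _ \<phi>.fin_H p Hs o'] nn' by blast
    moreover have "card (rcosets H) = p"
      using lagrange[OF H] o subgroup_card_pos[OF fin H] by (simp add: order_def)
    ultimately have "modularly_embedded n H G"
      unfolding modularly_embedded_def Core_eq_core_in[OF H] using H p q oQ by metis
    then show ?thesis using n(1) \<open>n \<noteq> 0\<close> by (intro exI[of _ n]) simp
  qed
qed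

lemma modularly_embedded_subgroup_iff:
  assumes fin: "finite (carrier G)" and k: "1 \<le> k" and B: "subgroup B G"
  shows "(\<exists>n. 1 \<le> n \<and> n \<le> k \<and> modularly_embedded n A (G\<restriction>B)) \<longleftrightarrow> modular_step k G A B"
proof -
  interpret B: group "G\<restriction>B" using B by (rule subgroup_group)
  have "finite (carrier (G\<restriction>B))" using subgroup_finite[OF fin B] by simp
  from B.modularly_embedded_iff_modular_step[OF this k, of A] show ?thesis
    using modular_step_restrict_iff[OF B order_refl, of k A] by simp
qed

lemma subgroup_chain_iff_rtranclp:
  "(\<exists>m C. subgroup_chain G H m C \<and> (\<forall>i<m. R (C i) (C (Suc i)))) \<longleftrightarrow>
   subgroup H G \<and> (\<lambda>A B. subgroup A G \<and> subgroup B G \<and> A \<subseteq> B \<and> R A B)^** H (carrier G)"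
  (is "?L \<longleftrightarrow> subgroup H G \<and> ?S^** H (carrier G)")
proof
  assume ?L
  then obtain m C where C: "subgroup_chain G H m C" "\<And>i. i < m \<Longrightarrow> R (C i) (C (Suc i))" by blast
  then have "(?S ^^ m) H (carrier G)"
    unfolding relpowp_fun_conv by (intro exI[of _ C]) (auto simp: subgroup_chain_def)
  then have "?S^** H (carrier G)" by (rule relpowp_imp_rtranclp)
  then show "subgroup H G \<and> ?S^** H (carrier G)" using C(1) by (auto simp: subgroup_chain_def)
next
  assume H: "subgroup H G \<and> ?S^** H (carrier G)"
  then obtain m where "(?S ^^ m) H (carrier G)" by (auto dest: rtranclp_imp_relpowp)
  then obtain C where C: "C 0 = H" "C m = carrier G" "\<And>i. i < m \<Longrightarrow> ?S (C i) (C (Suc i))"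
    unfolding relpowp_fun_conv by blast
  have "subgroup (C i) G" if "i \<le> m" for i
    using that C H by (cases "i = m") (auto simp: subgroup_self)
  then have "subgroup_chain G H m C" using C by (simp add: subgroup_chain_def)
  then show ?L using C(3) by blast
qed

lemma submodular_iff_modular_steps:
  assumes fin: "finite (carrier G)" and k: "1 \<le> k"
  shows "submodular k H G \<longleftrightarrow> subgroup H G \<and> (modular_step k G)^** H (carrier G)"
proof -
  have "(\<lambda>A B. subgroup A G \<and> subgroup B G \<and> A \<subseteq> B \<and>
      (\<exists>n. 1 \<le> n \<and> n \<le> k \<and> modularly_embedded n A (G\<restriction>B))) = modular_step k G"
    using modularly_embedded_subgroup_iff[OF fin k] modular_step_subgroup
    by (intro ext) blast
  then show ?thesis
    unfolding submodular_def
    using subgroup_chain_iff_rtranclp[of H "\<lambda>A B. \<exists>n. 1 \<le> n \<and> n \<le> k \<and> modularly_embedded n A (G\<restriction>B)"]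
    by simp
qed

lemma power_conj_minimal_normal:
  assumes fin: "finite (carrier G)" and N: "N \<lhd> G" "N \<noteq> {\<one>}"
    and pw: "\<And>x g. x \<in> N \<Longrightarrow> g \<in> carrier G \<Longrightarrow> \<exists>i::int. g \<otimes> x \<otimes> inv g = x [^] i"
  obtains P where "P \<lhd> G" "P \<subseteq> N" "prime (card P)"
proof -
  have Ns: "subgroup N G" using N(1) by (rule normal_imp_subgroup)
  interpret N: group "G\<restriction>N" using Ns by (rule subgroup_group)
  have "card N \<noteq> 1" using N(2) subgroup.one_closed[OF Ns] by (auto simp: card_1_singleton_iff)
  then obtain r where r: "prime r" "r dvd card N" using prime_factor_nat by blast
  then obtain m where m: "order (G\<restriction>N) = r ^ 1 * m" by (auto simp: order_def elim: dvdE)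
  obtain P where P: "subgroup P (G\<restriction>N)" "card P = r ^ 1"
    using sylow_thm[OF r(1) N.group_axioms m] subgroup_finite[OF fin Ns] by auto
  then have Ps: "subgroup P G" "P \<subseteq> N" using subgroup_restrict_iff[OF Ns] by auto
  have "P \<lhd> G"
    unfolding normal_inv_iff
  proof (intro conjI ballI Ps(1))
    fix g x assume "g \<in> carrier G" "x \<in> P"
    then show "g \<otimes> x \<otimes> inv g \<in> P"
      using pw[of x g] Ps subgroup_int_pow_closed[OF Ps(1)] by (metis subsetD)
  qed
  then show thesis using that Ps(2) P(2) r(1) by simp
qed

text \<open>
  If \<open>G\<close> acts on \<open>N / M\<close> by power maps, then every subgroup of \<open>N / M\<close> is normal in \<open>G / M\<close>; so a subgroup of
  prime order can be split off repeatedly. This covers cyclic \<open>N / M\<close> and central \<open>N / M\<close> alike.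
\<close>

lemma chief_refinement:
  assumes fin: "finite (carrier G)" and M: "M \<lhd> G" and N: "N \<lhd> G" and MN: "M \<subseteq> N"
    and pw: "\<And>x g. x \<in> N \<Longrightarrow> g \<in> carrier G \<Longrightarrow> \<exists>i::int. M #> (g \<otimes> x \<otimes> inv g) = M #> (x [^] i)"
  shows "(chief_step G)^** M N"
  using M MN pw
proof (induction "card N - card M" arbitrary: M rule: less_induct)
  case less
  note M = less.prems(1) and MN = less.prems(2) and pw = less.prems(3)
  show ?case
  proof (cases "M = N")
    case False
    have Ms: "subgroup M G" and Ns: "subgroup N G" using M N by (simp_all add: normal_imp_subgroup)
    interpret \<phi>: finite_epi G "G Mod M" "(#>) M" using M fin by (rule quotient_finite_epi)
    have ker: "kernel G (G Mod M) ((#>) M) = M" using M by (rule kernel_quotient)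
    let ?N = "((#>) M) ` N"
    have pre: "preimage G ((#>) M) ?N = N" using \<phi>.preimage_image[OF Ns] MN by (simp add: ker)
    have "?N \<noteq> {\<one>\<^bsub>G Mod M\<^esub>}"
      using pre \<phi>.preimage_one False by (metis ker)
    then obtain P where P: "P \<lhd> G Mod M" "P \<subseteq> ?N" "prime (card P)"
    proof (rule \<phi>.H.power_conj_minimal_normal[OF \<phi>.fin_H \<phi>.image_normal[OF N]])
      fix X Y assume "X \<in> ?N" "Y \<in> carrier (G Mod M)"
      then obtain x g where xg: "x \<in> N" "g \<in> carrier G" "X = M #> x" "Y = M #> g"
        by (auto simp: carrier_FactGroup)
      have xc: "x \<in> carrier G" using xg Ns by (simp add: subgroup.mem_carrier)
      obtain i :: int where i: "M #> (g \<otimes> x \<otimes> inv g) = M #> (x [^] i)" using pw[OF xg(1,2)] by blast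
      have "Y \<otimes>\<^bsub>G Mod M\<^esub> X \<otimes>\<^bsub>G Mod M\<^esub> inv\<^bsub>G Mod M\<^esub> Y = M #> (g \<otimes> x \<otimes> inv g)"
        using xg xc by (simp only: \<phi>.hom_mult \<phi>.hom_inv m_closed inv_closed)
      also have "\<dots> = X [^]\<^bsub>G Mod M\<^esub> i"
        using i xg xc normal.FactGroup_int_pow[OF M] by simp
      finally show "\<exists>i::int. Y \<otimes>\<^bsub>G Mod M\<^esub> X \<otimes>\<^bsub>G Mod M\<^esub> inv\<^bsub>G Mod M\<^esub> Y = X [^]\<^bsub>G Mod M\<^esub> i" ..
    qed blast
    define M' where "M' = preimage G ((#>) M) P"
    have M'n: "M' \<lhd> G" unfolding M'_def using P(1) by (rule \<phi>.preimage_normal)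
    have M's: "subgroup M' G" using M'n by (rule normal_imp_subgroup)
    have MM': "M \<subseteq> M'"
      using \<phi>.kernel_preimage[OF normal_imp_subgroup[OF P(1)]] unfolding ker M'_def .
    have M'N: "M' \<subseteq> N" using \<phi>.preimage_mono[OF P(2)] by (simp add: pre M'_def)
    have cM': "card M' = card P * card M"
      using \<phi>.card_preimage[OF normal_imp_subgroup[OF P(1)]] unfolding ker M'_def .
    then have st: "chief_step G M M'" using M M'n MM' P(3) by (auto simp: chief_step_def)
    have "card M > 0" using fin Ms by (rule subgroup_card_pos)
    then have "card M < card M'" using cM' prime_gt_1_nat[OF P(3)] by simp
    moreover have "card M' \<le> card N" using M'N subgroup_finite[OF fin Ns] by (simp add: card_mono)
    ultimately have "card N - card M' < card N - card M" by simp
    moreover have "\<exists>i::int. M' #> (g \<otimes> x \<otimes> inv g) = M' #> (x [^] i)" if xg: "x \<in> N" "g \<in> carrier G" for x g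
    proof -
      obtain i :: int where i: "M #> (g \<otimes> x \<otimes> inv g) = M #> (x [^] i)" using pw[OF xg] by blast
      have xc: "x \<in> carrier G" using xg Ns by (simp add: subgroup.mem_carrier)
      have "g \<otimes> x \<otimes> inv g \<in> M #> (x [^] i)" using i rcos_self[OF _ Ms, of "g \<otimes> x \<otimes> inv g"] xg xc by simp
      then have "g \<otimes> x \<otimes> inv g \<in> M' #> (x [^] i)" using MM' by (auto simp: r_coset_def)
      then have "M' #> (x [^] i) = M' #> (g \<otimes> x \<otimes> inv g)"
        using xc by (intro repr_independence[OF _ _ M's]) auto
      then show ?thesis by metis
    qed
    ultimately have "(chief_step G)^** M' N" using M'n M'N by (intro less.hyps)
    then show ?thesis using st by (rule converse_rtranclp_into_rtranclp[rotated])
  qed simp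
qed

lemma chief_refinement_cyclic:
  assumes fin: "finite (carrier G)" and M: "M \<lhd> G" and N: "N \<lhd> G" and MN: "M \<subseteq> N"
    and cyc: "cyclic_group (G\<restriction>N Mod M)"
  shows "(chief_step G)^** M N"
proof (rule chief_refinement[OF fin M N MN])
  have Ns: "subgroup N G" using N by (rule normal_imp_subgroup)
  have Ms: "subgroup M G" using M by (rule normal_imp_subgroup)
  interpret N: group "G\<restriction>N" using Ns by (rule subgroup_group)
  have "normal_in G M N" using M Ms Ns MN normal_in_subset[of M "carrier G" N] subgroup.subset[OF Ns]
    by (simp add: normal_in_carrier_iff)
  then have MnN: "M \<lhd> G\<restriction>N" using normal_in_iff[OF Ns] by blast
  interpret Q: group "G\<restriction>N Mod M" using MnN by (rule normal.factorgroup_is_group)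
  obtain X where X: "X \<in> carrier (G\<restriction>N Mod M)"
    "carrier (G\<restriction>N Mod M) = range (\<lambda>n::int. X [^]\<^bsub>G\<restriction>N Mod M\<^esub> n)"
    using cyc Q.cyclic_group by blast
  obtain c where c: "c \<in> N" "X = M #> c" using X(1) by (auto simp: carrier_FactGroup)
  have Nc: "x \<in> carrier G" if "x \<in> N" for x using that Ns by (rule subgroup.mem_carrier[rotated])
  have pow: "\<exists>j::int. M #> x = M #> (c [^] j)" if x: "x \<in> N" for x
  proof -
    have "M #> x \<in> carrier (G\<restriction>N Mod M)" using x by (auto simp: carrier_FactGroup)
    then obtain j :: int where "M #> x = X [^]\<^bsub>G\<restriction>N Mod M\<^esub> j" using X(2) by blast
    moreover have "X [^]\<^bsub>G\<restriction>N Mod M\<^esub> j = M #> (c [^] j)"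
      using normal.FactGroup_int_pow[OF MnN, of c j] c int_pow_consistent[OF Ns c(1), of j] by simp
    ultimately show ?thesis by metis
  qed
  interpret \<phi>: finite_epi G "G Mod M" "(#>) M" using M fin by (rule quotient_finite_epi)
  fix x g assume x: "x \<in> N" and g: "g \<in> carrier G"
  have cc: "c \<in> carrier G" using c Nc by blast
  obtain j :: int where j: "M #> x = M #> (c [^] j)" using pow[OF x] by blast
  have "g \<otimes> c \<otimes> inv g \<in> N" using N g c by (simp add: normal_inv_iff)
  then obtain a :: int where a: "M #> (g \<otimes> c \<otimes> inv g) = M #> (c [^] a)" using pow by blast
  interpret g: group_hom G G "\<lambda>x. g \<otimes> x \<otimes> inv g" using g by (rule conj_group_hom)
  let ?f = "(#>) M" and ?Q = "G Mod M"
  have "?f (g \<otimes> x \<otimes> inv g) = ?f g \<otimes>\<^bsub>?Q\<^esub> ?f x \<otimes>\<^bsub>?Q\<^esub> inv\<^bsub>?Q\<^esub> ?f g"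
    using g Nc[OF x] by (simp only: \<phi>.hom_mult \<phi>.hom_inv m_closed inv_closed)
  also have "\<dots> = ?f (g \<otimes> (c [^] j) \<otimes> inv g)"
    using g cc by (simp only: j \<phi>.hom_mult \<phi>.hom_inv m_closed inv_closed int_pow_closed)
  also have "\<dots> = ?f ((g \<otimes> c \<otimes> inv g) [^] j)" using g.hom_int_pow[OF cc, of j] by simp
  also have "\<dots> = ?f (g \<otimes> c \<otimes> inv g) [^]\<^bsub>?Q\<^esub> j" using \<phi>.hom_int_pow g cc by (metis m_closed inv_closed)
  also have "\<dots> = ?f ((c [^] a) [^] j)" unfolding a using \<phi>.hom_int_pow[of "c [^] a" j] cc by simp
  also have "\<dots> = ?f ((c [^] j) [^] a)" using cc by (simp add: int_pow_pow mult.commute)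
  also have "\<dots> = ?f (c [^] j) [^]\<^bsub>?Q\<^esub> a" using \<phi>.hom_int_pow[of "c [^] j" a] cc by simp
  also have "\<dots> = ?f (x [^] a)" unfolding j[symmetric] using \<phi>.hom_int_pow[of x a] Nc[OF x] by simp
  finally show "\<exists>i::int. M #> (g \<otimes> x \<otimes> inv g) = M #> (x [^] i)" by blast
qed

lemma prime_order_cyclic:
  assumes "prime (order G)"
  shows "cyclic_group G"
proof -
  have fin: "finite (carrier G)" using prime_gt_0_nat[OF assms] order_gt_0_iff_finite by simp
  have "carrier G \<noteq> {\<one>}" using assms by (auto simp: order_def)
  then obtain x where x: "x \<in> carrier G" "x \<noteq> \<one>" using one_closed by blast
  have "carrier G \<subseteq> range (\<lambda>n::int. x [^] n)"
  proof
    fix y assume "y \<in> carrier G"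
    then obtain i :: nat where "y = x [^] i"
      using prime_order_subgroup_powers[OF fin subgroup_self] assms x by (auto simp: order_def)
    then have "y = x [^] int i" by (simp add: int_pow_int)
    then show "y \<in> range (\<lambda>n::int. x [^] n)" by blast
  qed
  moreover have "range (\<lambda>n::int. x [^] n) \<subseteq> carrier G" using x(1) by auto
  ultimately show ?thesis unfolding cyclic_group using x(1) by blast
qed

text \<open>
  Cyclic factors refine to factors of prime order, and groups of prime order are cyclic.
\<close>

lemma supersoluble_iff_chief_steps:
  assumes fin: "finite (carrier G)"
  shows "supersoluble G \<longleftrightarrow> (chief_step G)^** {\<one>} (carrier G)"
proof
  assume "supersoluble G"
  then obtain m C where C: "subgroup_chain G {\<one>} m C" "\<And>i. i \<le> m \<Longrightarrow> C i \<lhd> G"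
    "\<And>i. i < m \<Longrightarrow> cyclic_group ((G\<lparr>carrier := C (Suc i)\<rparr>) Mod C i)"
    unfolding supersoluble_def by blast
  have "(chief_step G)^** (C 0) (C i)" if "i \<le> m" for i
    using that
  proof (induction i)
    case (Suc i)
    have "(chief_step G)^** (C i) (C (Suc i))"
      using Suc.prems C by (intro chief_refinement_cyclic[OF fin]) (auto simp: subgroup_chain_def)
    then show ?case using Suc by simp
  qed simp
  from this[of m] show "(chief_step G)^** {\<one>} (carrier G)"
    using C(1) by (simp add: subgroup_chain_def)
next
  assume "(chief_step G)^** {\<one>} (carrier G)"
  then obtain m where "(chief_step G ^^ m) {\<one>} (carrier G)" by (auto dest: rtranclp_imp_relpowp)
  then obtain C where C: "C 0 = {\<one>}" "C m = carrier G" "\<And>i. i < m \<Longrightarrow> chief_step G (C i) (C (Suc i))"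
    unfolding relpowp_fun_conv by blast
  have n: "C i \<lhd> G" if "i \<le> m" for i
    using that C(3)[of i] C(2) normal_self by (cases "i = m") (auto simp: chief_step_def)
  have "subgroup_chain G {\<one>} m C"
    unfolding subgroup_chain_def using C n by (auto simp: normal_imp_subgroup chief_step_def)
  moreover have "cyclic_group ((G\<lparr>carrier := C (Suc i)\<rparr>) Mod C i)" if i: "i < m" for i
  proof -
    obtain r :: nat where r: "prime r" "card (C (Suc i)) = r * card (C i)" "C i \<subseteq> C (Suc i)"
      using C(3)[OF i] by (auto simp: chief_step_def)
    have s: "subgroup (C (Suc i)) G" "subgroup (C i) G" using n i by (simp_all add: normal_imp_subgroup)
    interpret N: group "G\<lparr>carrier := C (Suc i)\<rparr>" using s(1) by (rule subgroup_group)
    have "normal_in G (C i) (C (Suc i))"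
      using n[of i] i s r(3) normal_in_subset[of "C i" "carrier G" "C (Suc i)"] subgroup.subset[OF s(1)]
      by (simp add: normal_in_carrier_iff)
    then have nn: "C i \<lhd> G\<lparr>carrier := C (Suc i)\<rparr>" using normal_in_iff[OF s(1)] by blast
    have finN: "finite (carrier (G\<lparr>carrier := C (Suc i)\<rparr>))" using subgroup_finite[OF fin s(1)] by simp
    interpret \<phi>: finite_epi "G\<lparr>carrier := C (Suc i)\<rparr>" "G\<lparr>carrier := C (Suc i)\<rparr> Mod C i"
      "\<lambda>x. C i #>\<^bsub>G\<lparr>carrier := C (Suc i)\<rparr>\<^esub> x"
      using nn finN by (rule N.quotient_finite_epi)
    have oC: "order (G\<lparr>carrier := C (Suc i)\<rparr>) = r * card (C i)" using r by (simp add: order_def)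
    have "r * card (C i) = order (G\<lparr>carrier := C (Suc i)\<rparr> Mod C i) * card (C i)"
      using \<phi>.order_eq unfolding N.kernel_quotient[OF nn] oC .
    then have "order (G\<lparr>carrier := C (Suc i)\<rparr> Mod C i) = r" using subgroup_card_pos[OF fin s(2)] by simp
    then show ?thesis using r(1) by (intro \<phi>.H.prime_order_cyclic) simp
  qed
  ultimately show "supersoluble G" unfolding supersoluble_def using n group_axioms by blast
qed

end

section \<open>Sylow subgroups of supersoluble groups\<close>

text \<open>
  The prime is made explicit because the trivial subgroup is a Sylow subgroup for many primes.
\<close>

definition sylow_for :: "nat \<Rightarrow> 'a set \<Rightarrow> ('a, 'b) monoid_scheme \<Rightarrow> bool" where
  "sylow_for p P G \<longleftrightarrow> prime p \<and> subgroup P G \<and> card P = p ^ multiplicity p (order G)"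

lemma sylow_subgroup_iff: "sylow_subgroup P G \<longleftrightarrow> (\<exists>p. sylow_for p P G)"
  by (auto simp: sylow_subgroup_def sylow_for_def)

lemma prime_power_dvd_imp_le_multiplicity:
  fixes p n :: nat
  assumes "prime p" "p ^ a dvd n" "n > 0"
  shows "p ^ a dvd p ^ multiplicity p n"
proof -
  have "a \<le> multiplicity p n"
    using assms by (intro multiplicity_geI) auto
  then show ?thesis by (rule le_imp_power_dvd)
qed

context group begin

lemma sylow_exists:
  assumes fin: "finite (carrier G)" and p: "prime p"
  shows "\<exists>P. sylow_for p P G"
proof -
  have "p ^ multiplicity p (order G) dvd order G" by (rule multiplicity_dvd)
  then obtain m where "order G = p ^ multiplicity p (order G) * m" by (auto elim: dvdE)
  then show ?thesis using sylow_thm[OF p group_axioms _ fin] p by (auto simp: sylow_for_def)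
qed

lemma p_subgroup_card_dvd_sylow:
  assumes fin: "finite (carrier G)" and P: "sylow_for p P G" and S: "subgroup S G" "card S = p ^ a"
  shows "card S dvd card P"
proof -
  have "p ^ a dvd order G"
    using subgroup_card_dvd[OF S(1) subgroup_self subgroup.subset[OF S(1)]] S(2) by (simp add: order_def)
  then show ?thesis
    using P S fin order_gt_0_iff_finite by (simp add: sylow_for_def prime_power_dvd_imp_le_multiplicity)
qed

lemma p_subgroup_in_sylow:
  assumes fin: "finite (carrier G)" and p: "prime p" and S: "subgroup S G" "card S = p ^ a"
  shows "\<exists>P. sylow_for p P G \<and> S \<subseteq> P"
proof -
  obtain P where P: "sylow_for p P G" using sylow_exists[OF fin p] by blast
  then have Ps: "subgroup P G" and cP: "card P = p ^ multiplicity p (order G)" by (auto simp: sylow_for_def)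
  have o: "order G > 0" using fin order_gt_0_iff_finite by simp
  have "\<not> p dvd card (rcosets P)"
  proof
    assume "p dvd card (rcosets P)"
    then have "p * p ^ multiplicity p (order G) dvd order G"
      using lagrange[OF Ps] cP by (metis mult_dvd_mono dvd_refl)
    then have "p ^ Suc (multiplicity p (order G)) dvd order G" by simp
    then show False using o p not_dvd_imp_multiplicity_0 power_dvd_iff_le_multiplicity
      by (metis Suc_n_not_le_n gr_implies_not0 not_prime_unit)
  qed
  then obtain g where g: "g \<in> carrier G" "\<forall>s\<in>S. g \<otimes> s \<otimes> inv g \<in> P"
    using q_subgroup_conjugate_into[OF p S Ps _ fin] by blast
  have "S \<subseteq> conj_sub G P g" using g S(1) by (auto simp: conj_sub_def subgroup.mem_carrier)
  moreover have "sylow_for p (conj_sub G P g) G"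
    using conj_sub_subgroup[OF Ps g(1)] conj_sub_card[OF subgroup.subset[OF Ps] g(1)] cP p
    by (simp add: sylow_for_def)
  ultimately show ?thesis by blast
qed

lemma sylow_restrict:
  assumes fin: "finite (carrier G)" and P: "sylow_for p P G" and B: "subgroup B G" "P \<subseteq> B"
  shows "sylow_for p P (G\<restriction>B)"
proof -
  have Ps: "subgroup P G" and p: "prime p" and cP: "card P = p ^ multiplicity p (order G)"
    using P by (auto simp: sylow_for_def)
  have "card P dvd card B" using subgroup_card_dvd[OF Ps B] .
  then have "multiplicity p (order G) \<le> multiplicity p (card B)"
    using cP subgroup_card_pos[OF fin B(1)] p by (intro multiplicity_geI) auto
  moreover have "multiplicity p (card B) \<le> multiplicity p (order G)"
    using subgroup_card_dvd[OF B(1) subgroup_self subgroup.subset[OF B(1)]] fin order_gt_0_iff_finite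
    by (intro dvd_imp_multiplicity_le) (auto simp: order_def)
  ultimately show ?thesis
    using cP p Ps B by (simp add: sylow_for_def order_def subgroup_incl)
qed

lemma sylow_of_subgroup:
  assumes fin: "finite (carrier G)" and B: "subgroup B G" and S: "sylow_for p S (G\<restriction>B)"
  shows "\<exists>P. sylow_for p P G \<and> S = P \<inter> B"
proof -
  interpret B: group "G\<restriction>B" using B by (rule subgroup_group)
  have p: "prime p" and Ss: "subgroup S G" "S \<subseteq> B" and cS: "card S = p ^ multiplicity p (card B)"
    using S subgroup_restrict_iff[OF B] by (auto simp: sylow_for_def order_def)
  obtain P where P: "sylow_for p P G" "S \<subseteq> P"
    using p_subgroup_in_sylow[OF fin p Ss(1) cS] by blast
  have Ps: "subgroup P G" and cP: "card P = p ^ multiplicity p (order G)" using P by (auto simp: sylow_for_def)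
  have s: "subgroup (P \<inter> B) G" using Ps B by (rule subgroups_Inter_pair)
  have "card (P \<inter> B) dvd p ^ multiplicity p (order G)" using subgroup_card_dvd[OF s Ps] cP by simp
  then obtain a where a: "card (P \<inter> B) = p ^ a" using p by (auto simp: divides_primepow_nat)
  have "finite (carrier (G\<restriction>B))" using subgroup_finite[OF fin B] by simp
  then have "card (P \<inter> B) dvd card S"
    using B.p_subgroup_card_dvd_sylow[OF _ S _ a] s B by (simp add: subgroup_incl)
  then have "card (P \<inter> B) \<le> card S" using subgroup_card_pos[OF fin Ss(1)] by (rule dvd_imp_le)
  then have "S = P \<inter> B"
    using P(2) Ss(2) subgroup_finite[OF fin s] by (intro card_seteq) auto
  then show ?thesis using P(1) by blast
qed

end

context finite_epi begin

text \<open>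
  The image and the part inside the kernel are \<open>p\<close>-groups whose orders are bounded by the \<open>p\<close>-parts of
  \<open>order H\<close> and of the kernel; the product of the bounds is attained.
\<close>

lemma sylow_image:
  assumes P: "sylow_for p P G"
  shows "sylow_for p (h ` P) H"
proof -
  have p: "prime p" and Ps: "subgroup P G" and cP: "card P = p ^ multiplicity p (order G)"
    using P by (auto simp: sylow_for_def)
  let ?K = "kernel G H h"
  have Ks: "subgroup ?K G" by (rule subgroup_kernel)
  have K0: "card ?K > 0" using fin Ks by (rule G.subgroup_card_pos)
  have H0: "order H > 0" using fin_H H.order_gt_0_iff_finite by simp
  have hs: "subgroup (h ` P) H" using Ps by (rule subgroup_img_is_subgroup)
  have ci: "card (h ` P) * card (P \<inter> ?K) = card P" using card_image[OF Ps fin] .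
  obtain a where a: "card (h ` P) = p ^ a"
    using ci cP p by (metis divides_primepow_nat dvd_triv_left)
  obtain b where b: "card (P \<inter> ?K) = p ^ b"
    using ci cP p by (metis divides_primepow_nat dvd_triv_right)
  have PK: "subgroup (P \<inter> ?K) G" using Ps Ks by (rule G.subgroups_Inter_pair)
  have "p ^ b dvd card ?K" using G.subgroup_card_dvd[OF PK Ks] b by simp
  then have "b \<le> multiplicity p (card ?K)" using K0 p by (intro multiplicity_geI) auto
  moreover have "p ^ a dvd order H"
    using H.subgroup_card_dvd[OF hs H.subgroup_self subgroup.subset[OF hs]] a by (simp add: order_def)
  then have "a \<le> multiplicity p (order H)" using H0 p by (intro multiplicity_geI) auto
  moreover have "multiplicity p (order G) = multiplicity p (order H) + multiplicity p (card ?K)"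
    unfolding order_eq using H0 K0 p by (intro prime_elem_multiplicity_mult_distrib) auto
  moreover have "p ^ (a + b) = p ^ multiplicity p (order G)"
    using ci cP a b by (simp add: power_add)
  then have "a + b = multiplicity p (order G)" using prime_gt_1_nat[OF p] by simp
  ultimately have "a = multiplicity p (order H)" by linarith
  then show ?thesis using p hs a by (simp add: sylow_for_def)
qed

text \<open>
  A Sylow subgroup of the full inverse image of \<open>S\<close> has full \<open>p\<close>-part in \<open>G\<close> and maps onto \<open>S\<close>.
\<close>

lemma sylow_lift:
  assumes S: "sylow_for p S H"
  shows "\<exists>P. sylow_for p P G \<and> h ` P = S"
proof -
  have p: "prime p" and Ss: "subgroup S H" and cS: "card S = p ^ multiplicity p (order H)"
    using S by (auto simp: sylow_for_def)
  let ?B = "preimage G h S" and ?K = "kernel G H h"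
  have Bs: "subgroup ?B G" using Ss by (rule subgroup_preimage)
  have K0: "card ?K > 0" using fin subgroup_kernel by (rule G.subgroup_card_pos)
  have H0: "order H > 0" using fin_H H.order_gt_0_iff_finite by simp
  interpret B: group "G\<restriction>?B" using Bs by (rule G.subgroup_group)
  have "finite (carrier (G\<restriction>?B))" using G.subgroup_finite[OF fin Bs] by simp
  then obtain P where P: "sylow_for p P (G\<restriction>?B)" using B.sylow_exists p by blast
  have Ps: "subgroup P G" "P \<subseteq> ?B" using P G.subgroup_restrict_iff[OF Bs] by (auto simp: sylow_for_def)
  have "multiplicity p (card ?B) = multiplicity p (order H) + multiplicity p (card ?K)"
    unfolding card_preimage[OF Ss] cS using p K0 by (simp add: prime_elem_multiplicity_mult_distrib prime_gt_0_nat)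
  also have "\<dots> = multiplicity p (order G)"
    unfolding order_eq using H0 K0 p by (subst prime_elem_multiplicity_mult_distrib) auto
  finally have "sylow_for p P G" using P Ps p by (simp add: sylow_for_def order_def)
  moreover have "h ` P = S"
  proof (rule card_subset_eq)
    show "finite S" using fin_H Ss by (rule H.subgroup_finite)
    show "h ` P \<subseteq> S" using Ps(2) by (auto simp: preimage_def)
    show "card (h ` P) = card S" using sylow_image[OF \<open>sylow_for p P G\<close>] cS by (simp add: sylow_for_def)
  qed
  ultimately show ?thesis by blast
qed

end

text \<open>
  The product \<open>N A\<close>, for normal \<open>N\<close> the full inverse image of the image of \<open>A\<close> in \<open>G / N\<close>.
\<close>

definition join_normal :: "('a, 'b) monoid_scheme \<Rightarrow> 'a set \<Rightarrow> 'a set \<Rightarrow> 'a set" where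
  "join_normal G N A = {x \<in> carrier G. \<exists>a\<in>A. x \<otimes>\<^bsub>G\<^esub> inv\<^bsub>G\<^esub> a \<in> N}"

context group begin

lemma join_normal_eq_preimage:
  assumes N: "N \<lhd> G" and A: "A \<subseteq> carrier G"
  shows "join_normal G N A = preimage G ((#>) N) (((#>) N) ` A)"
proof -
  have Ns: "subgroup N G" using N by (rule normal_imp_subgroup)
  have "x \<otimes> inv a \<in> N \<longleftrightarrow> N #> x = N #> a" if "x \<in> carrier G" "a \<in> A" for x a
  proof -
    have a: "a \<in> carrier G" using that A by blast
    have "x \<otimes> inv a \<in> N \<longleftrightarrow> x \<in> N #> a"
      using subgroup.rcos_module[OF Ns group_axioms a that(1)] by simp
    also have "\<dots> \<longleftrightarrow> N #> x = N #> a"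
      using repr_independence[OF _ a Ns] rcos_self[OF that(1) Ns] by metis
    finally show ?thesis .
  qed
  then show ?thesis by (auto simp: join_normal_def preimage_def)
qed

lemma join_normal_subgroup:
  assumes fin: "finite (carrier G)" and N: "N \<lhd> G" and A: "subgroup A G"
  shows "subgroup (join_normal G N A) G" "A \<subseteq> join_normal G N A" "N \<subseteq> join_normal G N A"
proof -
  interpret \<phi>: finite_epi G "G Mod N" "(#>) N" using N fin by (rule quotient_finite_epi)
  show "subgroup (join_normal G N A) G"
    unfolding join_normal_eq_preimage[OF N subgroup.subset[OF A]]
    using A by (intro \<phi>.subgroup_preimage \<phi>.subgroup_img_is_subgroup)
  have Ns: "subgroup N G" using N by (rule normal_imp_subgroup)
  show "A \<subseteq> join_normal G N A"
  proof
    fix x assume x: "x \<in> A"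
    have xc: "x \<in> carrier G" using x A by (simp add: subgroup.mem_carrier)
    then have "x \<otimes> inv x \<in> N" using Ns by (simp add: subgroup.one_closed)
    then show "x \<in> join_normal G N A" using x xc unfolding join_normal_def by blast
  qed
  show "N \<subseteq> join_normal G N A"
  proof
    fix x assume x: "x \<in> N"
    have xc: "x \<in> carrier G" using x Ns by (simp add: subgroup.mem_carrier)
    then have "x \<otimes> inv \<one> \<in> N" using x by simp
    then show "x \<in> join_normal G N A" using xc subgroup.one_closed[OF A] unfolding join_normal_def by blast
  qed
qed

lemma join_normal_subset:
  assumes "subgroup U G" "N \<subseteq> U" "A \<subseteq> U"
  shows "join_normal G N A \<subseteq> U"
proof
  fix x assume "x \<in> join_normal G N A"
  then obtain a where a: "x \<in> carrier G" "a \<in> A" "x \<otimes> inv a \<in> N" by (auto simp: join_normal_def)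
  then have "x \<otimes> inv a \<otimes> a \<in> U" using assms by (meson subgroup.m_closed subsetD)
  moreover have "a \<in> carrier G" using a assms subgroup.mem_carrier by (metis subsetD)
  ultimately show "x \<in> U" using a by (simp add: m_assoc)
qed

lemma join_normal_one:
  assumes A: "A \<subseteq> carrier G" shows "join_normal G {\<one>} A = A"
proof
  show "join_normal G {\<one>} A \<subseteq> A"
  proof
    fix x assume "x \<in> join_normal G {\<one>} A"
    then obtain a where a: "x \<in> carrier G" "a \<in> A" "x \<otimes> inv a = \<one>" by (auto simp: join_normal_def)
    then have "x = a" using A by (metis inv_closed inv_equality inv_inv subsetD)
    then show "x \<in> A" using a by simp
  qed
  show "A \<subseteq> join_normal G {\<one>} A" using A by (auto simp: join_normal_def intro!: bexI)
qed

lemma join_normal_carrier: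
  assumes A: "subgroup A G" shows "join_normal G (carrier G) A = carrier G"
  using A by (auto simp: join_normal_def subgroup.one_closed intro!: bexI[of _ \<one>])

lemma card_join_normal:
  assumes fin: "finite (carrier G)" and N: "N \<lhd> G" and A: "subgroup A G"
  shows "card (join_normal G N A) * card (A \<inter> N) = card N * card A"
proof -
  interpret \<phi>: finite_epi G "G Mod N" "(#>) N" using N fin by (rule quotient_finite_epi)
  have "card (join_normal G N A) = card (((#>) N) ` A) * card N"
    unfolding join_normal_eq_preimage[OF N subgroup.subset[OF A]]
    using \<phi>.card_preimage[OF \<phi>.subgroup_img_is_subgroup[OF A]] unfolding kernel_quotient[OF N] .
  moreover have "card (((#>) N) ` A) * card (A \<inter> N) = card A"
    using \<phi>.card_image[OF A fin] unfolding kernel_quotient[OF N] .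
  ultimately show ?thesis by (metis mult.assoc mult.commute)
qed

lemma conj_pow_exponent:
  assumes x: "x \<in> carrier G" and a: "a \<in> carrier G" and t: "a \<otimes> x \<otimes> inv a = x [^] (t::nat)"
  shows "a [^] (i::nat) \<otimes> x \<otimes> inv (a [^] i) = x [^] (t ^ i)"
proof (induction i)
  case (Suc i)
  have "a [^] Suc i \<otimes> x \<otimes> inv (a [^] Suc i) = a [^] i \<otimes> (a \<otimes> x \<otimes> inv a) \<otimes> inv (a [^] i)"
    using conj_conj[of "a [^] i" a x] x a by simp
  also have "\<dots> = (a [^] i \<otimes> x \<otimes> inv (a [^] i)) [^] t"
    unfolding t using conj_pow[of "a [^] i" x t] x a by simp
  also have "\<dots> = x [^] (t ^ Suc i)"
    unfolding Suc.IH using x by (simp add: nat_pow_pow mult.commute)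
  finally show ?case .
qed (use x in simp)

text \<open>
  An element \<open>a\<close> of \<open>Q\<close> acts on \<open>L\<close> as \<open>x \<mapsto> x\<^sup>t\<close>, where \<open>t\<close> modulo \<open>p\<close> determines \<open>a\<close> up to the
  centraliser and satisfies \<open>t ^ (q ^ k) = 1\<close> modulo \<open>p\<close>. A polynomial of degree \<open>q ^ k\<close> over the field with
  \<open>p\<close> elements has at most \<open>q ^ k\<close> roots. Here the restriction on the exponent becomes a restriction on the order.
\<close>

lemma q_subgroup_acting_on_prime_order:
  assumes fin: "finite (carrier G)" and L: "L \<lhd> G" "prime (card L)" and q: "prime q"
    and Q: "subgroup Q G" "card Q = q ^ m" and ex: "\<And>x. x \<in> Q \<Longrightarrow> x [^] (q ^ k) = \<one>"
  shows "card Q dvd q ^ k * card (Q \<inter> centraliser L)"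
proof -
  define p where "p = card L"
  have p: "prime p" using L by (simp add: p_def)
  have Ls: "subgroup L G" using L(1) by (rule normal_imp_subgroup)
  have Zs: "subgroup (centraliser L) G" using centraliser_normal[OF L(1)] by (rule normal_imp_subgroup)
  have Qc: "a \<in> carrier G" if "a \<in> Q" for a using that Q(1) by (rule subgroup.mem_carrier[rotated])
  define N where "N = Q \<inter> centraliser L"
  have Ns: "subgroup N G" unfolding N_def using Q(1) Zs by (rule subgroups_Inter_pair)
  have "L \<noteq> {\<one>}" using L(2) by auto
  then obtain x where x: "x \<in> L" "x \<noteq> \<one>" using subgroup.one_closed[OF Ls] by blast
  have xc: "x \<in> carrier G" using x Ls by (simp add: subgroup.mem_carrier)
  have pw: "\<exists>i::nat. y = x [^] i" if "y \<in> L" for y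
    using prime_order_subgroup_powers[OF fin Ls L(2) x that] .
  interpret Lg: group "G\<restriction>L" using Ls by (rule subgroup_group)
  have xp: "x [^] p = \<one>"
    using Lg.pow_order_eq_1[of x] x(1) by (simp add: order_def p_def nat_pow_consistent[symmetric])
  then have "ord x dvd p" using xc by (simp add: pow_eq_id)
  moreover have "ord x \<noteq> 1" using ord_eq_1[OF xc] x(2) by blast
  ultimately have ordx: "ord x = p" using p by (auto simp: prime_nat_iff)
  \<comment> \<open>The inverse is placed so that \<open>f\<close> separates right cosets of \<open>N\<close>.\<close>
  define f where "f = (\<lambda>a. inv a \<otimes> x \<otimes> a)"
  have "card ((\<lambda>g. N #> g) ` Q) = card (f ` Q)"
  proof (rule card_image_eq_if_same_fibres)
    fix a b assume ab: "a \<in> Q" "b \<in> Q"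
    have abc: "a \<in> carrier G" "b \<in> carrier G" using ab Qc by auto
    let ?c = "a \<otimes> inv b"
    have c: "?c \<in> Q" "?c \<in> carrier G" using ab Q(1) abc by (auto simp: subgroup.m_closed subgroup.m_inv_closed)
    have "N #> a = N #> b \<longleftrightarrow> a \<in> N #> b"
      using repr_independence[OF _ abc(2) Ns] rcos_self[OF abc(1) Ns] by metis
    also have "\<dots> \<longleftrightarrow> ?c \<in> N" using subgroup.rcos_module[OF Ns group_axioms abc(2,1)] by simp
    also have "\<dots> \<longleftrightarrow> ?c \<otimes> x \<otimes> inv ?c = x"
    proof
      assume "?c \<in> N" then show "?c \<otimes> x \<otimes> inv ?c = x" using x(1) by (simp add: N_def centraliser_def)
    next
      assume cx: "?c \<otimes> x \<otimes> inv ?c = x"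
      have "?c \<otimes> y \<otimes> inv ?c = y" if y: "y \<in> L" for y
      proof -
        obtain i :: nat where "y = x [^] i" using pw[OF y] by blast
        then show ?thesis using conj_pow[OF c(2) xc, of i] cx by simp
      qed
      then show "?c \<in> N" using c by (simp add: N_def centraliser_def)
    qed
    also have "\<dots> \<longleftrightarrow> f a = f b"
    proof -
      have "?c \<otimes> x \<otimes> inv ?c = a \<otimes> f b \<otimes> inv a"
        using abc xc by (simp add: f_def inv_mult_group m_assoc)
      moreover have "x = a \<otimes> f a \<otimes> inv a" using abc xc by (simp add: f_def conj_inv_conj)
      moreover have "f a \<in> carrier G" "f b \<in> carrier G" using abc xc by (auto simp: f_def)
      then have "a \<otimes> f b \<otimes> inv a = a \<otimes> f a \<otimes> inv a \<longleftrightarrow> f b = f a" using abc by simp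
      ultimately show ?thesis by metis
    qed
    finally show "N #> a = N #> b \<longleftrightarrow> f a = f b" .
  qed
  moreover have "card (f ` Q) \<le> q ^ k"
  proof -
    let ?T = "{t\<in>{..<p}. [t ^ (q ^ k) = 1] (mod p)}"
    have "f ` Q \<subseteq> (\<lambda>t. x [^] t) ` ?T"
    proof
      fix y assume "y \<in> f ` Q"
      then obtain a where a: "a \<in> Q" "y = f a" by blast
      define b where "b = inv a"
      have b: "b \<in> Q" "b \<in> carrier G" using a Q(1) Qc by (auto simp: b_def subgroup.m_inv_closed)
      have y: "y = b \<otimes> x \<otimes> inv b" using a Qc by (simp add: f_def b_def)
      then have "y \<in> L" using L(1) b x by (simp add: normal_inv_iff)
      then obtain s :: nat where s: "y = x [^] s" using pw by blast
      define t where "t = s mod p"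
      have "x [^] s = x [^] (p * (s div p) + t)" by (simp add: t_def)
      also have "\<dots> = (x [^] p) [^] (s div p) \<otimes> x [^] t"
        using xc by (simp add: nat_pow_mult nat_pow_pow)
      also have "\<dots> = x [^] t" using xc by (simp add: xp)
      finally have yt: "y = x [^] t" using s by simp
      have "b [^] (q ^ k) \<otimes> x \<otimes> inv (b [^] (q ^ k)) = x [^] (t ^ (q ^ k))"
        using conj_pow_exponent[OF xc b(2)] y yt by simp
      then have "x [^] (t ^ (q ^ k)) = x [^] (1::nat)" using ex[OF b(1)] xc by simp
      then have "x [^] int (t ^ (q ^ k)) = x [^] int 1" by (simp only: int_pow_int)
      then have "int p dvd int 1 - int (t ^ (q ^ k))" using int_pow_eq[OF xc] ordx by blast
      then have "[int (t ^ (q ^ k)) = int 1] (mod int p)"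
        by (simp only: cong_iff_dvd_diff dvd_diff_commute)
      then have "[t ^ (q ^ k) = 1] (mod p)" by (simp only: cong_int_iff)
      moreover have "t < p" using p by (simp add: t_def prime_gt_0_nat)
      ultimately show "y \<in> (\<lambda>t. x [^] t) ` ?T" using yt by blast
    qed
    then have "card (f ` Q) \<le> card ?T" by (rule surj_card_le[rotated]) simp
    also have "\<dots> \<le> q ^ k" using p q by (intro roots_mod_prime_bound) (auto simp: prime_gt_0_nat)
    finally show ?thesis .
  qed
  ultimately have le: "card ((\<lambda>g. N #> g) ` Q) \<le> q ^ k" by simp
  have cQ: "card ((\<lambda>g. N #> g) ` Q) * card N = card Q"
    using card_cosets_meeting[OF Ns Q(1) fin] by (simp add: N_def Int_absorb1)
  then obtain j where j: "card ((\<lambda>g. N #> g) ` Q) = q ^ j"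
    using Q(2) q by (metis divides_primepow_nat dvd_triv_left)
  have "j \<le> k" using le j prime_gt_1_nat[OF q] by simp
  then have "q ^ j dvd q ^ k" by (rule le_imp_power_dvd)
  then have "q ^ j * card N dvd q ^ k * card N" by (rule mult_dvd_mono) simp
  then have "card Q dvd q ^ k * card N" unfolding cQ[unfolded j] .
  then show ?thesis unfolding N_def .
qed

text \<open>
  The part of \<open>Q\<close> centralising \<open>L\<close> is normal in \<open>L Q\<close> and serves as the subgroup \<open>N\<close> of the modular step.
\<close>

lemma modular_step_join_prime_order:
  assumes fin: "finite (carrier G)" and L: "L \<lhd> G" "prime (card L)" and q: "prime q"
    and Q: "subgroup Q G" "card Q = q ^ m" and ex: "\<And>x. x \<in> Q \<Longrightarrow> x [^] (q ^ k) = \<one>"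
  shows "modular_step k G Q (join_normal G L Q)"
proof -
  let ?B = "join_normal G L Q" and ?N = "Q \<inter> centraliser L"
  have Ls: "subgroup L G" using L(1) by (rule normal_imp_subgroup)
  have Bs: "subgroup ?B G" "Q \<subseteq> ?B" using join_normal_subgroup[OF fin L(1) Q(1)] by auto
  have s: "subgroup (Q \<inter> L) G" using Q(1) Ls by (rule subgroups_Inter_pair)
  have "card (Q \<inter> L) dvd card L" using subgroup_card_dvd[OF s Ls] by simp
  then have "card (Q \<inter> L) = 1 \<or> card (Q \<inter> L) = card L" using L(2) by (simp add: prime_nat_iff)
  then show ?thesis
  proof
    assume "card (Q \<inter> L) = card L"
    then have "card ?B = card Q"
      using card_join_normal[OF fin L(1) Q(1)] subgroup_card_pos[OF fin Ls] by simp
    then have "?B = Q" using Bs subgroup_finite[OF fin Bs(1)] by (metis card_subset_eq)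
    then show ?thesis using normal_in_refl[OF Q(1)] by (simp add: modular_step_def)
  next
    assume "card (Q \<inter> L) = 1"
    then have cB: "card ?B = card L * card Q" using card_join_normal[OF fin L(1) Q(1)] by simp
    have Zn: "centraliser L \<lhd> G" using L(1) by (rule centraliser_normal)
    have Ns: "subgroup ?N G" using Q(1) normal_imp_subgroup[OF Zn] by (rule subgroups_Inter_pair)
    have "normal_in G ?N ?B"
      unfolding normal_in_def
    proof (intro conjI ballI Ns Bs(1))
      show "?N \<subseteq> ?B" using Bs(2) by blast
      fix b n assume b: "b \<in> ?B" and n: "n \<in> ?N"
      then obtain a where a: "a \<in> Q" "b \<otimes> inv a \<in> L" by (auto simp: join_normal_def)
      define l where "l = b \<otimes> inv a"
      have c: "a \<in> carrier G" "b \<in> carrier G" "n \<in> carrier G" "l \<in> carrier G"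
        using a b n Q(1) by (auto simp: join_normal_def centraliser_def subgroup.mem_carrier l_def)
      have b': "b = l \<otimes> a" using c by (simp add: l_def m_assoc)
      define n' where "n' = a \<otimes> n \<otimes> inv a"
      have n': "n' \<in> ?N" "n' \<in> carrier G"
        using n a Q(1) Zn c by (auto simp: n'_def normal_inv_iff subgroup.m_closed subgroup.m_inv_closed)
      have "n' \<otimes> l \<otimes> inv n' = l" using n' a by (simp add: centraliser_def l_def)
      then have "n' \<otimes> l = l \<otimes> n'" using c n' by (metis inv_solve_right m_closed)
      then have "l \<otimes> n' \<otimes> inv l = n'" using c n' by (metis m_assoc r_inv r_one inv_closed)
      then have "b \<otimes> n \<otimes> inv b = n'" using conj_conj[of l a n] c by (simp add: b' n'_def)
      then show "b \<otimes> n \<otimes> inv b \<in> ?N" using n' by simp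
    qed
    moreover have "card ?B dvd card L * q ^ k * card ?N"
      using q_subgroup_acting_on_prime_order[OF fin L q Q ex] by (simp add: cB mult.assoc)
    ultimately show ?thesis unfolding modular_step_def using L(2) q Q(1) Bs cB by blast
  qed
qed

lemma chief_step_modular_step_join:
  assumes fin: "finite (carrier G)" and st: "chief_step G M N" and q: "prime q"
    and Q: "subgroup Q G" "card Q = q ^ m" and ex: "\<And>x. x \<in> Q \<Longrightarrow> x [^] (q ^ k) = \<one>"
  shows "modular_step k G (join_normal G M Q) (join_normal G N Q)"
proof -
  obtain r :: nat where M: "M \<lhd> G" and N: "N \<lhd> G" and MN: "M \<subseteq> N" and r: "prime r" "card N = r * card M"
    using st by (auto simp: chief_step_def)
  have Ms: "subgroup M G" and Ns: "subgroup N G" using M N by (simp_all add: normal_imp_subgroup)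
  interpret \<phi>: finite_epi G "G Mod M" "(#>) M" using M fin by (rule quotient_finite_epi)
  have ker: "kernel G (G Mod M) ((#>) M) = M" using M by (rule kernel_quotient)
  let ?f = "(#>) M" and ?Q = "G Mod M"
  have "card (?f ` N) * card M = r * card M"
    using \<phi>.card_image[OF Ns fin] r(2) MN unfolding ker by (simp add: Int_absorb1)
  then have cL: "card (?f ` N) = r" using subgroup_card_pos[OF fin Ms] by simp
  have "card (?f ` Q) dvd q ^ m" using \<phi>.card_image[OF Q(1) fin] Q(2) by (metis dvd_triv_left)
  then obtain m' where m': "card (?f ` Q) = q ^ m'" using q by (auto simp: divides_primepow_nat)
  have "modular_step k ?Q (?f ` Q) (join_normal ?Q (?f ` N) (?f ` Q))"
  proof (rule \<phi>.H.modular_step_join_prime_order[OF \<phi>.fin_H \<phi>.image_normal[OF N] _ q _ m'])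
    show "prime (card (?f ` N))" using r cL by simp
    show "subgroup (?f ` Q) ?Q" using Q(1) by (rule \<phi>.subgroup_img_is_subgroup)
    fix X assume "X \<in> ?f ` Q"
    then obtain x where x: "x \<in> Q" "X = ?f x" by blast
    then have "X [^]\<^bsub>?Q\<^esub> (q ^ k) = ?f (x [^] (q ^ k))"
      using \<phi>.hom_nat_pow[of x "q ^ k"] Q(1) by (simp add: subgroup.mem_carrier)
    then show "X [^]\<^bsub>?Q\<^esub> (q ^ k) = \<one>\<^bsub>?Q\<^esub>" using ex[OF x(1)] \<phi>.hom_one by simp
  qed
  then have "modular_step k G (preimage G ?f (?f ` Q)) (preimage G ?f (join_normal ?Q (?f ` N) (?f ` Q)))"
    by (rule \<phi>.modular_step_preimage)
  moreover have "preimage G ?f (?f ` Q) = join_normal G M Q"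
    using join_normal_eq_preimage[OF M subgroup.subset[OF Q(1)]] by simp
  moreover have "preimage G ?f (join_normal ?Q (?f ` N) (?f ` Q)) = join_normal G N Q"
  proof -
    have "?f x \<otimes>\<^bsub>?Q\<^esub> inv\<^bsub>?Q\<^esub> ?f a \<in> ?f ` N \<longleftrightarrow> x \<otimes> inv a \<in> N" if "x \<in> carrier G" "a \<in> Q" for x a
    proof -
      have a: "a \<in> carrier G" using that Q(1) by (simp add: subgroup.mem_carrier)
      have "?f x \<otimes>\<^bsub>?Q\<^esub> inv\<^bsub>?Q\<^esub> ?f a = ?f (x \<otimes> inv a)"
        using that(1) a by (simp only: \<phi>.hom_mult \<phi>.hom_inv inv_closed)
      then have "?f x \<otimes>\<^bsub>?Q\<^esub> inv\<^bsub>?Q\<^esub> ?f a \<in> ?f ` N \<longleftrightarrow> x \<otimes> inv a \<in> preimage G ?f (?f ` N)"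
        using that a unfolding preimage_def by (metis (no_types, lifting) inv_closed m_closed mem_Collect_eq)
      also have "preimage G ?f (?f ` N) = N" using \<phi>.preimage_image[OF Ns] MN by (simp add: ker)
      finally show ?thesis .
    qed
    then show ?thesis
      unfolding join_normal_def preimage_def using \<phi>.hom_closed by blast
  qed
  ultimately show ?thesis by simp
qed

text \<open>
  This is the inclusion of \<open>class_Uk k\<close> in \<open>class_K k\<close>. Multiplying a Sylow subgroup with the terms
  of a chief series gives a chain of modular steps.
\<close>

lemma sylow_modular_steps_if_supersoluble:
  fixes e :: nat
  assumes fin: "finite (carrier G)" and ss: "(chief_step G)^** {\<one>} (carrier G)"
    and e: "\<And>x. x \<in> carrier G \<Longrightarrow> x [^] e = \<one>" and kfree: "\<And>p::nat. prime p \<Longrightarrow> \<not> p ^ (k + 1) dvd e"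
    and P: "sylow_for q P G"
  shows "(modular_step k G)^** P (carrier G)"
proof -
  have q: "prime q" and Ps: "subgroup P G" and cP: "card P = q ^ multiplicity q (order G)"
    using P by (auto simp: sylow_for_def)
  interpret Pg: group "G\<restriction>P" using Ps by (rule subgroup_group)
  have ex: "x [^] (q ^ k) = \<one>" if x: "x \<in> P" for x
  proof -
    have xc: "x \<in> carrier G" using x Ps by (simp add: subgroup.mem_carrier)
    have "x [^] card P = \<one>"
      using Pg.pow_order_eq_1[of x] x by (simp add: order_def nat_pow_consistent[symmetric])
    then have "ord x dvd q ^ multiplicity q (order G)" using xc cP by (simp add: pow_eq_id)
    then obtain j where j: "ord x = q ^ j" using q by (auto simp: divides_primepow_nat)
    have "q ^ j dvd e" using e[OF xc] pow_eq_id[OF xc] j by metis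
    then have "j \<le> k"
      using kfree[OF q] by (metis dvd_trans le_imp_power_dvd not_less_eq_eq Suc_eq_plus1)
    then have "ord x dvd q ^ k" using j by (simp add: le_imp_power_dvd)
    then show ?thesis using pow_eq_id[OF xc] by simp
  qed
  have "(modular_step k G)^** (join_normal G {\<one>} P) (join_normal G (carrier G) P)"
    using ss by (rule rtranclp_map_step[where f = "\<lambda>N. join_normal G N P"])
      (simp add: chief_step_modular_step_join[OF fin _ q Ps cP ex])
  then show ?thesis using join_normal_one[OF subgroup.subset[OF Ps]] join_normal_carrier[OF Ps] by simp
qed

section \<open>Residuals for the two formations\<close>

lemma pow_index_in_normal:
  assumes fin: "finite (carrier G)" and N: "N \<lhd> G" and c: "order G = c * card N" and x: "x \<in> carrier G"
  shows "x [^] c \<in> N"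
proof -
  have Ns: "subgroup N G" using N by (rule normal_imp_subgroup)
  interpret \<phi>: finite_epi G "G Mod N" "(#>) N" using N fin by (rule quotient_finite_epi)
  have "order (G Mod N) * card N = c * card N" using \<phi>.order_eq c unfolding kernel_quotient[OF N] by metis
  then have "order (G Mod N) = c" using subgroup_card_pos[OF fin Ns] by simp
  then have "(N #> x) [^]\<^bsub>G Mod N\<^esub> c = \<one>\<^bsub>G Mod N\<^esub>"
    using \<phi>.H.pow_order_eq_1[of "N #> x"] \<phi>.hom_closed[OF x] by simp
  then have "N #> (x [^] c) = N" using \<phi>.hom_nat_pow[OF x, of c] by simp
  then show ?thesis using rcos_self[OF _ Ns, of "x [^] c"] x by simp
qed

text \<open>
  Any exponent will do in place of the least one, since the least one divides it.
\<close>

lemma exponent_power_free_iff: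
  assumes fin: "finite (carrier G)"
  shows "(\<forall>p::nat. prime p \<longrightarrow> \<not> p ^ (k + 1) dvd group_exponent G) \<longleftrightarrow>
    (\<exists>e>0. (\<forall>x\<in>carrier G. x [^] (e::nat) = \<one>) \<and> (\<forall>p::nat. prime p \<longrightarrow> \<not> p ^ (k + 1) dvd e))"
    (is "?L \<longleftrightarrow> ?R")
proof -
  define m where "m = group_exponent G"
  have "0 < order G \<and> (\<forall>x\<in>carrier G. x [^] order G = \<one>)"
    using fin order_gt_0_iff_finite pow_order_eq_1 by simp
  then have m: "0 < m \<and> (\<forall>x\<in>carrier G. x [^] m = \<one>)"
    unfolding m_def group_exponent_def by (rule LeastI)
  have "m dvd e" if e: "\<forall>x\<in>carrier G. x [^] (e::nat) = \<one>" for e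
  proof (rule ccontr)
    assume "\<not> m dvd e"
    then have pos: "0 < e mod m" by (simp add: mod_greater_zero_iff_not_dvd)
    have "x [^] (e mod m) = \<one>" if x: "x \<in> carrier G" for x
    proof -
      have "\<one> = x [^] (m * (e div m) + e mod m)" using e x by simp
      also have "\<dots> = (x [^] m) [^] (e div m) \<otimes> x [^] (e mod m)"
        using x by (simp add: nat_pow_mult nat_pow_pow)
      also have "\<dots> = x [^] (e mod m)" using m x by simp
      finally show ?thesis by simp
    qed
    then have "m \<le> e mod m" unfolding m_def group_exponent_def using pos by (intro Least_le) (simp add: m_def group_exponent_def)
    moreover have "e mod m < m" using m by (intro mod_less_divisor) blast
    ultimately show False by linarith
  qed
  then have "p ^ (k + 1) dvd e" if "\<forall>x\<in>carrier G. x [^] (e::nat) = \<one>" "p ^ (k + 1) dvd m" for p e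
    using that dvd_trans by blast
  then show ?thesis using m unfolding m_def[symmetric] by blast
qed

lemma chief_steps_quotient_iff:
  assumes fin: "finite (carrier G)" and N: "N \<lhd> G"
  shows "(chief_step (G Mod N))^** {\<one>\<^bsub>G Mod N\<^esub>} (carrier (G Mod N)) \<longleftrightarrow> (chief_step G)^** N (carrier G)"
proof -
  have Ns: "subgroup N G" using N by (rule normal_imp_subgroup)
  interpret \<phi>: finite_epi G "G Mod N" "(#>) N" using N fin by (rule quotient_finite_epi)
  have ker: "kernel G (G Mod N) ((#>) N) = N" using N by (rule kernel_quotient)
  have imN: "((#>) N) ` N = {\<one>\<^bsub>G Mod N\<^esub>}"
    using \<phi>.image_preimage[of "{\<one>\<^bsub>G Mod N\<^esub>}"] \<phi>.H.one_closed unfolding \<phi>.preimage_one ker by blast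
  show ?thesis
  proof
    assume "(chief_step (G Mod N))^** {\<one>\<^bsub>G Mod N\<^esub>} (carrier (G Mod N))"
    then have "(chief_step G)^** (preimage G ((#>) N) {\<one>\<^bsub>G Mod N\<^esub>}) (preimage G ((#>) N) (carrier (G Mod N)))"
      by (rule rtranclp_map_step) (simp add: \<phi>.chief_step_preimage)
    then show "(chief_step G)^** N (carrier G)" unfolding \<phi>.preimage_one ker \<phi>.preimage_carrier .
  next
    assume "(chief_step G)^** N (carrier G)"
    then have "(chief_step (G Mod N))^** (((#>) N) ` N) (((#>) N) ` carrier G)"
      by (rule rtranclp_map_step) (rule \<phi>.chief_step_image)
    then show "(chief_step (G Mod N))^** {\<one>\<^bsub>G Mod N\<^esub>} (carrier (G Mod N))"
      unfolding imN \<phi>.surj .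
  qed
qed

lemma quotient_in_class_Uk_iff:
  assumes fin: "finite (carrier G)" and N: "N \<lhd> G"
  shows "G Mod N \<in> class_Uk k \<longleftrightarrow> (chief_step G)^** N (carrier G) \<and>
    (\<exists>e>0. (\<forall>x\<in>carrier G. x [^] (e::nat) \<in> N) \<and> (\<forall>p::nat. prime p \<longrightarrow> \<not> p ^ (k + 1) dvd e))"
proof -
  have Ns: "subgroup N G" using N by (rule normal_imp_subgroup)
  interpret \<phi>: finite_epi G "G Mod N" "(#>) N" using N fin by (rule quotient_finite_epi)
  have "(\<forall>X\<in>carrier (G Mod N). X [^]\<^bsub>G Mod N\<^esub> (e::nat) = \<one>\<^bsub>G Mod N\<^esub>) \<longleftrightarrow> (\<forall>x\<in>carrier G. x [^] e \<in> N)" for e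
  proof -
    have "(N #> x) [^]\<^bsub>G Mod N\<^esub> e = \<one>\<^bsub>G Mod N\<^esub> \<longleftrightarrow> x [^] e \<in> N" if x: "x \<in> carrier G" for x
    proof -
      have "(N #> x) [^]\<^bsub>G Mod N\<^esub> e = N #> (x [^] e)" using \<phi>.hom_nat_pow[OF x] by simp
      moreover have "N #> (x [^] e) = N \<longleftrightarrow> x [^] e \<in> N"
        using coset_join1[OF _ _ Ns, of "x [^] e"] coset_join2[OF _ Ns, of "x [^] e"] x by auto
      ultimately show ?thesis by simp
    qed
    then show ?thesis unfolding carrier_FactGroup by simp
  qed
  then show ?thesis
    unfolding class_Uk_def mem_Collect_eq finite_group_def
      \<phi>.H.supersoluble_iff_chief_steps[OF \<phi>.fin_H] chief_steps_quotient_iff[OF fin N]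
      \<phi>.H.exponent_power_free_iff[OF \<phi>.fin_H]
    using \<phi>.H.group_axioms \<phi>.fin_H by simp
qed

lemma quotient_in_class_K_iff:
  assumes fin: "finite (carrier G)" and k: "1 \<le> k" and N: "N \<lhd> G"
  shows "G Mod N \<in> class_K k \<longleftrightarrow> (chief_step G)^** N (carrier G) \<and>
    (\<forall>p P. sylow_for p P G \<longrightarrow> (modular_step k G)^** (join_normal G N P) (carrier G))"
proof -
  have Ns: "subgroup N G" using N by (rule normal_imp_subgroup)
  interpret \<phi>: finite_epi G "G Mod N" "(#>) N" using N fin by (rule quotient_finite_epi)
  let ?f = "(#>) N" and ?Q = "G Mod N"
  have ker: "kernel G ?Q ?f = N" using N by (rule kernel_quotient)
  have eq: "(modular_step k ?Q)^** (?f ` P) (carrier ?Q) \<longleftrightarrow> (modular_step k G)^** (join_normal G N P) (carrier G)"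
    if P: "subgroup P G" for P
  proof
    assume "(modular_step k ?Q)^** (?f ` P) (carrier ?Q)"
    then have "(modular_step k G)^** (preimage G ?f (?f ` P)) (preimage G ?f (carrier ?Q))"
      by (rule \<phi>.modular_steps_preimage)
    then show "(modular_step k G)^** (join_normal G N P) (carrier G)"
      unfolding join_normal_eq_preimage[OF N subgroup.subset[OF P]] \<phi>.preimage_carrier .
  next
    assume "(modular_step k G)^** (join_normal G N P) (carrier G)"
    then have "(modular_step k ?Q)^** (?f ` join_normal G N P) (?f ` carrier G)"
      by (rule \<phi>.modular_steps_image)
    moreover have "?f ` join_normal G N P = ?f ` P"
      unfolding join_normal_eq_preimage[OF N subgroup.subset[OF P]]
      using subgroup.subset[OF \<phi>.subgroup_img_is_subgroup[OF P]] by (rule \<phi>.image_preimage)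
    ultimately show "(modular_step k ?Q)^** (?f ` P) (carrier ?Q)" unfolding \<phi>.surj by simp
  qed
  have "(\<forall>S. sylow_subgroup S ?Q \<longrightarrow> submodular k S ?Q) \<longleftrightarrow>
      (\<forall>p P. sylow_for p P G \<longrightarrow> (modular_step k G)^** (join_normal G N P) (carrier G))" (is "?A \<longleftrightarrow> ?B")
  proof
    assume A: ?A
    show ?B
    proof (intro allI impI)
      fix p P assume P: "sylow_for p P G"
      have "sylow_subgroup (?f ` P) ?Q" using \<phi>.sylow_image[OF P] sylow_subgroup_iff by blast
      then have "(modular_step k ?Q)^** (?f ` P) (carrier ?Q)"
        using A \<phi>.H.submodular_iff_modular_steps[OF \<phi>.fin_H k] by blast
      then show "(modular_step k G)^** (join_normal G N P) (carrier G)"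
        using eq P by (simp add: sylow_for_def)
    qed
  next
    assume B: ?B
    show ?A
    proof (intro allI impI)
      fix S assume "sylow_subgroup S ?Q"
      then obtain p where S: "sylow_for p S ?Q" using sylow_subgroup_iff by blast
      then obtain P where P: "sylow_for p P G" "?f ` P = S" using \<phi>.sylow_lift by blast
      then have "(modular_step k ?Q)^** S (carrier ?Q)"
        using B eq[of P] by (auto simp: sylow_for_def)
      then show "submodular k S ?Q"
        using \<phi>.H.submodular_iff_modular_steps[OF \<phi>.fin_H k] S by (simp add: sylow_for_def)
    qed
  qed
  then show ?thesis
    unfolding class_K_def mem_Collect_eq finite_group_def
      \<phi>.H.supersoluble_iff_chief_steps[OF \<phi>.fin_H] chief_steps_quotient_iff[OF fin N]
    using \<phi>.H.group_axioms \<phi>.fin_H by simp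
qed

lemma quotient_in_class_K_if_Uk:
  assumes fin: "finite (carrier G)" and k: "1 \<le> k" and N: "N \<lhd> G" and U: "G Mod N \<in> class_Uk k"
  shows "G Mod N \<in> class_K k"
proof -
  interpret \<phi>: finite_epi G "G Mod N" "(#>) N" using N fin by (rule quotient_finite_epi)
  have ss: "supersoluble (G Mod N)" using U by (simp add: class_Uk_def)
  obtain e :: nat where e: "\<And>x. x \<in> carrier (G Mod N) \<Longrightarrow> x [^]\<^bsub>G Mod N\<^esub> e = \<one>\<^bsub>G Mod N\<^esub>"
    "\<And>p::nat. prime p \<Longrightarrow> \<not> p ^ (k + 1) dvd e"
    using U \<phi>.H.exponent_power_free_iff[OF \<phi>.fin_H, of k] unfolding class_Uk_def by blast
  have "submodular k S (G Mod N)" if S: "sylow_subgroup S (G Mod N)" for S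
  proof -
    obtain q where q: "sylow_for q S (G Mod N)" using S sylow_subgroup_iff by blast
    have "(modular_step k (G Mod N))^** S (carrier (G Mod N))"
      using \<phi>.H.sylow_modular_steps_if_supersoluble[OF \<phi>.fin_H _ e q] ss
        \<phi>.H.supersoluble_iff_chief_steps[OF \<phi>.fin_H] by blast
    then show ?thesis using \<phi>.H.submodular_iff_modular_steps[OF \<phi>.fin_H k] q by (simp add: sylow_for_def)
  qed
  then show ?thesis using U by (simp add: class_K_def class_Uk_def)
qed

lemma chief_step_Int:
  assumes fin: "finite (carrier G)" and st: "chief_step G A B" and M: "M \<lhd> G"
  shows "A \<inter> M = B \<inter> M \<or> chief_step G (A \<inter> M) (B \<inter> M)"
proof -
  have n: "A \<lhd> G" "B \<lhd> G" "A \<subseteq> B" using st by (auto simp: chief_step_def)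
  have "A \<inter> M = B \<inter> M \<or> prime_step G (A \<inter> M) (B \<inter> M)"
    using prime_step_Int[OF fin chief_step_imp_prime_step[OF st] normal_imp_subgroup[OF M]] .
  moreover have "A \<inter> M \<lhd> G" "B \<inter> M \<lhd> G" using n M by (simp_all add: normal_subgroup_intersect)
  moreover have "A \<inter> M \<subseteq> B \<inter> M" using n(3) by blast
  ultimately show ?thesis unfolding prime_step_def chief_step_def by blast
qed

text \<open>
  The chain from \<open>N\<close> to \<open>G\<close>, cut down to \<open>M\<close>, leads from \<open>N \<inter> M\<close> to \<open>M\<close>; there the chain
  from \<open>M\<close> to \<open>G\<close> takes over.
\<close>

lemma chief_steps_Int:
  assumes fin: "finite (carrier G)" and M: "M \<lhd> G"
    and cM: "(chief_step G)^** M (carrier G)" and cN: "(chief_step G)^** N (carrier G)"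
  shows "(chief_step G)^** (N \<inter> M) (carrier G)"
proof -
  have "(chief_step G)^** (N \<inter> M) (carrier G \<inter> M)"
    using cN by (rule rtranclp_map_step[where f = "\<lambda>X. X \<inter> M"]) (rule chief_step_Int[OF fin _ M])
  moreover have "carrier G \<inter> M = M" using subgroup.subset[OF normal_imp_subgroup[OF M]] by blast
  ultimately show ?thesis using cM by simp
qed

lemma class_Uk_Int:
  assumes fin: "finite (carrier G)" and M: "M \<lhd> G" and N: "N \<lhd> G"
    and U: "G Mod M \<in> class_Uk k" "G Mod N \<in> class_Uk k"
  shows "G Mod (N \<inter> M) \<in> class_Uk k"
proof -
  obtain d :: nat where d: "d > 0" "\<And>x. x \<in> carrier G \<Longrightarrow> x [^] d \<in> M" "\<And>p::nat. prime p \<Longrightarrow> \<not> p ^ (k + 1) dvd d"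
    using U(1) quotient_in_class_Uk_iff[OF fin M] by blast
  obtain e :: nat where e: "e > 0" "\<And>x. x \<in> carrier G \<Longrightarrow> x [^] e \<in> N" "\<And>p::nat. prime p \<Longrightarrow> \<not> p ^ (k + 1) dvd e"
    using U(2) quotient_in_class_Uk_iff[OF fin N] by blast
  have Ms: "subgroup M G" and Ns: "subgroup N G" using M N by (simp_all add: normal_imp_subgroup)
  have pw: "y [^] (i::nat) \<in> K" if "subgroup K G" "y \<in> K" for y i K
    using that by (induction i) (auto simp: subgroup.m_closed subgroup.one_closed)
  \<comment> \<open>The least common multiple annihilates both quotients and has no higher prime powers.\<close>
  have "x [^] lcm d e \<in> N \<inter> M" if x: "x \<in> carrier G" for x
  proof -
    obtain a b where ab: "lcm d e = d * a" "lcm d e = e * b" by (meson dvdE dvd_lcm1 dvd_lcm2)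
    have "(x [^] d) [^] a \<in> M" "(x [^] e) [^] b \<in> N" using d(2) e(2) x pw Ms Ns by auto
    then have "x [^] (d * a) \<in> M" "x [^] (e * b) \<in> N" using x by (simp_all add: nat_pow_pow)
    moreover from this have "x [^] lcm d e \<in> M" unfolding ab(1) by blast
    ultimately show ?thesis unfolding ab(2) by blast
  qed
  moreover have "\<not> p ^ (k + 1) dvd lcm d e" if p: "prime p" for p :: nat
  proof -
    have "multiplicity p d < k + 1" "multiplicity p e < k + 1"
      using d e p by (meson multiplicity_dvd' not_le)+
    then have "multiplicity p (lcm d e) < k + 1" using multiplicity_lcm[of d e p] d(1) e(1) p by simp
    moreover have "lcm d e \<noteq> 0" using d(1) e(1) by simp
    ultimately show ?thesis using p multiplicity_geI[of "lcm d e" p "k + 1"] by fastforce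
  qed
  moreover have "lcm d e > 0" using d(1) e(1) by (simp add: lcm_pos_nat)
  moreover have "(chief_step G)^** (N \<inter> M) (carrier G)"
    using chief_steps_Int[OF fin M] U quotient_in_class_Uk_iff[OF fin M] quotient_in_class_Uk_iff[OF fin N] by blast
  moreover have "N \<inter> M \<lhd> G" using N M by (rule normal_subgroup_intersect)
  ultimately show ?thesis using quotient_in_class_Uk_iff[OF fin] by blast
qed

text \<open>
  Modulo \<open>M \<inter> N\<close> the left side is a \<open>p\<close>-group: it maps to \<open>p\<close>-groups modulo \<open>M\<close> and modulo \<open>N\<close>. It
  contains a Sylow subgroup, hence equals it.
\<close>

lemma join_normal_Int:
  assumes fin: "finite (carrier G)" and M: "M \<lhd> G" and N: "N \<lhd> G" and P: "sylow_for p P G"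
  shows "join_normal G M P \<inter> join_normal G N P = join_normal G (N \<inter> M) P"
proof -
  let ?D = "join_normal G M P \<inter> join_normal G N P" and ?R = "N \<inter> M" and ?E = "join_normal G (N \<inter> M) P"
  have p: "prime p" and Ps: "subgroup P G" and cP: "card P = p ^ multiplicity p (order G)"
    using P by (auto simp: sylow_for_def)
  have Ms: "subgroup M G" and Ns: "subgroup N G" using M N by (simp_all add: normal_imp_subgroup)
  have Rn: "?R \<lhd> G" using N M by (rule normal_subgroup_intersect)
  have Rs: "subgroup ?R G" using Rn by (rule normal_imp_subgroup)
  note jM = join_normal_subgroup[OF fin M Ps] and jN = join_normal_subgroup[OF fin N Ps]
  note jR = join_normal_subgroup[OF fin Rn Ps]
  have Ds: "subgroup ?D G" using jM(1) jN(1) by (rule subgroups_Inter_pair)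
  \<comment> \<open>For \<open>V \<subseteq> K P\<close> the index of \<open>V \<inter> K\<close> in \<open>V\<close> is a power of \<open>p\<close>.\<close>
  have ppow: "\<exists>a. card V = p ^ a * card (V \<inter> K)"
    if K: "K \<lhd> G" and V: "subgroup V G" "V \<subseteq> join_normal G K P" for K V
  proof -
    interpret \<phi>: finite_epi G "G Mod K" "(#>) K" using K fin by (rule quotient_finite_epi)
    have "((#>) K) ` V \<subseteq> ((#>) K) ` P"
      using V(2) unfolding join_normal_eq_preimage[OF K subgroup.subset[OF Ps]] preimage_def by blast
    then have "card (((#>) K) ` V) dvd card (((#>) K) ` P)"
      by (rule \<phi>.H.subgroup_card_dvd[OF \<phi>.subgroup_img_is_subgroup[OF V(1)] \<phi>.subgroup_img_is_subgroup[OF Ps]])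
    also have "\<dots> dvd p ^ multiplicity p (order G)" using \<phi>.card_image[OF Ps fin] cP by (metis dvd_triv_left)
    finally obtain a where "card (((#>) K) ` V) = p ^ a" using p by (auto simp: divides_primepow_nat)
    then show ?thesis using \<phi>.card_image[OF V(1) fin] unfolding kernel_quotient[OF K] by metis
  qed
  obtain a where a: "card ?D = p ^ a * card (?D \<inter> M)" using ppow[OF M Ds] by blast
  have DM: "subgroup (?D \<inter> M) G" using Ds Ms by (rule subgroups_Inter_pair)
  \<comment> \<open>Descend from the intersection to \<open>M\<close>, and then to \<open>N \<inter> M\<close>, by \<open>p\<close>-power indices.\<close>
  obtain b where b: "card (?D \<inter> M) = p ^ b * card (?D \<inter> M \<inter> N)" using ppow[OF N DM] by blast
  have "?D \<inter> M \<inter> N = ?R" using jM(3) jN(3) by blast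
  then have cD: "card ?D = p ^ (a + b) * card ?R" using a b by (simp add: power_add mult.assoc)
  have R0: "card ?R > 0" using fin Rs by (rule subgroup_card_pos)
  interpret \<phi>: finite_epi G "G Mod ?R" "(#>) ?R" using Rn fin by (rule quotient_finite_epi)
  have ker: "kernel G (G Mod ?R) ((#>) ?R) = ?R" using Rn by (rule kernel_quotient)
  have oG: "order G = order (G Mod ?R) * card ?R" using \<phi>.order_eq unfolding ker .
  have Q0: "order (G Mod ?R) > 0" using \<phi>.fin_H \<phi>.H.order_gt_0_iff_finite by simp
  have cE: "card ?E = p ^ multiplicity p (order (G Mod ?R)) * card ?R"
  proof -
    have "card ?E = card (((#>) ?R) ` P) * card ?R"
      unfolding join_normal_eq_preimage[OF Rn subgroup.subset[OF Ps]]
      using \<phi>.card_preimage[OF \<phi>.subgroup_img_is_subgroup[OF Ps]] unfolding ker .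
    then show ?thesis using \<phi>.sylow_image[OF P] by (simp add: sylow_for_def)
  qed
  have "card ?D dvd order G"
    using subgroup_card_dvd[OF Ds subgroup_self subgroup.subset[OF Ds]] by (simp add: order_def)
  then have "p ^ (a + b) * card ?R dvd order (G Mod ?R) * card ?R" unfolding cD oG .
  then have "p ^ (a + b) dvd order (G Mod ?R)" using R0 by simp
  then have "p ^ (a + b) dvd p ^ multiplicity p (order (G Mod ?R))"
    using prime_power_dvd_imp_le_multiplicity p Q0 by blast
  then have "p ^ (a + b) \<le> p ^ multiplicity p (order (G Mod ?R))"
    using prime_gt_0_nat[OF p] by (intro dvd_imp_le) auto
  then have "card ?D \<le> card ?E" unfolding cD cE by (rule mult_right_mono) simp
  moreover have "?E \<subseteq> ?D"
    using join_normal_subset[OF Ds, of ?R P] jM(2,3) jN(2,3) by blast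
  moreover have "finite ?D" using fin Ds by (rule subgroup_finite)
  ultimately show ?thesis by (metis card_seteq)
qed

lemma class_K_Int:
  assumes fin: "finite (carrier G)" and k: "1 \<le> k" and M: "M \<lhd> G" and N: "N \<lhd> G"
    and U: "G Mod M \<in> class_K k" "G Mod N \<in> class_K k"
  shows "G Mod (N \<inter> M) \<in> class_K k"
proof -
  have "(modular_step k G)^** (join_normal G (N \<inter> M) P) (carrier G)" if P: "sylow_for p P G" for p P
  proof -
    have Ps: "subgroup P G" using P by (simp add: sylow_for_def)
    have sM: "(modular_step k G)^** (join_normal G M P) (carrier G)"
      and sN: "(modular_step k G)^** (join_normal G N P) (carrier G)"
      using U P quotient_in_class_K_iff[OF fin k M] quotient_in_class_K_iff[OF fin k N] by blast+
    have jN: "subgroup (join_normal G N P) G" using join_normal_subgroup[OF fin N Ps] by blast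
    have "(modular_step k G)^** (join_normal G M P \<inter> join_normal G N P) (carrier G \<inter> join_normal G N P)"
      using sM jN by (rule modular_steps_Int[OF fin])
    moreover have "carrier G \<inter> join_normal G N P = join_normal G N P" using subgroup.subset[OF jN] by blast
    ultimately show ?thesis using sN unfolding join_normal_Int[OF fin M N P] by simp
  qed
  moreover have "(chief_step G)^** (N \<inter> M) (carrier G)"
    using chief_steps_Int[OF fin M] U quotient_in_class_K_iff[OF fin k M] quotient_in_class_K_iff[OF fin k N] by blast
  moreover have "N \<inter> M \<lhd> G" using N M by (rule normal_subgroup_intersect)
  ultimately show ?thesis using quotient_in_class_K_iff[OF fin k] by blast
qed

lemma trivial_quotient_in_class_Uk:
  assumes fin: "finite (carrier G)" and k: "1 \<le> k"
  shows "G Mod carrier G \<in> class_Uk k"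
proof -
  have "\<not> p ^ (k + 1) dvd 1" if "prime p" for p :: nat
    using that prime_gt_1_nat[OF that] by simp
  moreover have "x [^] (1::nat) \<in> carrier G" if "x \<in> carrier G" for x using that by simp
  ultimately show ?thesis
    using quotient_in_class_Uk_iff[OF fin normal_self] zero_less_one rtranclp.rtrancl_refl by metis
qed

end

text \<open>
  The subgroups of \<open>G\<close> have their trivial quotients in the class, and the class is closed under subdirect
  products of their quotients. For finite \<open>G\<close> the residuals are then attained as least elements.
\<close>

definition formation_like :: "'a set monoid set \<Rightarrow> ('a, 'b) monoid_scheme \<Rightarrow> bool" where
  "formation_like X G \<longleftrightarrow> (\<forall>B. subgroup B G \<longrightarrow>
     G\<restriction>B Mod B \<in> X \<and>
     (\<forall>M N. M \<lhd> G\<restriction>B \<and> N \<lhd> G\<restriction>B \<and> G\<restriction>B Mod M \<in> X \<and> G\<restriction>B Mod N \<in> X \<longrightarrow>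
        G\<restriction>B Mod (N \<inter> M) \<in> X))"

lemma formation_like_class_Uk:
  assumes "group G" "finite (carrier G)" "1 \<le> k"
  shows "formation_like (class_Uk k) G"
  unfolding formation_like_def
proof (intro allI impI conjI)
  interpret group G by fact
  fix B assume B: "subgroup B G"
  interpret B: group "G\<restriction>B" using B by (rule subgroup_group)
  have fin: "finite (carrier (G\<restriction>B))" using subgroup_finite[OF assms(2) B] by simp
  show "G\<restriction>B Mod B \<in> class_Uk k"
    using B.trivial_quotient_in_class_Uk[OF fin assms(3)] by simp
  fix M N assume "M \<lhd> G\<restriction>B \<and> N \<lhd> G\<restriction>B \<and> G\<restriction>B Mod M \<in> class_Uk k \<and> G\<restriction>B Mod N \<in> class_Uk k"
  then show "G\<restriction>B Mod (N \<inter> M) \<in> class_Uk k" using B.class_Uk_Int[OF fin] by blast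
qed

lemma formation_like_class_K:
  assumes "group G" "finite (carrier G)" "1 \<le> k"
  shows "formation_like (class_K k) G"
  unfolding formation_like_def
proof (intro allI impI conjI)
  interpret group G by fact
  fix B assume B: "subgroup B G"
  interpret B: group "G\<restriction>B" using B by (rule subgroup_group)
  have fin: "finite (carrier (G\<restriction>B))" using subgroup_finite[OF assms(2) B] by simp
  show "G\<restriction>B Mod B \<in> class_K k"
    using B.quotient_in_class_K_if_Uk[OF fin assms(3) B.normal_self B.trivial_quotient_in_class_Uk[OF fin assms(3)]] by simp
  fix M N assume "M \<lhd> G\<restriction>B \<and> N \<lhd> G\<restriction>B \<and> G\<restriction>B Mod M \<in> class_K k \<and> G\<restriction>B Mod N \<in> class_K k"
  then show "G\<restriction>B Mod (N \<inter> M) \<in> class_K k" using B.class_K_Int[OF fin assms(3)] by blast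
qed

definition class_step :: "'a set monoid set \<Rightarrow> ('a, 'b) monoid_scheme \<Rightarrow> 'a set \<Rightarrow> 'a set \<Rightarrow> bool" where
  "class_step X G A B \<longleftrightarrow> subgroup A G \<and> subgroup B G \<and> A \<subseteq> B \<and>
     (\<exists>N. N \<lhd> G\<restriction>B \<and> N \<subseteq> A \<and> G\<restriction>B Mod N \<in> X)"

text \<open>
  A member of least cardinality is contained in every other one, by intersecting the two.
\<close>

lemma (in group) residual_subset_iff:
  assumes fin: "finite (carrier G)" and f: "formation_like X G" and B: "subgroup B G"
  shows "residual X (G\<restriction>B) \<subseteq> A \<longleftrightarrow> (\<exists>N. N \<lhd> G\<restriction>B \<and> N \<subseteq> A \<and> G\<restriction>B Mod N \<in> X)"
proof -
  let ?G = "G\<restriction>B"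
  interpret B: group ?G using B by (rule subgroup_group)
  have Bfin: "finite B" using fin B by (rule subgroup_finite)
  define P where "P = (\<lambda>N. N \<lhd> ?G \<and> ?G Mod N \<in> X)"
  have PB: "P B" using f B B.normal_self by (simp add: P_def formation_like_def)
  have PI: "P (N \<inter> M)" if "P M" "P N" for M N
    using that f B B.normal_subgroup_intersect by (auto simp: P_def formation_like_def)
  define R where "R = arg_min card P"
  have R: "P R" "\<And>N. P N \<Longrightarrow> card R \<le> card N"
    unfolding R_def using arg_min_nat_lemma[of P B card] PB by auto
  have least: "R \<subseteq> N" if N: "P N" for N
  proof -
    have "R \<subseteq> B" using R(1) subgroup.subset[OF normal_imp_subgroup[of R ?G]] by (simp add: P_def)
    then have "finite R" using Bfin finite_subset by blast
    moreover have "card R \<le> card (R \<inter> N)" using PI[OF N R(1)] by (rule R(2))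
    ultimately have "R \<inter> N = R" by (intro card_seteq) auto
    then show ?thesis by blast
  qed
  have "residual X ?G = R"
    unfolding residual_def by (rule Least_equality) (use R(1) least in \<open>auto simp: P_def\<close>)
  then show ?thesis using R(1) least unfolding P_def by blast
qed

lemma (in group) class_subnormal_iff:
  assumes fin: "finite (carrier G)" and f: "formation_like X G"
  shows "class_subnormal X H G \<longleftrightarrow> subgroup H G \<and> (class_step X G)^** H (carrier G)"
proof -
  have "(\<lambda>A B. subgroup A G \<and> subgroup B G \<and> A \<subseteq> B \<and> residual X (G\<restriction>B) \<subseteq> A) = class_step X G"
    using residual_subset_iff[OF fin f] unfolding class_step_def by (intro ext) blast
  then show ?thesis
    unfolding class_subnormal_def
    using subgroup_chain_iff_rtranclp[of H "\<lambda>A B. residual X (G\<restriction>B) \<subseteq> A"] subgroup_self by auto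
qed

context group begin

text \<open>
  In a soluble group a single normal step refines to steps of prime index: intersect a series of \<open>G\<close> with \<open>B\<close> and
  multiply it with \<open>A\<close>.
\<close>

lemma prime_steps_between:
  assumes fin: "finite (carrier G)" and sol: "(prime_step G)^** {\<one>} (carrier G)" and AB: "normal_in G A B"
  shows "(prime_step G)^** A B"
proof -
  have As: "subgroup A G" and B: "subgroup B G" and le: "A \<subseteq> B" using AB by (auto simp: normal_inD)
  let ?G = "G\<restriction>B"
  interpret B: group ?G using B by (rule subgroup_group)
  have Bfin: "finite (carrier ?G)" using subgroup_finite[OF fin B] by simp
  have An: "A \<lhd> ?G" using AB normal_in_iff[OF B] by blast
  let ?f = "\<lambda>x. A #>\<^bsub>?G\<^esub> x"
  interpret \<phi>: finite_epi ?G "?G Mod A" ?f using An Bfin by (rule B.quotient_finite_epi)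
  have ker: "kernel ?G (?G Mod A) ?f = A" using An by (rule B.kernel_quotient)
  have st: "prime_step G C D \<Longrightarrow> preimage ?G ?f (?f ` (C \<inter> B)) = preimage ?G ?f (?f ` (D \<inter> B)) \<or>
      prime_step G (preimage ?G ?f (?f ` (C \<inter> B))) (preimage ?G ?f (?f ` (D \<inter> B)))" for C D
  proof -
    assume "prime_step G C D"
    then consider "C \<inter> B = D \<inter> B" | "prime_step G (C \<inter> B) (D \<inter> B)" using prime_step_Int[OF fin _ B] by blast
    then show ?thesis
    proof cases
      case 2
      then have "prime_step ?G (C \<inter> B) (D \<inter> B)" using prime_step_restrict_iff[OF B, of "D \<inter> B"] by blast
      then consider "?f ` (C \<inter> B) = ?f ` (D \<inter> B)" | "prime_step (?G Mod A) (?f ` (C \<inter> B)) (?f ` (D \<inter> B))"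
        using \<phi>.prime_step_image[OF Bfin] by blast
      then show ?thesis
      proof cases
        case 2
        then have "prime_step ?G (preimage ?G ?f (?f ` (C \<inter> B))) (preimage ?G ?f (?f ` (D \<inter> B)))"
          by (rule \<phi>.prime_step_preimage)
        moreover have "preimage ?G ?f (?f ` (D \<inter> B)) \<subseteq> B" by (auto simp: preimage_def)
        ultimately show ?thesis using prime_step_restrict_iff[OF B] by blast
      qed simp
    qed simp
  qed
  have "(prime_step G)^** (preimage ?G ?f (?f ` ({\<one>} \<inter> B))) (preimage ?G ?f (?f ` (carrier G \<inter> B)))"
    using sol by (rule rtranclp_map_step[where f = "\<lambda>X. preimage ?G ?f (?f ` (X \<inter> B))"]) (rule st)
  moreover have "preimage ?G ?f (?f ` ({\<one>} \<inter> B)) = A"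
  proof -
    have "?f ` ({\<one>} \<inter> B) = {\<one>\<^bsub>?G Mod A\<^esub>}"
      using \<phi>.hom_one subgroup.one_closed[OF B] by auto
    then show ?thesis using \<phi>.preimage_one unfolding ker by simp
  qed
  moreover have "preimage ?G ?f (?f ` (carrier G \<inter> B)) = B"
    using subgroup.subset[OF B] by (auto simp: preimage_def)
  ultimately show ?thesis by simp
qed

end

section \<open>Solubility and the two characterisations\<close>

lemma rtranclp_last_step:
  assumes "R^** a b" "a \<noteq> b"
  shows "\<exists>c. R^** a c \<and> R c b \<and> c \<noteq> b"
  using assms
proof (induction rule: rtranclp_induct)
  case (step y z)
  then show ?case by (cases "y = z") auto
qed simp

context group begin

text \<open>
  Let \<open>A\<close> be a maximal normal subgroup and \<open>S\<close> a nontrivial Sylow subgroup of the simple group \<open>G / A\<close>. If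
  \<open>S\<close> were proper, the last link of its chain could not be normal, so \<open>G / A\<close> would have the proper nontrivial
  normal subgroup provided by \<open>modular_step_structure\<close>. So \<open>G / A\<close> is an \<open>r\<close>-group, in which
  a subgroup of index \<open>r\<close> is normal.
\<close>

lemma prime_index_normal_if_sylow_modular:
  assumes fin: "finite (carrier G)" and nt: "carrier G \<noteq> {\<one>}"
    and syl: "\<And>p P. sylow_for p P G \<Longrightarrow> (modular_step k G)^** P (carrier G)"
  shows "\<exists>M. prime_step G M (carrier G)"
proof -
  have "\<exists>A. (A \<lhd> G \<and> A \<noteq> carrier G) \<and> (\<forall>N. N \<lhd> G \<and> N \<noteq> carrier G \<longrightarrow> card N \<le> card A)"
  proof (rule ex_has_greatest_nat[of _ "{\<one>}" _ "Suc (order G)"])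
    show "{\<one>} \<lhd> G \<and> {\<one>} \<noteq> carrier G" using nt one_is_normal by blast
    show "\<forall>N. N \<lhd> G \<and> N \<noteq> carrier G \<longrightarrow> card N < Suc (order G)"
      using fin by (auto simp: order_def less_Suc_eq_le intro!: card_mono dest: normal_imp_subgroup subgroup.subset)
  qed
  then obtain A where A: "A \<lhd> G" "A \<noteq> carrier G"
    and max: "\<And>N. N \<lhd> G \<Longrightarrow> N \<noteq> carrier G \<Longrightarrow> card N \<le> card A" by blast
  have As: "subgroup A G" using A(1) by (rule normal_imp_subgroup)
  let ?f = "(#>) A" and ?Q = "G Mod A"
  interpret \<phi>: finite_epi G ?Q ?f using A(1) fin by (rule quotient_finite_epi)
  have ker: "kernel G ?Q ?f = A" using A(1) by (rule kernel_quotient)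
  have simple: "N = {\<one>\<^bsub>?Q\<^esub>} \<or> N = carrier ?Q" if N: "N \<lhd> ?Q" for N
  proof (rule disjCI)
    assume ne: "N \<noteq> carrier ?Q"
    have Ns: "subgroup N ?Q" using N by (rule normal_imp_subgroup)
    have im: "?f ` preimage G ?f N = N" using subgroup.subset[OF Ns] by (rule \<phi>.image_preimage)
    have "preimage G ?f N \<noteq> carrier G" using im ne \<phi>.surj by metis
    then have "card (preimage G ?f N) \<le> card A" using \<phi>.preimage_normal[OF N] by (intro max)
    moreover have "A \<subseteq> preimage G ?f N" using \<phi>.kernel_preimage[OF Ns] unfolding ker .
    ultimately have "A = preimage G ?f N"
      using subgroup_finite[OF fin \<phi>.subgroup_preimage[OF Ns]] by (intro card_seteq)
    then have "preimage G ?f N = preimage G ?f {\<one>\<^bsub>?Q\<^esub>}" using \<phi>.preimage_one ker by simp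
    then have "?f ` preimage G ?f N = ?f ` preimage G ?f {\<one>\<^bsub>?Q\<^esub>}" by (rule arg_cong)
    also have "?f ` preimage G ?f {\<one>\<^bsub>?Q\<^esub>} = {\<one>\<^bsub>?Q\<^esub>}"
      by (rule \<phi>.image_preimage) (use \<phi>.H.one_closed in blast)
    finally show "N = {\<one>\<^bsub>?Q\<^esub>}" unfolding im .
  qed
  have "order ?Q \<noteq> 1"
  proof
    assume "order ?Q = 1"
    then have "card A = card (carrier G)" using \<phi>.order_eq unfolding ker by (simp add: order_def)
    then show False using A(2) fin subgroup.subset[OF As] card_subset_eq by blast
  qed
  then obtain r where r: "prime r" "r dvd order ?Q" using prime_factor_nat by blast
  obtain P where P: "sylow_for r P G" using sylow_exists[OF fin r(1)] by blast
  let ?S = "?f ` P"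
  have S: "sylow_for r ?S ?Q" using P by (rule \<phi>.sylow_image)
  then have Ss: "subgroup ?S ?Q" and cS: "card ?S = r ^ multiplicity r (order ?Q)" by (auto simp: sylow_for_def)
  have oQ: "order ?Q > 0" using \<phi>.fin_H \<phi>.H.order_gt_0_iff_finite by simp
  have "1 \<le> multiplicity r (order ?Q)" using r oQ by (intro multiplicity_geI) auto
  then have m0: "multiplicity r (order ?Q) \<noteq> 0" by simp
  have st: "(modular_step k ?Q)^** ?S (carrier ?Q)"
    using \<phi>.modular_steps_image[OF syl[OF P]] unfolding \<phi>.surj .
  show ?thesis
  proof (cases "?S = carrier ?Q")
    case True
    obtain t where t: "multiplicity r (order ?Q) = Suc t" using m0 not0_implies_Suc by blast
    then have o: "order ?Q = r ^ t * r" using cS True by (simp add: order_def)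
    then obtain T where T: "subgroup T ?Q" "card T = r ^ t"
      using sylow_thm[OF r(1) \<phi>.H.group_axioms o \<phi>.fin_H] by blast
    have "T \<lhd> ?Q"
      using \<phi>.H.prime_index_normal_if_p_group[OF r(1) T(1), of "Suc t"] o T(2) by (simp add: mult.commute)
    then have "prime_step ?Q T (carrier ?Q)"
      unfolding prime_step_def \<phi>.H.normal_in_carrier_iff using r(1) o T(2) by (auto simp: order_def mult.commute)
    then have "prime_step G (preimage G ?f T) (preimage G ?f (carrier ?Q))" by (rule \<phi>.prime_step_preimage)
    then show ?thesis unfolding \<phi>.preimage_carrier by blast
  next
    case False
    then obtain C where C: "(modular_step k ?Q)^** ?S C" "modular_step k ?Q C (carrier ?Q)" "C \<noteq> carrier ?Q"
      using rtranclp_last_step[OF st] by blast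
    have Cs: "subgroup C ?Q" using C(2) by (rule modular_step_subgroup)
    have "?S \<subseteq> C" using C(1) by (rule \<phi>.H.modular_steps_subset)
    moreover have "card ?S \<noteq> 1" using cS m0 prime_gt_1_nat[OF r(1)] by (simp add: power_eq_1_iff)
    then have "?S \<noteq> {\<one>\<^bsub>?Q\<^esub>}" by auto
    ultimately have "C \<noteq> {\<one>\<^bsub>?Q\<^esub>}" using subgroup.one_closed[OF Ss] by blast
    then have nn: "\<not> normal_in ?Q C (carrier ?Q)"
      using simple C(3) \<phi>.H.normal_in_carrier_iff by blast
    obtain p q n :: nat and N L where p: "prime p" and "normal_in ?Q N (carrier ?Q)"
      and L: "normal_in ?Q L (carrier ?Q)" and N: "normal_in ?Q N (carrier ?Q)" "N \<subseteq> C"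
      and cL: "card L = p * card N" and cC: "card (carrier ?Q) = p * card C"
      using \<phi>.H.modular_step_structure[OF \<phi>.fin_H C(2) nn] by metis
    have N0: "card N > 0" using \<phi>.H.subgroup_card_pos[OF \<phi>.fin_H normal_inD(1)[OF N(1)]] .
    then have "card L \<noteq> 1" using cL prime_gt_1_nat[OF p] by auto
    then have "L \<noteq> {\<one>\<^bsub>?Q\<^esub>}" by auto
    then have "L = carrier ?Q" using simple L \<phi>.H.normal_in_carrier_iff by blast
    then have "card N = card C" using cL cC prime_gt_0_nat[OF p] by simp
    then have "N = C" using N(2) \<phi>.H.subgroup_finite[OF \<phi>.fin_H Cs] by (intro card_subset_eq)
    then show ?thesis using N(1) nn by blast
  qed
qed

text \<open>
  The hypothesis passes to subgroups, because their Sylow subgroups are intersections with Sylow subgroups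
  of \<open>G\<close>. So solubility follows by descending through normal subgroups of prime index.
\<close>

lemma prime_steps_if_sylow_modular:
  assumes fin: "finite (carrier G)"
    and syl: "\<And>p P. sylow_for p P G \<Longrightarrow> (modular_step k G)^** P (carrier G)"
    and B: "subgroup B G"
  shows "(prime_step G)^** {\<one>} B"
  using B
proof (induction "card B" arbitrary: B rule: less_induct)
  case less
  note B = less.prems
  show ?case
  proof (cases "B = {\<one>}")
    case False
    let ?G = "G\<restriction>B"
    interpret B: group ?G using B by (rule subgroup_group)
    have "\<exists>M. prime_step ?G M (carrier ?G)"
    proof (rule B.prime_index_normal_if_sylow_modular)
      show "finite (carrier ?G)" using subgroup_finite[OF fin B] by simp
      show "carrier ?G \<noteq> {\<one>\<^bsub>?G\<^esub>}" using False by simp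
      fix p S assume "sylow_for p S ?G"
      then obtain P where P: "sylow_for p P G" "S = P \<inter> B" using sylow_of_subgroup[OF fin B] by blast
      have "(modular_step k G)^** (P \<inter> B) (carrier G \<inter> B)"
        using fin syl[OF P(1)] B by (rule modular_steps_Int)
      moreover have "carrier G \<inter> B = B" using subgroup.subset[OF B] by blast
      ultimately show "(modular_step k ?G)^** S (carrier ?G)"
        using modular_steps_restrict_iff[OF B] P(2) by simp
    qed
    then obtain M where M: "prime_step G M B" using prime_step_restrict_iff[OF B order_refl] by auto
    then obtain r :: nat where Ms: "subgroup M G" and r: "prime r" "card B = r * card M"
      by (auto simp: prime_step_def normal_in_def)
    have "card M < card B" using r prime_gt_1_nat[OF r(1)] subgroup_card_pos[OF fin Ms] by simp
    then have "(prime_step G)^** {\<one>} M" using Ms by (rule less.hyps)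
    then show ?thesis using M by (rule rtranclp.rtrancl_into_rtrancl)
  qed simp
qed

lemma prime_steps_if_chief_steps: "(chief_step G)^** A B \<Longrightarrow> (prime_step G)^** A B"
  by (erule rtranclp_mono[THEN predicate2D, rotated]) (auto intro: chief_step_imp_prime_step)

lemma class_step_Uk_if_prime_step:
  assumes fin: "finite (carrier G)" and k: "1 \<le> k" and st: "prime_step G A B"
  shows "class_step (class_Uk k) G A B"
proof -
  obtain r :: nat where n: "normal_in G A B" and r: "prime r" "card B = r * card A"
    using st by (auto simp: prime_step_def)
  have B: "subgroup B G" using n by (rule normal_inD)
  let ?G = "G\<restriction>B"
  interpret B: group ?G using B by (rule subgroup_group)
  have Bfin: "finite (carrier ?G)" using subgroup_finite[OF fin B] by simp
  have An: "A \<lhd> ?G" using n normal_in_iff[OF B] by blast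
  have "chief_step ?G A (carrier ?G)"
    unfolding chief_step_def using An B.normal_self normal_inD(3)[OF n] r by auto
  then have "(chief_step ?G)^** A (carrier ?G)" by (rule r_into_rtranclp)
  moreover have "x [^]\<^bsub>?G\<^esub> r \<in> A" if "x \<in> carrier ?G" for x
    using B.pow_index_in_normal[OF Bfin An _ that] r(2) by (simp add: order_def)
  moreover have "\<not> p ^ (k + 1) dvd r" if p: "prime p" for p :: nat
  proof
    assume d: "p ^ (k + 1) dvd r"
    then have "p dvd r" by (metis dvd_mult_left power_add power_one_right mult.commute)
    then have "p = r" using p r(1) primes_dvd_imp_eq by blast
    then have "r ^ (k + 1) \<le> r ^ 1" using d prime_gt_0_nat[OF r(1)] by (simp add: dvd_imp_le)
    then show False using prime_gt_1_nat[OF r(1)] k by (simp only: power_increasing_iff)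
  qed
  ultimately have "?G Mod A \<in> class_Uk k"
    using B.quotient_in_class_Uk_iff[OF Bfin An] prime_gt_0_nat[OF r(1)] by blast
  then show ?thesis unfolding class_step_def using An normal_inD[OF n] by blast
qed

text \<open>
  The quotient \<open>B / N\<close> has the normal subgroup \<open>L / N\<close> of prime order with abelian quotient, and its order
  \<open>p q\<^sup>n\<close> is not divisible by a \<open>(k + 1)\<close>th power of a prime.
\<close>

lemma class_step_Uk_if_modular_step:
  assumes fin: "finite (carrier G)" and k: "1 \<le> k" and st: "modular_step k G A B" and nn: "\<not> normal_in G A B"
  shows "class_step (class_Uk k) G A B"
proof -
  obtain p q n :: nat and N L where p: "prime p" and q: "prime q" and pq: "p \<noteq> q" and n: "n \<le> k"
    and N: "normal_in G N B" and L: "normal_in G L B" and NA: "N \<subseteq> A" and NL: "N \<subseteq> L"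
    and cL: "card L = p * card N" and cN: "card B = p * q ^ n * card N"
    and comm: "\<And>u v. u \<in> B \<Longrightarrow> v \<in> B \<Longrightarrow> u \<otimes> v \<otimes> inv u \<otimes> inv v \<in> L"
    using modular_step_structure[OF fin st nn] by metis
  have B: "subgroup B G" using N by (rule normal_inD)
  let ?G = "G\<restriction>B"
  interpret B: group ?G using B by (rule subgroup_group)
  have Bfin: "finite (carrier ?G)" using subgroup_finite[OF fin B] by simp
  have Nn: "N \<lhd> ?G" and Ln: "L \<lhd> ?G" using N L normal_in_iff[OF B] by blast+
  have Ls: "subgroup L ?G" using Ln by (rule normal_imp_subgroup)
  have "chief_step ?G N L" unfolding chief_step_def using Nn Ln NL p cL by blast
  moreover have "(chief_step ?G)^** L (carrier ?G)"
  proof (rule B.chief_refinement[OF Bfin Ln B.normal_self])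
    show "L \<subseteq> carrier ?G" using normal_inD(3)[OF L] by simp
    fix x g assume "x \<in> carrier ?G" "g \<in> carrier ?G"
    then have xg: "x \<in> B" "g \<in> B" by auto
    have xc: "x \<in> carrier ?G" "g \<otimes>\<^bsub>?G\<^esub> x \<otimes>\<^bsub>?G\<^esub> inv\<^bsub>?G\<^esub> g \<in> carrier ?G"
      using xg \<open>x \<in> carrier ?G\<close> \<open>g \<in> carrier ?G\<close> by (simp_all only: B.m_closed B.inv_closed)
    have "g \<otimes>\<^bsub>?G\<^esub> x \<otimes>\<^bsub>?G\<^esub> inv\<^bsub>?G\<^esub> g \<otimes>\<^bsub>?G\<^esub> inv\<^bsub>?G\<^esub> x \<in> L"
      using comm[OF xg(2,1)] xg m_inv_consistent[OF B] by simp
    then have "g \<otimes>\<^bsub>?G\<^esub> x \<otimes>\<^bsub>?G\<^esub> inv\<^bsub>?G\<^esub> g \<in> L #>\<^bsub>?G\<^esub> x"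
      using subgroup.rcos_module[OF Ls B.group_axioms xc] by blast
    then have "L #>\<^bsub>?G\<^esub> x = L #>\<^bsub>?G\<^esub> (g \<otimes>\<^bsub>?G\<^esub> x \<otimes>\<^bsub>?G\<^esub> inv\<^bsub>?G\<^esub> g)"
      using B.repr_independence[OF _ xc(1) Ls] by blast
    moreover have "x [^]\<^bsub>?G\<^esub> (1::int) = x" using xc(1) by (rule B.int_pow_1)
    ultimately show "\<exists>i::int. L #>\<^bsub>?G\<^esub> (g \<otimes>\<^bsub>?G\<^esub> x \<otimes>\<^bsub>?G\<^esub> inv\<^bsub>?G\<^esub> g) = L #>\<^bsub>?G\<^esub> (x [^]\<^bsub>?G\<^esub> i)"
      by metis
  qed
  ultimately have ch: "(chief_step ?G)^** N (carrier ?G)" by (rule converse_rtranclp_into_rtranclp)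
  have pow: "x [^]\<^bsub>?G\<^esub> (p * q ^ n) \<in> N" if "x \<in> carrier ?G" for x
    using B.pow_index_in_normal[OF Bfin Nn _ that] cN by (simp add: order_def)
  have free: "\<not> s ^ (k + 1) dvd p * q ^ n" if s: "prime s" for s :: nat
  proof
    assume d: "s ^ (k + 1) dvd p * q ^ n"
    show False
    proof (cases "s = p")
      case True
      then have "p ^ k dvd q ^ n" using d prime_gt_0_nat[OF p] by simp
      then have "p dvd q ^ n" using k by (metis dvd_power dvd_trans less_le_trans zero_less_one)
      then show False using p q pq prime_dvd_power primes_dvd_imp_eq by blast
    next
      case False
      then have "coprime (s ^ (k + 1)) p" using primes_coprime[OF s p] by simp
      then have d': "s ^ (k + 1) dvd q ^ n" using d by (simp add: coprime_dvd_mult_right_iff)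
      then have "s dvd q ^ n" by (metis dvd_mult_left power_add power_one_right mult.commute)
      then have "s = q" using s q prime_dvd_power primes_dvd_imp_eq by blast
      then have "k + 1 \<le> n" using d' prime_gt_1_nat[OF q] by (simp only: power_dvd_imp_le)
      then show False using n by simp
    qed
  qed
  have "p * q ^ n > 0" using p q by (simp add: prime_gt_0_nat)
  then have "?G Mod N \<in> class_Uk k"
    unfolding B.quotient_in_class_Uk_iff[OF Bfin Nn] using ch pow free by blast
  then show ?thesis unfolding class_step_def using Nn NA modular_step_subgroup[OF st] by blast
qed

lemma class_steps_Uk_if_modular_steps:
  assumes fin: "finite (carrier G)" and k: "1 \<le> k" and sol: "(prime_step G)^** {\<one>} (carrier G)"
    and st: "(modular_step k G)^** A B"
  shows "(class_step (class_Uk k) G)^** A B"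
  using st
proof induction
  case (step C D)
  have "(class_step (class_Uk k) G)^** C D"
  proof (cases "normal_in G C D")
    case True
    then have "(prime_step G)^** C D" by (rule prime_steps_between[OF fin sol])
    then show ?thesis
      by (rule rtranclp_mono[THEN predicate2D, rotated]) (auto intro: class_step_Uk_if_prime_step[OF fin k])
  next
    case False
    then show ?thesis using class_step_Uk_if_modular_step[OF fin k step.hyps(2)] by blast
  qed
  then show ?case using step.IH by simp
qed simp

lemma class_step_K_if_Uk:
  assumes fin: "finite (carrier G)" and k: "1 \<le> k" and st: "class_step (class_Uk k) G A B"
  shows "class_step (class_K k) G A B"
proof -
  obtain N where A: "subgroup A G" and B: "subgroup B G" and "A \<subseteq> B"
    and N: "N \<lhd> G\<restriction>B" "N \<subseteq> A" "G\<restriction>B Mod N \<in> class_Uk k"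
    using st by (auto simp: class_step_def)
  interpret B: group "G\<restriction>B" using B by (rule subgroup_group)
  have "finite (carrier (G\<restriction>B))" using subgroup_finite[OF fin B] by simp
  then have "G\<restriction>B Mod N \<in> class_K k" using B.quotient_in_class_K_if_Uk[OF _ k N(1,3)] by blast
  then show ?thesis unfolding class_step_def using A B \<open>A \<subseteq> B\<close> N by blast
qed

lemma class_steps_K_if_Uk:
  assumes fin: "finite (carrier G)" and k: "1 \<le> k" and st: "(class_step (class_Uk k) G)^** A B"
  shows "(class_step (class_K k) G)^** A B"
  using st by (rule rtranclp_mono[THEN predicate2D, rotated]) (auto intro: class_step_K_if_Uk[OF fin k])

text \<open>
  At a link from \<open>A\<close> to \<open>B\<close> with \<open>B / N\<close> in the class and \<open>N \<subseteq> A\<close>, the chain is not continued from \<open>A\<close>,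
  which need not be submodular in \<open>B\<close>. The subgroup \<open>N P\<close> is submodular in \<open>B\<close>, since \<open>N P / N\<close> is a Sylow subgroup
  of \<open>B / N\<close>; and \<open>P\<close> is submodular in \<open>N P \<subseteq> A\<close> by intersecting its chain up to \<open>A\<close> with \<open>N P\<close>.
\<close>

lemma modular_steps_if_class_steps_K:
  assumes fin: "finite (carrier G)" and k: "1 \<le> k" and P: "sylow_for p P G"
    and st: "(class_step (class_K k) G)^** P B"
  shows "(modular_step k G)^** P B"
  using st
proof induction
  case (step A B)
  have Ps: "subgroup P G" using P by (simp add: sylow_for_def)
  obtain N where A: "subgroup A G" and B: "subgroup B G" and AB: "A \<subseteq> B"
    and N: "N \<lhd> G\<restriction>B" "N \<subseteq> A" "G\<restriction>B Mod N \<in> class_K k"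
    using step.hyps(2) by (auto simp: class_step_def)
  let ?G = "G\<restriction>B"
  interpret B: group ?G using B by (rule subgroup_group)
  have Bfin: "finite (carrier ?G)" using subgroup_finite[OF fin B] by simp
  have PA: "P \<subseteq> A" using step.IH by (rule modular_steps_subset)
  have PB: "sylow_for p P ?G" using PA AB by (intro sylow_restrict[OF fin P B]) blast
  have PsB: "subgroup P ?G" using PB by (simp add: sylow_for_def)
  let ?J = "join_normal ?G N P"
  have "(modular_step k ?G)^** ?J B"
    using B.quotient_in_class_K_iff[OF Bfin k N(1)] N(3) PB by auto
  then have top: "(modular_step k G)^** ?J B" using modular_steps_restrict_iff[OF B] by simp
  have J: "subgroup ?J ?G" "P \<subseteq> ?J" using B.join_normal_subgroup[OF Bfin N(1) PsB] by auto
  have Js: "subgroup ?J G" using J(1) subgroup_restrict_iff[OF B] by blast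
  have "subgroup A ?G" using A B AB by (simp add: subgroup_incl)
  then have JA: "?J \<subseteq> A" using N(2) PA by (rule B.join_normal_subset)
  have "(modular_step k G)^** (P \<inter> ?J) (A \<inter> ?J)" using fin step.IH Js by (rule modular_steps_Int)
  moreover have "P \<inter> ?J = P" "A \<inter> ?J = ?J" using J(2) JA by auto
  ultimately show ?case using top by simp
qed simp

end

lemma in_class_F_iff:
  assumes k: "1 \<le> k"
  shows "G \<in> class_F k \<longleftrightarrow> group G \<and> finite (carrier G) \<and>
    (\<forall>p P. sylow_for p P G \<longrightarrow> (modular_step k G)^** P (carrier G))"
proof -
  have "submodular k P G \<longleftrightarrow> (modular_step k G)^** P (carrier G)"
    if "group G" "finite (carrier G)" "sylow_for p P G" for p P
    using group.submodular_iff_modular_steps[OF that(1,2) k] that(3) by (simp add: sylow_for_def)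
  then show ?thesis
    unfolding class_F_def mem_Collect_eq finite_group_def sylow_subgroup_iff by blast
qed

lemma in_class_w_iff:
  assumes f: "group G \<Longrightarrow> finite (carrier G) \<Longrightarrow> formation_like X G"
  shows "G \<in> class_w X \<longleftrightarrow> group G \<and> finite (carrier G) \<and>
    (\<forall>p P. sylow_for p P G \<longrightarrow> (class_step X G)^** P (carrier G))"
proof -
  have "class_subnormal X P G \<longleftrightarrow> (class_step X G)^** P (carrier G)"
    if "group G" "finite (carrier G)" "sylow_for p P G" for p P
    using group.class_subnormal_iff[OF that(1,2) f[OF that(1,2)]] that(3) by (simp add: sylow_for_def)
  then show ?thesis
    unfolding class_w_def mem_Collect_eq finite_group_def sylow_subgroup_iff by blast
qed

lemma class_K_eq: "class_K k = class_U \<inter> class_F k"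
  by (auto simp: class_K_def class_U_def class_F_def)

theorem proposition1:
  fixes k :: nat
  assumes "1 \<le> k"
  shows "(class_K k :: 'a monoid set) = class_U \<inter> class_w (class_Uk k) \<and>
    (class_F k :: 'a monoid set) = class_w (class_K k)"
proof -
  have FK: "G \<in> class_F k \<longleftrightarrow> G \<in> class_w (class_K k)" for G :: "'a monoid"
  proof (cases "group G \<and> finite (carrier G)")
    case True
    then interpret group G by blast
    have fin: "finite (carrier G)" using True by blast
    have "(class_step (class_K k) G)^** P (carrier G)"
      if F: "G \<in> class_F k" and P: "sylow_for p P G" for p P
    proof -
      have syl: "\<And>p P. sylow_for p P G \<Longrightarrow> (modular_step k G)^** P (carrier G)"
        using F in_class_F_iff[OF assms] by blast
      have "(prime_step G)^** {\<one>\<^bsub>G\<^esub>} (carrier G)"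
        using fin syl subgroup_self by (rule prime_steps_if_sylow_modular)
      then show ?thesis
        using class_steps_K_if_Uk[OF fin assms class_steps_Uk_if_modular_steps[OF fin assms _ syl[OF P]]] by blast
    qed
    then show ?thesis
      using in_class_F_iff[OF assms, of G] in_class_w_iff[OF formation_like_class_K[OF _ _ assms], of G]
        modular_steps_if_class_steps_K[OF fin assms] by blast
  next
    case False
    then show ?thesis by (auto simp: class_F_def class_w_def finite_group_def)
  qed
  have KU: "G \<in> class_K k \<longleftrightarrow> G \<in> class_U \<inter> class_w (class_Uk k)" for G :: "'a monoid"
  proof (cases "group G \<and> finite (carrier G) \<and> supersoluble G")
    case True
    then interpret group G by blast
    have fin: "finite (carrier G)" using True by blast
    have "(prime_step G)^** {\<one>\<^bsub>G\<^esub>} (carrier G)"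
      using True supersoluble_iff_chief_steps[OF fin] prime_steps_if_chief_steps by blast
    then have UF: "(class_step (class_Uk k) G)^** P (carrier G)"
      if "G \<in> class_F k" "sylow_for p P G" for p P
      using class_steps_Uk_if_modular_steps[OF fin assms] that in_class_F_iff[OF assms] by blast
    have FU: "(modular_step k G)^** P (carrier G)"
      if "(class_step (class_Uk k) G)^** P (carrier G)" "sylow_for p P G" for p P
      using modular_steps_if_class_steps_K[OF fin assms that(2) class_steps_K_if_Uk[OF fin assms that(1)]] .
    have "G \<in> class_F k \<longleftrightarrow> G \<in> class_w (class_Uk k)"
      using in_class_F_iff[OF assms, of G] in_class_w_iff[OF formation_like_class_Uk[OF _ _ assms], of G] UF FU
      by blast
    then show ?thesis using class_K_eq by blast
  next
    case False
    then show ?thesis by (auto simp: class_K_def class_U_def finite_group_def)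
  qed
  show ?thesis using FK KU by blast
qed

end
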